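(* Let $\mathcal H$ be a finite-dimensional Hilbert space and $\varrho,\sigma$ density operators on $\mathcal H$. For every $\alpha\in(0,1)$, \[ \tfrac12 D_\alpha(\varrho\|\sigma)\le \overline{D}_\alpha^{\mathrm{test}}(\varrho\|\sigma)\le D_\alpha(\varrho\|\sigma). \] Moreover, the following are equivalent: (1) the second inequality is strict for every $\alpha\in(0,1)$; (2) the second inequality is strict for some $\alpha\in(0,1)$; (3) $\frac1n D_\alpha^{\mathrm{test}}(\varrho^{\otimes n}\|\sigma^{\otimes n})<D_\alpha(\varrho\|\sigma)$ for some $\alpha\in(0,1)$ and some $n\in\mathbb N$; (4) both $\beta\mapsto D_\beta(\varrho\|\sigma)$ and $\beta\mapsto D_\beta(\sigma\|\varrho)$ are strictly increasing on $(0,1)$.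
   Context: For a PSD operator $A=\sum_a aP_a$ (spectral decomposition) and $x\in\mathbb R$, $A^x:=\sum_{a>0}a^xP_a$. For probability vectors $p,q$ on a finite set and $\alpha\in(0,1)$, $D_\alpha(p\|q)=\frac{1}{\alpha-1}\log\sum_\omega p(\omega)^\alpha q(\omega)^{1-\alpha}$. A test is an operator $0\le T\le I$; $\mathcal T(X):=(\operatorname{Tr}XT,\operatorname{Tr}X(I-T))$. $D_\alpha^{\mathrm{test}}(\varrho\|\sigma):=\max_{0\le T\le I}D_\alpha(\mathcal T(\varrho)\|\mathcal T(\sigma))$ and $\overline{D}_\alpha^{\mathrm{test}}(\varrho\|\sigma):=\limsup_{n\to\infty}\frac1n D_\alpha^{\mathrm{test}}(\varrho^{\otimes n}\|\sigma^{\otimes n})$. The Petz-type Rényi divergence for $\alpha\in(0,1)$ is $D_\alpha(\varrho\|\sigma)=\frac{1}{\alpha-1}\log\operatorname{Tr}\varrho^\alpha\sigma^{1-\alpha}$ ($=+\infty$ if the trace is $0$). *)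

theory Defs
  imports Complex_Main "HOL-Library.Extended_Real" "HOL-Library.Liminf_Limsup" "Jordan_Normal_Form.Matrix"
begin

definition mtrace :: "complex mat \<Rightarrow> complex" where
  "mtrace A = (\<Sum>i<dim_row A. A $$ (i,i))"

definition adj :: "complex mat \<Rightarrow> complex mat" where
  "adj A = mat (dim_col A) (dim_row A) (\<lambda>(i,j). cnj (A $$ (j,i)))"

definition hermitian :: "complex mat \<Rightarrow> bool" where
  "hermitian A \<longleftrightarrow> dim_row A = dim_col A \<and> adj A = A"

definition psd :: "complex mat \<Rightarrow> bool" where
  "psd A \<longleftrightarrow> hermitian A \<and>
     (\<forall>v \<in> carrier_vec (dim_row A). 0 \<le> Re (\<Sum>i<dim_row A. cnj (v $ i) * (A *\<^sub>v v) $ i))"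

definition density :: "nat \<Rightarrow> complex mat \<Rightarrow> bool" where
  "density d \<rho> \<longleftrightarrow> \<rho> \<in> carrier_mat d d \<and> psd \<rho> \<and> mtrace \<rho> = 1"

definition unitary :: "complex mat \<Rightarrow> bool" where
  "unitary U \<longleftrightarrow> dim_row U = dim_col U \<and> U * adj U = 1\<^sub>m (dim_row U)"

definition diagm :: "nat \<Rightarrow> (nat \<Rightarrow> complex) \<Rightarrow> complex mat" where
  "diagm n f = mat n n (\<lambda>(i,j). if i = j then f i else 0)"

text \<open>Functional calculus A^x = sum over positive eigenvalues a of a^x P_a,
  computed from a (chosen) unitary diagonalisation A = U diag(lambda) U^*.\<close>
definition mpow :: "complex mat \<Rightarrow> real \<Rightarrow> complex mat" where
  "mpow A x = (let n = dim_row A;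
      (U, l) = (SOME (U, l). U \<in> carrier_mat n n \<and> unitary U \<and>
                   A = U * diagm n (\<lambda>i. complex_of_real (l i)) * adj U)
    in U * diagm n (\<lambda>i. if l i > 0 then complex_of_real (l i powr x) else 0) * adj U)"

definition kron :: "complex mat \<Rightarrow> complex mat \<Rightarrow> complex mat" where
  "kron A B = mat (dim_row A * dim_row B) (dim_col A * dim_col B)
     (\<lambda>(i,j). A $$ (i div dim_row B, j div dim_col B) * B $$ (i mod dim_row B, j mod dim_col B))"

fun tpow :: "nat \<Rightarrow> complex mat \<Rightarrow> complex mat" where
  "tpow 0 A = 1\<^sub>m 1"
| "tpow (Suc n) A = kron (tpow n A) A"

text \<open>Classical Renyi divergence of two-point distributions p = (p1,p2), q = (q1,q2),
  with 0^a = 0 and value +infinity when the sum vanishes (log 0 = -infinity).\<close>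
definition Dcl :: "real \<Rightarrow> real \<times> real \<Rightarrow> real \<times> real \<Rightarrow> ereal" where
  "Dcl \<alpha> p q = (let s = fst p powr \<alpha> * fst q powr (1 - \<alpha>) + snd p powr \<alpha> * snd q powr (1 - \<alpha>)
     in if s = 0 then \<infinity> else ereal (ln s / (\<alpha> - 1)))"

definition is_test :: "complex mat \<Rightarrow> bool" where
  "is_test T \<longleftrightarrow> psd T \<and> psd (1\<^sub>m (dim_row T) - T)"

definition meas :: "complex mat \<Rightarrow> complex mat \<Rightarrow> real \<times> real" where
  "meas T X = (Re (mtrace (X * T)), Re (mtrace (X * (1\<^sub>m (dim_row T) - T))))"

definition Dtest :: "real \<Rightarrow> complex mat \<Rightarrow> complex mat \<Rightarrow> ereal" where
  "Dtest \<alpha> \<rho> \<sigma> = (SUP T \<in> {T. T \<in> carrier_mat (dim_row \<rho>) (dim_row \<rho>) \<and> is_test T}.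
       Dcl \<alpha> (meas T \<rho>) (meas T \<sigma>))"

definition Dtest_bar :: "real \<Rightarrow> complex mat \<Rightarrow> complex mat \<Rightarrow> ereal" where
  "Dtest_bar \<alpha> \<rho> \<sigma> =
     limsup (\<lambda>n. ereal (1 / real (Suc n)) * Dtest \<alpha> (tpow (Suc n) \<rho>) (tpow (Suc n) \<sigma>))"

definition Dpetz :: "real \<Rightarrow> complex mat \<Rightarrow> complex mat \<Rightarrow> ereal" where
  "Dpetz \<alpha> \<rho> \<sigma> = (let s = Re (mtrace (mpow \<rho> \<alpha> * mpow \<sigma> (1 - \<alpha>)))
     in if s = 0 then \<infinity> else ereal (ln s / (\<alpha> - 1)))"

end

(*
  Diagonalise \<rho> = \<Sum> r_i |u_i><u_i| and \<sigma> = \<Sum> s_j |v_j><v_j|, and put w_ij = |<u_i,v_j>|^2. Then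
  Tr \<rho>^t \<sigma>^(1-t) = Q(t), the sum of r_i^t s_j^(1-t) w_ij over the pairs with r_i, s_j, w_ij > 0; so D_\<alpha> is the
  classical Renyi divergence of p_ij = r_i w_ij and q_ij = s_j w_ij (Nussbaum and Szkola), with log-convex Q.

  Upper bound: a test on n copies with errors a and b satisfies a + \<lambda> b \<ge> (1/2) \<Sum> min(p, \<lambda> q) over the n-fold
  product, and Cramer's theorem bounds the right-hand side below. With \<lambda> = exp(n c), where c balances the error
  exponents that a too large test divergence would force, this gives "\<le> D_\<alpha>"; and "<" when both divergences are
  strictly increasing, since then ln Q lies strictly above the line through (0,0) and (\<alpha>, ln Q(\<alpha>)) to the right
  of \<alpha>, and strictly above the line through (1,0) and (\<alpha>, ln Q(\<alpha>)) to the left of it.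

  If one of the divergences is not strictly increasing, the equality case of Hoelder's inequality makes p/q constant
  on the common support and p (or q) concentrated there. The projection onto the support of \<rho> (or \<sigma>) then attains
  D_\<alpha> for every number of copies.

  Lower bound: Audenaert's inequality yields a test with a + \<lambda> b \<le> \<lambda>^(1-\<alpha>) Q(\<alpha>)^n, and \<lambda> can be chosen such
  that both a^\<alpha> and b^(1-\<alpha>) are at most Q(\<alpha>)^(n/2).
*)

theory Submission
  imports Defs "Jordan_Normal_Form.Spectral_Radius"
begin

section \<open>Trace, adjoint and positive semidefinite matrices\<close>

text \<open>For large n, a test on n copies whose Renyi sum is below exp(n K), K < 0, has after
  relabelling its outcomes errors of order at most exp(n K/\<alpha>) and exp(n K/(1 - \<alpha>)).
  Such tests are excluded once the line L(t) = t K/\<alpha> + (1 - t) K/(1 - \<alpha>) lies strictly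
  below ln Q on [0,1]. L is the sum of the two lines that join (0,0) and (1,0) to (\<alpha>, K).
  Both are nonpositive on [0,1], so L lies below each of them, and convexity of ln Q together with
  ln Q(0), ln Q(1) \<le> 0 compares ln Q with one of them on each side of \<alpha>. For K = ln
  Q(\<alpha>) the slack left by the other line vanishes at t = 0 and t = 1; there strictness has to
  come from the divergences.

  The tilting parameter in Cramer's bound is confined to [0,1], so at an endpoint the tilted
  log-likelihood ratio may keep a drift. That drift points to the region where min(x, y) is the
  tilted weight itself, and costs nothing.\<close>

lemma dim_adj [simp]: "dim_row (adj A) = dim_col A" "dim_col (adj A) = dim_row A"
  by (simp_all add: adj_def)

lemma adj_carrier [simp]: "A \<in> carrier_mat n m \<Longrightarrow> adj A \<in> carrier_mat m n"
  by (intro carrier_matI) auto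

lemma index_adj [simp]: "i < dim_col A \<Longrightarrow> j < dim_row A \<Longrightarrow> adj A $$ (i,j) = cnj (A $$ (j,i))"
  by (simp add: adj_def)

lemma dim_diagm [simp]: "dim_row (diagm n f) = n" "dim_col (diagm n f) = n"
  by (simp_all add: diagm_def)

lemma diagm_carrier [simp]: "diagm n f \<in> carrier_mat n n"
  by (intro carrier_matI) auto

lemma index_diagm [simp]: "i < n \<Longrightarrow> j < n \<Longrightarrow> diagm n f $$ (i,j) = (if i = j then f i else 0)"
  by (simp add: diagm_def)

lemma index_mult_sum:
  assumes "i < dim_row A" "j < dim_col B" "dim_col A = dim_row B"
  shows "(A * B) $$ (i,j) = (\<Sum>k<dim_col A. A $$ (i,k) * B $$ (k,j))"
  using assms by (simp add: scalar_prod_def atLeast0LessThan)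

text \<open>Side conditions are equations between dimensions, which simp can discharge, instead of
  memberships in \<open>carrier_mat\<close>. Products are thereby normalised to the right;
  \<open>mat_alg\<close> adds distributivity in the same form.\<close>

lemma mat_assoc:
  assumes "dim_col A = dim_row B" "dim_col B = dim_row C"
  shows "(A * B) * C = A * (B * C)"
  using assms by (intro assoc_mult_mat[of _ "dim_row A" "dim_row B" _ "dim_row C" _ "dim_col C"]) auto

lemma mat_distrib_left:
  fixes A B C :: "'a::ring mat"
  assumes "dim_col A = dim_row B" "dim_row B = dim_row C" "dim_col B = dim_col C"
  shows "A * (B + C) = A * B + A * C" "A * (B - C) = A * B - A * C"
  using assms
  by (auto intro!: mult_add_distrib_mat[of _ "dim_row A" "dim_col A" _ "dim_col B"]
      mult_minus_distrib_mat[of _ "dim_row A" "dim_col A" _ "dim_col B"])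

lemma mat_distrib_right:
  fixes A B C :: "'a::ring mat"
  assumes "dim_col B = dim_row A" "dim_row B = dim_row C" "dim_col B = dim_col C"
  shows "(B + C) * A = B * A + C * A" "(B - C) * A = B * A - C * A"
  using assms
  by (auto intro!: add_mult_distrib_mat[of _ "dim_row B" "dim_col B" _ _ "dim_col A"]
      minus_mult_distrib_mat[of _ "dim_row B" "dim_col B" _ _ "dim_col A"])

lemma mat_one_mult [simp]:
  fixes A :: "'a::semiring_1 mat"
  shows "dim_row A = n \<Longrightarrow> 1\<^sub>m n * A = A" "dim_col A = n \<Longrightarrow> A * 1\<^sub>m n = A"
  by (auto intro!: left_mult_one_mat[of _ n "dim_col A"] right_mult_one_mat[of _ "dim_row A" n])

lemmas mat_alg = mat_assoc mat_distrib_left mat_distrib_right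

lemma adj_adj [simp]: "adj (adj A) = A"
  by (rule eq_matI) auto

lemma adj_mult: "dim_col A = dim_row B \<Longrightarrow> adj (A * B) = adj B * adj A"
  by (rule eq_matI) (auto simp: index_mult_sum mult.commute simp del: index_mult_mat(1))

lemma adj_add: "dim_row A = dim_row B \<Longrightarrow> dim_col A = dim_col B \<Longrightarrow> adj (A + B) = adj A + adj B"
  by (rule eq_matI) auto

lemma adj_minus: "dim_row A = dim_row B \<Longrightarrow> dim_col A = dim_col B \<Longrightarrow> adj (A - B) = adj A - adj B"
  by (rule eq_matI) auto

lemma adj_one [simp]: "adj (1\<^sub>m n) = 1\<^sub>m n"
  by (rule eq_matI) auto

lemma adj_diagm: "adj (diagm n f) = diagm n (\<lambda>i. cnj (f i))"
  by (rule eq_matI) auto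

lemma adj_diagm_of_real [simp]: "adj (diagm n (\<lambda>i. complex_of_real (f i))) = diagm n (\<lambda>i. complex_of_real (f i))"
  by (simp add: adj_diagm)

lemma diagm_mult: "diagm n f * diagm n g = diagm n (\<lambda>i. f i * g i)"
  by (rule eq_matI) (auto simp: index_mult_sum if_distrib[of "\<lambda>x. x * _"] if_distrib[of "\<lambda>x. _ * x"]
      cong: if_cong simp del: index_mult_mat(1))

lemma diagm_add: "diagm n f + diagm n g = diagm n (\<lambda>i. f i + g i)"
  by (rule eq_matI) auto

lemma diagm_minus: "diagm n f - diagm n g = diagm n (\<lambda>i. f i - g i)"
  by (rule eq_matI) auto

lemma diagm_one: "diagm n (\<lambda>i. 1) = 1\<^sub>m n"
  by (rule eq_matI) auto

lemma diagm_cong: "(\<And>i. i < n \<Longrightarrow> f i = g i) \<Longrightarrow> diagm n f = diagm n g"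
  by (rule eq_matI) auto

lemma index_diagm_mult:
  "i < n \<Longrightarrow> j < dim_col A \<Longrightarrow> dim_row A = n \<Longrightarrow> (diagm n f * A) $$ (i,j) = f i * A $$ (i,j)"
  by (auto simp: index_mult_sum if_distrib[of "\<lambda>x. x * _"] cong: if_cong simp del: index_mult_mat(1))

lemma index_mult_diagm:
  "i < dim_row A \<Longrightarrow> j < n \<Longrightarrow> dim_col A = n \<Longrightarrow> (A * diagm n f) $$ (i,j) = A $$ (i,j) * f j"
  by (auto simp: index_mult_sum if_distrib[of "\<lambda>x. _ * x"] cong: if_cong simp del: index_mult_mat(1))

lemma mtrace_mult_comm:
  assumes "dim_col A = dim_row B" "dim_row A = dim_col B"
  shows "mtrace (A * B) = mtrace (B * A)"
proof -
  have "mtrace (A * B) = (\<Sum>i<dim_row A. \<Sum>k<dim_row B. A $$ (i,k) * B $$ (k,i))"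
    using assms by (simp add: mtrace_def index_mult_sum del: index_mult_mat(1))
  also have "\<dots> = (\<Sum>k<dim_row B. \<Sum>i<dim_row A. B $$ (k,i) * A $$ (i,k))"
    by (subst sum.swap) (simp add: mult.commute)
  also have "\<dots> = mtrace (B * A)"
    using assms by (simp add: mtrace_def index_mult_sum del: index_mult_mat(1))
  finally show ?thesis .
qed

lemma mtrace_add: "dim_row A = dim_row B \<Longrightarrow> dim_col B = dim_row B \<Longrightarrow> mtrace (A + B) = mtrace A + mtrace B"
  by (simp add: mtrace_def sum.distrib)

lemma mtrace_minus: "dim_row A = dim_row B \<Longrightarrow> dim_col B = dim_row B \<Longrightarrow> mtrace (A - B) = mtrace A - mtrace B"
  by (simp add: mtrace_def sum_subtractf)

lemma mtrace_smult: "dim_col A = dim_row A \<Longrightarrow> mtrace (c \<cdot>\<^sub>m A) = c * mtrace A"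
  by (simp add: mtrace_def sum_distrib_left)

lemma unitaryD:
  assumes "unitary U"
  shows "U * adj U = 1\<^sub>m (dim_row U)" "adj U * U = 1\<^sub>m (dim_row U)" "dim_col U = dim_row U"
proof -
  show "dim_col U = dim_row U" "U * adj U = 1\<^sub>m (dim_row U)"
    using assms by (simp_all add: unitary_def)
  then show "adj U * U = 1\<^sub>m (dim_row U)"
    by (intro mat_mult_left_right_inverse[of U "dim_row U" "adj U"] carrier_matI) simp_all
qed

lemma unitaryI: "U \<in> carrier_mat n n \<Longrightarrow> U * adj U = 1\<^sub>m n \<Longrightarrow> unitary U"
  by (simp add: unitary_def)

lemma unitary_mult:
  assumes "unitary U" "unitary V" "dim_row V = dim_row U"
  shows "unitary (U * V)"
proof -
  note u = unitaryD[OF assms(1)] unitaryD[OF assms(2)]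
  have "U * V * adj (U * V) = U * (V * adj V) * adj U"
    using u(3,6) assms(3) by (simp add: adj_mult mat_assoc)
  also have "\<dots> = 1\<^sub>m (dim_row U)"
    using u(1,3,4,6) assms(3) by simp
  finally show ?thesis
    using u(6) assms(3) by (intro unitaryI[of _ "dim_row U"] carrier_matI) simp_all
qed

lemma unitary_cancel:
  assumes "unitary U" "dim_row A = dim_row U"
  shows "U * (adj U * A) = A" "adj U * (U * A) = A"
proof -
  note u = unitaryD[OF assms(1)]
  have "U * (adj U * A) = (U * adj U) * A" "adj U * (U * A) = (adj U * U) * A"
    using assms(2) u(3) by (simp_all only: mat_assoc dim_adj)
  then show "U * (adj U * A) = A" "adj U * (U * A) = A"
    using assms(2) by (simp_all only: u(1,2) mat_one_mult)
qed

lemma hermitianI: "A \<in> carrier_mat n n \<Longrightarrow> adj A = A \<Longrightarrow> hermitian A"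
  by (simp add: hermitian_def)

lemma hermitianD:
  assumes "hermitian A" shows "adj A = A" "dim_col A = dim_row A"
  using assms unfolding hermitian_def by (blast, metis)

definition qform :: "complex mat \<Rightarrow> complex vec \<Rightarrow> complex" where
  "qform A v = (\<Sum>i<dim_row A. cnj (v $ i) * (A *\<^sub>v v) $ i)"

lemma psd_iff: "psd A \<longleftrightarrow> hermitian A \<and> (\<forall>v\<in>carrier_vec (dim_row A). 0 \<le> Re (qform A v))"
  by (simp add: psd_def qform_def)

lemma psdD:
  assumes "psd A" shows "adj A = A" "dim_col A = dim_row A"
  using assms hermitianD by (auto simp: psd_iff)

lemma psd_qform: "psd A \<Longrightarrow> v \<in> carrier_vec (dim_row A) \<Longrightarrow> 0 \<le> Re (qform A v)"
  by (simp add: psd_iff)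

lemma psdI:
  assumes "A \<in> carrier_mat n n" "adj A = A" "\<And>v. v \<in> carrier_vec n \<Longrightarrow> 0 \<le> Re (qform A v)"
  shows "psd A"
  using assms hermitianI[of A n] by (simp add: psd_iff)

lemma qform_eq:
  assumes "A \<in> carrier_mat n n" "v \<in> carrier_vec n"
  shows "qform A v = (\<Sum>i<n. \<Sum>j<n. cnj (v $ i) * A $$ (i,j) * v $ j)"
  using assms by (auto simp: qform_def scalar_prod_def atLeast0LessThan sum_distrib_left mult.assoc
      intro!: sum.cong)

lemma qform_add:
  assumes "A \<in> carrier_mat n n" "B \<in> carrier_mat n n" "v \<in> carrier_vec n"
  shows "qform (A + B) v = qform A v + qform B v"
  using assms by (simp add: qform_eq[of _ n] sum.distrib ring_distribs)

lemma qform_minus: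
  assumes "A \<in> carrier_mat n n" "B \<in> carrier_mat n n" "v \<in> carrier_vec n"
  shows "qform (A - B) v = qform A v - qform B v"
  using assms by (simp add: qform_eq[of _ n] minus_carrier_mat sum_subtractf ring_distribs)

lemma qform_conj:
  assumes "A \<in> carrier_mat n n" "X \<in> carrier_mat n m" "v \<in> carrier_vec m"
  shows "qform (adj X * A * X) v = qform A (X *\<^sub>v v)"
proof -
  define w where "w = A *\<^sub>v (X *\<^sub>v v)"
  have w: "dim_vec w = n" using assms by (simp add: w_def)
  have "adj X * A \<in> carrier_mat m n" using assms by (intro carrier_matI) auto
  then have "(adj X * A * X) *\<^sub>v v = (adj X * A) *\<^sub>v (X *\<^sub>v v)"
    using assms by (intro assoc_mult_mat_vec)
  also have "\<dots> = adj X *\<^sub>v w"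
    unfolding w_def using assms
    by (intro assoc_mult_mat_vec[of _ m n _ n] adj_carrier) (auto intro: mult_mat_vec_carrier)
  finally have "qform (adj X * A * X) v = (\<Sum>i<m. cnj (v $ i) * (\<Sum>k<n. cnj (X $$ (k,i)) * w $ k))"
    using assms w by (auto simp: qform_def scalar_prod_def atLeast0LessThan intro!: sum.cong)
  also have "\<dots> = (\<Sum>k<n. \<Sum>i<m. cnj (v $ i) * (cnj (X $$ (k,i)) * w $ k))"
    by (subst sum.swap) (simp add: sum_distrib_left)
  also have "\<dots> = (\<Sum>k<n. cnj ((X *\<^sub>v v) $ k) * w $ k)"
    using assms by (auto simp: scalar_prod_def atLeast0LessThan sum_distrib_left sum_distrib_right mult_ac intro!: sum.cong)
  finally show ?thesis
    using assms by (simp add: qform_def w_def)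
qed

lemma qform_unit:
  assumes "A \<in> carrier_mat n n" "i < n"
  shows "qform A (unit_vec n i) = A $$ (i,i)"
proof -
  have "qform A (unit_vec n i) = (\<Sum>k<n. \<Sum>j<n. if k = i \<and> j = i then A $$ (i,i) else 0)"
    using assms by (subst qform_eq[of _ n]) (auto simp: unit_vec_def intro!: sum.cong)
  also have "\<dots> = (\<Sum>k<n. if k = i then A $$ (i,i) else 0)"
    using assms by (intro sum.cong) auto
  finally show ?thesis using assms by simp
qed

lemma psd_conj:
  assumes "psd A" "A \<in> carrier_mat n n" "X \<in> carrier_mat n m"
  shows "psd (adj X * A * X)"
proof (rule psdI)
  show "adj (adj X * A * X) = adj X * A * X"
    using assms psdD(1)[OF assms(1)] by (simp add: adj_mult mat_assoc)
  show "0 \<le> Re (qform (adj X * A * X) v)" if "v \<in> carrier_vec m" for v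
    unfolding qform_conj[OF assms(2,3) that]
    using assms that by (intro psd_qform) (auto intro: mult_mat_vec_carrier)
qed (use assms in \<open>auto intro!: carrier_matI\<close>)

lemma psd_add:
  assumes "psd A" "psd B" "A \<in> carrier_mat n n" "B \<in> carrier_mat n n"
  shows "psd (A + B)"
proof (rule psdI)
  show "adj (A + B) = A + B"
    using assms psdD(1)[OF assms(1)] psdD(1)[OF assms(2)] by (simp add: adj_add)
  show "0 \<le> Re (qform (A + B) v)" if "v \<in> carrier_vec n" for v
    using assms that psd_qform[of A v] psd_qform[of B v] by (simp add: qform_add)
qed (use assms in auto)

lemma psd_one: "psd (1\<^sub>m n)"
proof (rule psdI)
  have "qform (1\<^sub>m n) v = (\<Sum>i<n. complex_of_real ((cmod (v $ i))\<^sup>2))" if "v \<in> carrier_vec n" for v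
    using that by (simp add: qform_def complex_norm_square mult.commute del: of_real_power)
  then show "v \<in> carrier_vec n \<Longrightarrow> 0 \<le> Re (qform (1\<^sub>m n) v)" for v
    by (simp add: sum_nonneg)
qed auto

lemma psd_adj_mult: "psd (adj C * C)"
  using psd_conj[OF psd_one one_carrier_mat, of C "dim_row C" "dim_col C"] by simp

lemma psd_index_nonneg:
  assumes "psd A" "i < dim_row A"
  shows "0 \<le> Re (A $$ (i,i))"
proof -
  have "A \<in> carrier_mat (dim_row A) (dim_row A)"
    using psdD(2)[OF assms(1)] by (intro carrier_matI refl)
  then show ?thesis
    using psd_qform[OF assms(1), of "unit_vec (dim_row A) i"] assms(2)
    by (metis qform_unit unit_vec_carrier)
qed

lemma psd_mtrace_nonneg: "psd A \<Longrightarrow> 0 \<le> Re (mtrace A)"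
  unfolding mtrace_def Re_sum by (intro sum_nonneg psd_index_nonneg) auto

section \<open>Spectral theorem and powers of matrices\<close>

text \<open>A Householder reflection taking the first basis vector to a multiple of
  \<open>v\<close>. It replaces the completion of an eigenvector to an orthonormal basis, and being
  self-adjoint it is its own inverse.\<close>

lemma exists_hermitian_unitary_col:
  fixes v :: "complex vec"
  assumes v: "v \<in> carrier_vec n" "v \<noteq> 0\<^sub>v n" and n: "0 < n"
  obtains H k where "H \<in> carrier_mat n n" "unitary H" "adj H = H" "\<And>i. i < n \<Longrightarrow> H $$ (i,0) = k * v $ i"
proof -
  define s where "s = sqrt (\<Sum>i<n. (cmod (v $ i))\<^sup>2)"
  have s: "0 < s"
  proof -
    obtain i where "i < n" "v $ i \<noteq> 0"
      using v by (metis eq_vecI carrier_vecD index_zero_vec(1) index_zero_vec(2))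
    then have "0 < (\<Sum>i<n. (cmod (v $ i))\<^sup>2)"
      by (intro sum_pos2[of _ i]) auto
    then show ?thesis by (simp add: s_def)
  qed
  \<comment> \<open>Phase that makes \<open>u 0\<close> real and nonnegative: a self-adjoint
    \<open>H\<close> can map the first basis vector to \<open>u\<close> only if their inner product
    is real.\<close>
  define c where "c = (if v $ 0 = 0 then 1 else cnj (v $ 0) / cmod (v $ 0))"
  have c: "cmod c = 1" by (simp add: c_def norm_divide)
  define k where "k = c / s"
  define u where "u i = k * v $ i" for i
  define a where "a = cmod (v $ 0) / s"
  have u0: "u 0 = of_real a"
  proof -
    have "cnj (v $ 0) * v $ 0 = complex_of_real ((cmod (v $ 0))\<^sup>2)"
      by (simp add: complex_norm_square mult.commute del: of_real_power)
    then show ?thesis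
      by (auto simp: u_def k_def c_def a_def power2_eq_square field_simps)
  qed
  have cu: "(\<Sum>i<n. u i * cnj (u i)) = 1"
  proof -
    have "(\<Sum>i<n. u i * cnj (u i)) = of_real (\<Sum>i<n. (cmod (u i))\<^sup>2)"
      by (simp add: complex_norm_square del: of_real_power)
    also have "(\<Sum>i<n. (cmod (u i))\<^sup>2) = (\<Sum>i<n. (cmod (v $ i))\<^sup>2) / s\<^sup>2"
      using s c by (simp add: u_def k_def norm_mult norm_divide power_mult_distrib power_divide sum_divide_distrib)
    also have "\<dots> = 1"
      using s by (simp add: s_def sum_nonneg)
    finally show ?thesis by simp
  qed
  define \<delta> where "\<delta> i j = (if i = j then 1 else 0 :: complex)" for i j :: nat
  define w where "w i = \<delta> i 0 - u i" for i
  have S: "(\<Sum>i<n. w i * cnj (w i)) = of_real (2 - 2 * a)"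
  proof -
    have "(\<Sum>i<n. w i * cnj (w i)) = (\<Sum>i<n. (if i = 0 then 1 - u 0 - cnj (u 0) else 0) + u i * cnj (u i))"
      by (intro sum.cong) (auto simp: w_def \<delta>_def algebra_simps)
    also have "\<dots> = (1 - u 0 - cnj (u 0)) + 1"
      using n by (simp add: sum.distrib cu)
    finally show ?thesis by (simp add: u0)
  qed
  \<comment> \<open>The usual factor 2 over the squared norm of \<open>w\<close>, which is
    \<open>2 - 2 * a\<close> by \<open>S\<close>. For \<open>a = 1\<close> division by zero gives 0,
    so \<open>H\<close> is the identity; \<open>w\<close> vanishes in that case.\<close>
  define \<beta> where "\<beta> = 1 / (1 - a)"
  define H where "H = mat n n (\<lambda>(i,j). \<delta> i j - of_real \<beta> * w i * cnj (w j))"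
  have H: "H \<in> carrier_mat n n" by (simp add: H_def)
  have "adj H = H"
    by (rule eq_matI) (auto simp: H_def \<delta>_def)
  moreover have "H * H = 1\<^sub>m n"
  proof (rule eq_matI)
    fix i j assume "i < dim_row (1\<^sub>m n :: complex mat)" "j < dim_col (1\<^sub>m n :: complex mat)"
    then have ij: "i < n" "j < n" by auto
    have "(H * H) $$ (i,j) = (\<Sum>k<n. H $$ (i,k) * H $$ (k,j))"
      using ij H by (simp add: index_mult_sum del: index_mult_mat(1))
    also have "\<dots> = (\<Sum>k<n. (if k = i then \<delta> i j - of_real \<beta> * w i * cnj (w j) else 0)
        + (if k = j then - of_real \<beta> * w i * cnj (w j) else 0)
        + (of_real \<beta>)\<^sup>2 * w i * cnj (w j) * (w k * cnj (w k)))"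
      using ij by (intro sum.cong) (auto simp: H_def \<delta>_def algebra_simps power2_eq_square)
    also have "\<dots> = (\<delta> i j - of_real \<beta> * w i * cnj (w j)) - of_real \<beta> * w i * cnj (w j)
        + (of_real \<beta>)\<^sup>2 * w i * cnj (w j) * of_real (2 - 2 * a)"
      using ij by (simp add: sum.distrib S flip: sum_distrib_left)
    also have "\<dots> = \<delta> i j + w i * cnj (w j) * of_real (\<beta> * (\<beta> * (2 - 2 * a)  - 2))"
      by (simp add: algebra_simps power2_eq_square)
    also have "\<beta> * (\<beta> * (2 - 2 * a)  - 2) = 0"
      by (cases "a = 1") (auto simp: \<beta>_def field_simps)
    finally show "(H * H) $$ (i,j) = 1\<^sub>m n $$ (i,j)"
      using ij by (simp add: \<delta>_def)
  qed (use H in auto)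
  moreover have "H $$ (i,0) = k * v $ i" if i: "i < n" for i
  proof (cases "a = 1")
    case True
    have "of_real (\<Sum>i<n. (cmod (w i))\<^sup>2) = (\<Sum>i<n. w i * cnj (w i))"
      by (simp add: complex_norm_square del: of_real_power)
    also have "\<dots> = 0" using S True by simp
    finally have "(\<Sum>i<n. (cmod (w i))\<^sup>2) = 0" by (simp only: of_real_eq_0_iff)
    then have "w i = 0" using i by (subst (asm) sum_nonneg_eq_0_iff) auto
    then show ?thesis using i n by (simp add: H_def w_def u_def)
  next
    case False
    have "H $$ (i,0) = \<delta> i 0 - w i * of_real (\<beta> * (1 - a))"
      using i n by (simp add: H_def w_def[of 0] u0 \<delta>_def)
    also have "\<dots> = u i" using False by (simp add: \<beta>_def w_def)
    finally show ?thesis by (simp add: u_def)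
  qed
  ultimately show ?thesis
    using H that[of H k] unitaryI[of H n] by simp
qed

text \<open>Deflation: with an eigenvector in the first column of \<open>H\<close>, the first column
  of \<open>H * A * H\<close> is a multiple of a unit vector, and by self-adjointness so is the
  first row. The remaining block \<open>A'\<close> is hermitian of smaller size; \<open>E\<close> is
  its eigenbasis bordered by a 1 in the corner.\<close>

lemma spectral_theorem:
  assumes "A \<in> carrier_mat n n" "adj A = A"
  shows "\<exists>U l. U \<in> carrier_mat n n \<and> unitary U \<and> A = U * diagm n (\<lambda>i. complex_of_real (l i)) * adj U"
  using assms
proof (induction n arbitrary: A)
  case 0
  then show ?case
    by (intro exI[of _ "1\<^sub>m 0"] exI[of _ "\<lambda>_. 0"]) (auto intro!: unitaryI[of _ 0])
next
  case (Suc n)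
  note A = Suc.prems
  let ?N = "Suc n"
  have "spectrum A \<noteq> {}" using spectrum_non_empty[OF A(1)] by simp
  then obtain e v where v: "v \<in> carrier_vec ?N" "v \<noteq> 0\<^sub>v ?N" "A *\<^sub>v v = e \<cdot>\<^sub>v v"
    using A(1) by (auto simp: spectrum_def eigenvalue_def eigenvector_def)
  obtain H k where H: "H \<in> carrier_mat ?N ?N" "unitary H" "adj H = H"
    "\<And>i. i < ?N \<Longrightarrow> H $$ (i,0) = k * v $ i"
    using exists_hermitian_unitary_col[OF v(1,2)] by blast
  define B where "B = H * A * H"
  have B: "B \<in> carrier_mat ?N ?N" using A H by (simp add: B_def)
  have adjB: "adj B = B" using A H by (simp add: B_def adj_mult mat_assoc)
  have AH: "(A * H) $$ (i,0) = e * H $$ (i,0)" if "i < ?N" for i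
  proof -
    have "(A * H) $$ (i,0) = k * (\<Sum>j<?N. A $$ (i,j) * v $ j)"
      unfolding sum_distrib_left using A(1) H(1) that
      by (subst index_mult_sum) (auto simp: H(4) intro!: sum.cong simp del: sum.lessThan_Suc)
    also have "(\<Sum>j<?N. A $$ (i,j) * v $ j) = (A *\<^sub>v v) $ i"
      using A(1) v(1) that by (simp add: scalar_prod_def atLeast0LessThan del: sum.lessThan_Suc)
    finally show ?thesis using v that by (simp add: H(4))
  qed
  have HH: "H * H = 1\<^sub>m ?N" using unitaryD(1)[OF H(2)] H(1,3) by simp
  have B0: "B $$ (i,0) = (if i = 0 then e else 0)" if "i < ?N" for i
  proof -
    have "B $$ (i,0) = (H * (A * H)) $$ (i,0)"
      using A H(1) by (simp add: B_def mat_assoc)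
    also have "\<dots> = (\<Sum>j<?N. H $$ (i,j) * (A * H) $$ (j,0))"
      using A(1) H(1) that by (subst index_mult_sum) auto
    also have "\<dots> = e * (H * H) $$ (i,0)"
      using A(1) H(1) that by (subst index_mult_sum) (auto simp: AH sum_distrib_left mult_ac intro!: sum.cong simp del: index_mult_mat(1) sum.lessThan_Suc)
    finally show ?thesis using that HH by auto
  qed
  have Bsym: "B $$ (i,j) = cnj (B $$ (j,i))" if "i < ?N" "j < ?N" for i j
    using adjB B that by (metis carrier_matD index_adj)
  have e: "e = of_real (Re e)"
    using Bsym[of 0 0] B0[of 0] by (simp add: complex_eq_iff)
  define A' where "A' = mat n n (\<lambda>(i,j). B $$ (Suc i, Suc j))"
  have "adj A' = A'"
    by (rule eq_matI) (auto simp: A'_def Bsym[symmetric])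
  moreover have "A' \<in> carrier_mat n n" by (simp add: A'_def)
  ultimately obtain U' l' where U': "U' \<in> carrier_mat n n" "unitary U'"
      "A' = U' * diagm n (\<lambda>i. complex_of_real (l' i)) * adj U'"
    using Suc.IH by blast
  define E where "E = mat ?N ?N (\<lambda>(i,j). case (i,j) of (Suc i, Suc j) \<Rightarrow> U' $$ (i,j) | (0,0) \<Rightarrow> 1 | _ \<Rightarrow> 0)"
  define l where "l i = (case i of 0 \<Rightarrow> Re e | Suc i \<Rightarrow> l' i)" for i
  have E: "E \<in> carrier_mat ?N ?N" by (simp add: E_def)
  have E_sum: "(E * diagm ?N f * adj E) $$ (i,j) = E $$ (i,0) * f 0 * cnj (E $$ (j,0))
      + (\<Sum>k<n. E $$ (i, Suc k) * f (Suc k) * cnj (E $$ (j, Suc k)))" if "i < ?N" "j < ?N" for f i j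
    using E that by (subst index_mult_sum) (auto simp: index_mult_diagm sum.lessThan_Suc_shift simp del: index_mult_mat(1) sum.lessThan_Suc)
  have U'_sum: "(U' * diagm n f * adj U') $$ (i,j) = (\<Sum>k<n. U' $$ (i, k) * f k * cnj (U' $$ (j, k)))"
    if "i < n" "j < n" for f i j
    using U'(1) that by (subst index_mult_sum) (auto simp: index_mult_diagm simp del: index_mult_mat(1))
  have "E * diagm ?N (\<lambda>i. 1) * adj E = 1\<^sub>m ?N"
  proof (rule eq_matI)
    fix i j assume "i < dim_row (1\<^sub>m ?N :: complex mat)" "j < dim_col (1\<^sub>m ?N :: complex mat)"
    then have ij: "i < ?N" "j < ?N" by auto
    have U1: "U' * diagm n (\<lambda>i. 1) * adj U' = 1\<^sub>m n"
      using U' unitaryD(1)[OF U'(2)] by (simp add: diagm_one)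
    show "(E * diagm ?N (\<lambda>i. 1) * adj E) $$ (i,j) = 1\<^sub>m ?N $$ (i,j)"
      unfolding E_sum[OF ij] using ij U'_sum[of _ _ "\<lambda>i. 1", unfolded U1, symmetric]
      by (cases i; cases j) (auto simp: E_def)
  qed (use E in auto)
  then have "unitary E"
    using E by (intro unitaryI[of _ ?N]) (simp_all add: diagm_one)
  have "E * diagm ?N (\<lambda>i. complex_of_real (l i)) * adj E = B"
  proof (rule eq_matI)
    fix i j assume "i < dim_row B" "j < dim_col B"
    then have ij: "i < ?N" "j < ?N" using B by auto
    have *: "B $$ (Suc i, Suc j) = (\<Sum>k<n. U' $$ (i, k) * of_real (l' k) * cnj (U' $$ (j, k)))"
      if "i < n" "j < n" for i j
      using U'_sum[OF that, of "\<lambda>i. complex_of_real (l' i)", folded U'(3)] that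
      by (simp add: A'_def)
    have **: "B $$ (0, Suc j) = 0" if "j < n" for j
      using Bsym[of 0 "Suc j"] B0[of "Suc j"] that by simp
    show "(E * diagm ?N (\<lambda>i. complex_of_real (l i)) * adj E) $$ (i,j) = B $$ (i,j)"
      unfolding E_sum[OF ij] using ij e
      by (cases i; cases j) (auto simp: E_def B0 * ** l_def)
  qed (use E B in auto)
  moreover have "H * B * H = A"
  proof -
    have "H * B * H = (H * H) * A * (H * H)"
      unfolding B_def using H A by (simp add: mat_assoc)
    then show ?thesis using A by (simp add: HH)
  qed
  ultimately have "A = H * (E * diagm ?N (\<lambda>i. complex_of_real (l i)) * adj E) * H"
    by simp
  then have "A = (H * E) * diagm ?N (\<lambda>i. complex_of_real (l i)) * adj (H * E)"
    using E H(1,3) by (simp add: adj_mult mat_assoc)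
  moreover have "unitary (H * E)"
    using unitary_mult[OF H(2) \<open>unitary E\<close>] H(1) E by simp
  moreover have "H * E \<in> carrier_mat ?N ?N" using H E by simp
  ultimately show ?case by blast
qed

text \<open>Follows \<open>mpow\<close> in dropping eigenvalues that are not positive. In particular
  \<open>pospow a 0\<close> is the indicator of \<open>a > 0\<close>, so the zeroth power of a
  positive semidefinite matrix is its support projection.\<close>

definition pospow :: "real \<Rightarrow> real \<Rightarrow> real" where
  "pospow a x = (if a > 0 then a powr x else 0)"

lemma pospow_nonneg [simp]: "0 \<le> pospow a x"
  by (simp add: pospow_def)

lemma pospow_add: "pospow a x * pospow a y = pospow a (x + y)"
  by (simp add: pospow_def powr_add)

lemma pospow_one: "0 \<le> a \<Longrightarrow> pospow a 1 = a"
  by (auto simp: pospow_def)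

lemma pospow_mult: "0 \<le> a \<Longrightarrow> 0 \<le> b \<Longrightarrow> pospow (a * b) x = pospow a x * pospow b x"
  by (auto simp: pospow_def powr_mult zero_less_mult_iff)

text \<open>The matrix \<open>W\<close> intertwines the two diagonals, so its entries vanish unless
  the eigenvalues agree; hence it also intertwines their images under \<open>f\<close>. This makes
  \<open>mpow\<close> independent of the chosen diagonalisation.\<close>

lemma functional_calculus_unique:
  assumes U: "U \<in> carrier_mat n n" "unitary U" and V: "V \<in> carrier_mat n n" "unitary V"
    and eq: "U * diagm n (\<lambda>i. complex_of_real (l i)) * adj U = V * diagm n (\<lambda>i. complex_of_real (m i)) * adj V"
  shows "U * diagm n (\<lambda>i. complex_of_real (f (l i))) * adj U = V * diagm n (\<lambda>i. complex_of_real (f (m i))) * adj V"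
proof -
  define W where "W = adj V * U"
  have W: "W \<in> carrier_mat n n" unfolding W_def using U V by (intro carrier_matI) simp_all
  let ?D = "\<lambda>l. diagm n (\<lambda>i. complex_of_real (l i))"
  have "W * ?D l = adj V * (U * ?D l * adj U) * U"
    using U V unitaryD(2)[OF U(2)] by (simp add: W_def mat_assoc)
  also have "\<dots> = ?D m * W"
    unfolding eq using U V unitary_cancel(2)[OF V(2)] by (simp add: W_def mat_assoc)
  finally have *: "W * ?D l = ?D m * W" .
  have "W $$ (i,j) * l j = m i * W $$ (i,j)" if "i < n" "j < n" for i j
  proof -
    have "(W * ?D l) $$ (i,j) = (?D m * W) $$ (i,j)" by (simp add: *)
    then show ?thesis using that W by (simp add: index_diagm_mult index_mult_diagm del: index_mult_mat(1))
  qed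
  then have "W $$ (i,j) = 0 \<or> l j = m i" if "i < n" "j < n" for i j
    using that by (metis mult.commute mult_cancel_left of_real_eq_iff)
  then have **: "W * ?D (\<lambda>i. f (l i)) = ?D (\<lambda>i. f (m i)) * W"
    using W by (intro eq_matI) (fastforce simp: index_diagm_mult index_mult_diagm simp del: index_mult_mat(1))+
  have "U * ?D (\<lambda>i. f (l i)) * adj U = V * (W * ?D (\<lambda>i. f (l i))) * adj U"
    using U V unitary_cancel(1)[OF V(2)] by (simp add: W_def mat_assoc)
  also have "\<dots> = V * ?D (\<lambda>i. f (m i)) * adj V"
    unfolding ** using U V unitaryD(1)[OF U(2)] by (simp add: W_def mat_assoc)
  finally show ?thesis .
qed

lemma mpow_eq:
  assumes "U \<in> carrier_mat n n" "unitary U" "A = U * diagm n (\<lambda>i. complex_of_real (l i)) * adj U"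
  shows "mpow A x = U * diagm n (\<lambda>i. complex_of_real (pospow (l i) x)) * adj U"
proof -
  let ?P = "\<lambda>p. case p of (U, l) \<Rightarrow> U \<in> carrier_mat n n \<and> unitary U \<and>
                   A = U * diagm n (\<lambda>i. complex_of_real (l i)) * adj U"
  obtain V m where Vm: "(SOME p. ?P p) = (V, m)" by (cases "SOME p. ?P p") auto
  have "?P (U, l)" using assms by simp
  then have "?P (SOME p. ?P p)" by (rule someI)
  then have V: "V \<in> carrier_mat n n" "unitary V" "A = V * diagm n (\<lambda>i. complex_of_real (m i)) * adj V"
    unfolding Vm by blast+
  have "dim_row A = n" unfolding assms(3) using assms(1) by simp
  then have "mpow A x = V * diagm n (\<lambda>i. complex_of_real (pospow (m i) x)) * adj V"
    by (simp add: mpow_def Vm pospow_def if_distrib[of complex_of_real] cong: if_cong)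
  also have "\<dots> = U * diagm n (\<lambda>i. complex_of_real (pospow (l i) x)) * adj U"
    by (rule functional_calculus_unique[OF V(1,2) assms(1,2) trans[OF V(3)[symmetric] assms(3)]])
  finally show ?thesis .
qed

lemma psd_spectral:
  assumes "psd A" "A \<in> carrier_mat n n"
  obtains U l where "U \<in> carrier_mat n n" "unitary U" "A = U * diagm n (\<lambda>i. complex_of_real (l i)) * adj U"
    "\<And>i. 0 \<le> l i"
proof -
  obtain U l where U: "U \<in> carrier_mat n n" "unitary U" "A = U * diagm n (\<lambda>i. complex_of_real (l i)) * adj U"
    using spectral_theorem[OF assms(2) psdD(1)[OF assms(1)]] by blast
  have "adj U * A * U = diagm n (\<lambda>i. complex_of_real (l i))"
    using U unitary_cancel(2)[OF U(2)] unitaryD(2)[OF U(2)] by (simp add: mat_assoc)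
  then have l: "0 \<le> l i" if "i < n" for i
    using psd_index_nonneg[OF psd_conj[OF assms U(1)], of i] that U(1) by simp
  \<comment> \<open>Values of \<open>l\<close> at indices from \<open>n\<close> on are arbitrary;
    truncation at 0 makes all of them nonnegative without changing the matrix.\<close>
  have "A = U * diagm n (\<lambda>i. complex_of_real (max 0 (l i))) * adj U"
    unfolding U(3) using l by (intro arg_cong2[of _ _ _ _ "(*)"] diagm_cong refl) (auto simp: max_def)
  then show ?thesis using U that[of U "\<lambda>i. max 0 (l i)"] by simp
qed

lemma psd_diag_conj:
  assumes "\<And>i. i < n \<Longrightarrow> 0 \<le> l i" "U \<in> carrier_mat m n"
  shows "psd (U * diagm n (\<lambda>i. complex_of_real (l i)) * adj U)"
proof -
  let ?C = "diagm n (\<lambda>i. complex_of_real (sqrt (l i))) * adj U"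
  have "diagm n (\<lambda>i. complex_of_real (sqrt (l i))) * diagm n (\<lambda>i. complex_of_real (sqrt (l i)))
     = diagm n (\<lambda>i. complex_of_real (l i))"
    unfolding diagm_mult using assms(1) by (intro diagm_cong) (simp flip: of_real_mult)
  moreover have "adj ?C * ?C = U * (diagm n (\<lambda>i. complex_of_real (sqrt (l i)))
      * diagm n (\<lambda>i. complex_of_real (sqrt (l i)))) * adj U"
    using assms(2) by (simp add: adj_mult mat_assoc)
  ultimately show ?thesis using psd_adj_mult[of ?C] by simp
qed

lemma mpow_carrier [simp]:
  assumes "psd A" "A \<in> carrier_mat n n"
  shows "mpow A x \<in> carrier_mat n n"
  using psd_spectral[OF assms] by (metis mpow_eq adj_carrier diagm_carrier mult_carrier_mat)

lemma dim_mpow [simp]: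
  assumes "psd A"
  shows "dim_row (mpow A x) = dim_row A" "dim_col (mpow A x) = dim_row A"
proof -
  have "A \<in> carrier_mat (dim_row A) (dim_row A)"
    using psdD(2)[OF assms(1)] by (intro carrier_matI refl)
  from mpow_carrier[OF assms this]
  show "dim_row (mpow A x) = dim_row A" "dim_col (mpow A x) = dim_row A" by blast+
qed

lemma mpow_psd:
  assumes "psd A" "A \<in> carrier_mat n n"
  shows "psd (mpow A x)"
proof -
  obtain U l where U: "U \<in> carrier_mat n n" "unitary U" "A = U * diagm n (\<lambda>i. complex_of_real (l i)) * adj U"
    "\<And>i. 0 \<le> l i" using psd_spectral[OF assms] by blast
  show ?thesis unfolding mpow_eq[OF U(1-3)] by (intro psd_diag_conj[OF _ U(1)]) simp
qed

lemma mpow_mult: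
  assumes "psd A" "A \<in> carrier_mat n n"
  shows "mpow A x * mpow A y = mpow A (x + y)"
proof -
  obtain U l where U: "U \<in> carrier_mat n n" "unitary U" "A = U * diagm n (\<lambda>i. complex_of_real (l i)) * adj U"
    "\<And>i. 0 \<le> l i" using psd_spectral[OF assms] by blast
  let ?D = "\<lambda>x. diagm n (\<lambda>i. complex_of_real (pospow (l i) x))"
  have "?D x * ?D y = ?D (x + y)" by (simp add: diagm_mult flip: pospow_add)
  moreover have "(U * ?D x * adj U) * (U * ?D y * adj U) = U * (?D x * ?D y) * adj U"
    using U(1) unitary_cancel(2)[OF U(2)] by (simp add: mat_assoc)
  ultimately show ?thesis unfolding mpow_eq[OF U(1-3)] by simp
qed

lemma mpow_1:
  assumes "psd A" "A \<in> carrier_mat n n"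
  shows "mpow A 1 = A"
proof -
  obtain U l where U: "U \<in> carrier_mat n n" "unitary U" "A = U * diagm n (\<lambda>i. complex_of_real (l i)) * adj U"
    "\<And>i. 0 \<le> l i" using psd_spectral[OF assms] by blast
  show ?thesis unfolding mpow_eq[OF U(1-3)] by (simp add: pospow_one U(3,4))
qed

text \<open>Cyclicity turns the trace into that of \<open>B\<close> conjugated by the square root of
  \<open>A\<close>.\<close>

lemma mtrace_psd_mult_nonneg:
  assumes "psd A" "psd B" "A \<in> carrier_mat n n" "B \<in> carrier_mat n n"
  shows "0 \<le> Re (mtrace (A * B))"
proof -
  let ?C = "mpow A (1/2)"
  have C: "?C \<in> carrier_mat n n" "adj ?C = ?C"
    using assms mpow_psd psdD(1) by auto
  have "A * B = ?C * (?C * B)"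
    using C assms mpow_mult[OF assms(1,3), of "1/2" "1/2"] mpow_1[OF assms(1,3)]
    by (simp add: mat_assoc[symmetric])
  then have "mtrace (A * B) = mtrace (adj ?C * B * ?C)"
    using C assms by (simp add: mtrace_mult_comm[of ?C "?C * B"])
  then show ?thesis
    using psd_mtrace_nonneg[OF psd_conj[OF assms(2,4) C(1)]] by simp
qed

section \<open>The Loewner-Heinz and Audenaert inequalities\<close>

lemma mpow_adj [simp]: "psd A \<Longrightarrow> A \<in> carrier_mat n n \<Longrightarrow> adj (mpow A x) = mpow A x"
  by (rule psdD(1)[OF mpow_psd])

lemma mpow_mult_left:
  assumes "psd A" "A \<in> carrier_mat n n" "dim_row X = n"
  shows "mpow A x * (mpow A y * X) = mpow A (x + y) * X"
proof -
  have "mpow A x * (mpow A y * X) = (mpow A x * mpow A y) * X"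
    using assms by (subst mat_assoc) auto
  then show ?thesis using mpow_mult[OF assms(1,2)] by simp
qed

lemma qform_diag_conj:
  assumes "U \<in> carrier_mat n n" "v \<in> carrier_vec n"
  shows "qform (U * diagm n (\<lambda>i. complex_of_real (f i)) * adj U) v
    = complex_of_real (\<Sum>i<n. f i * (cmod ((adj U *\<^sub>v v) $ i))\<^sup>2)"
proof -
  define w where "w = adj U *\<^sub>v v"
  have w: "w \<in> carrier_vec n" unfolding w_def using assms by (intro carrier_vecI) simp
  have "qform (U * diagm n (\<lambda>i. complex_of_real (f i)) * adj U) v = qform (diagm n (\<lambda>i. complex_of_real (f i))) w"
    using qform_conj[of "diagm n (\<lambda>i. complex_of_real (f i))" n "adj U" n v] assms by (simp add: w_def)
  also have "\<dots> = (\<Sum>i<n. \<Sum>j<n. if j = i then of_real (f i) * (w $ i * cnj (w $ i)) else 0)"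
    unfolding qform_eq[OF diagm_carrier w] by (intro sum.cong refl) auto
  also have "\<dots> = (\<Sum>i<n. complex_of_real (f i * (cmod (w $ i))\<^sup>2))"
    by (simp add: complex_norm_square del: of_real_power)
  finally show ?thesis by (simp add: w_def)
qed

text \<open>The points of \<open>S\<close> nearest to a missing \<open>x\<close> on either side
  would have their midpoint in \<open>S\<close> as well. Applied to the set of exponents at which
  powers are monotone.\<close>

lemma closed_midpoint_convex_superset:
  fixes S :: "real set"
  assumes "closed S" "0 \<in> S" "1 \<in> S" and mid: "\<And>a b. a \<in> S \<Longrightarrow> b \<in> S \<Longrightarrow> (a + b) / 2 \<in> S"
  shows "{0..1} \<subseteq> S"
proof
  fix x :: real assume x: "x \<in> {0..1}"
  show "x \<in> S"
  proof (rule ccontr)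
    assume "x \<notin> S"
    have "compact ({0..x} \<inter> S)" "compact ({x..1} \<inter> S)"
      using assms(1) by auto
    moreover have "{0..x} \<inter> S \<noteq> {}" "{x..1} \<inter> S \<noteq> {}" using assms(2,3) x by auto
    ultimately obtain l u where l: "l \<in> {0..x} \<inter> S" "\<And>t. t \<in> {0..x} \<inter> S \<Longrightarrow> t \<le> l"
      and u: "u \<in> {x..1} \<inter> S" "\<And>t. t \<in> {x..1} \<inter> S \<Longrightarrow> u \<le> t"
      by (metis compact_attains_inf compact_attains_sup)
    then have "l < x" "x < u" using \<open>x \<notin> S\<close> by (auto simp: less_le)
    moreover have "(l + u) / 2 \<in> S" using mid l u by blast
    ultimately show False using l(1) u(1) l(2)[of "(l + u) / 2"] u(2)[of "(l + u) / 2"]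
      by (cases "(l + u) / 2 \<le> x") auto
  qed
qed

text \<open>Pedersen's argument: an eigenvalue of \<open>B\<^sup>-\<^sup>m\<^sup>/\<^sup>2 A\<^sup>m B\<^sup>-\<^sup>m\<^sup>/\<^sup>2\<close> is also an eigenvalue of the similar
  matrix \<open>B\<^sup>-\<^sup>s\<^sup>/\<^sup>2 A\<^sup>m B\<^sup>-\<^sup>t\<^sup>/\<^sup>2 = (A\<^sup>s\<^sup>/\<^sup>2 B\<^sup>-\<^sup>s\<^sup>/\<^sup>2)\<^sup>* (A\<^sup>t\<^sup>/\<^sup>2 B\<^sup>-\<^sup>t\<^sup>/\<^sup>2)\<close>, a product of two contractions.
  The columns of \<open>W\<close> below are the eigenvectors of the latter.\<close>

lemma mpow_mono_midpoint:
  assumes A: "psd A" "A \<in> carrier_mat n n" and B: "psd B" "B \<in> carrier_mat n n" "mpow B 0 = 1\<^sub>m n"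
    and s: "psd (mpow B s - mpow A s)" and t: "psd (mpow B t - mpow A t)" and m: "m = (s + t) / 2"
  shows "psd (mpow B m - mpow A m)"
proof -
  note mm = mpow_mult[OF A(1,2)] mpow_mult[OF B(1,2)] mpow_mult_left[OF A(1,2)] mpow_mult_left[OF B(1,2)]
  have dims: "dim_row A = n" "dim_row B = n" using A B by auto
  define C where "C = mpow B (-m/2) * mpow A m * mpow B (-m/2)"
  have psdC: "psd C"
    using psd_conj[OF mpow_psd[OF A, of m] mpow_carrier[OF A, of m] mpow_carrier[OF B(1,2), of "-m/2"]] A B
    by (simp add: C_def)
  have C: "C \<in> carrier_mat n n"
    unfolding C_def using A B by (intro carrier_matI) auto
  obtain Y \<mu> where Y: "Y \<in> carrier_mat n n" "unitary Y"
    "C = Y * diagm n (\<lambda>i. complex_of_real (\<mu> i)) * adj Y"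
    using spectral_theorem[OF C psdD(1)[OF psdC]] by blast
  let ?M = "diagm n (\<lambda>i. complex_of_real (\<mu> i))"
  have Yd: "dim_row Y = n" "dim_col Y = n" using Y by auto
  have CY: "C * Y = Y * ?M"
    unfolding Y(3) using Yd unitaryD(2)[OF Y(2)] by (simp add: mat_assoc)
  define W where "W = mpow B ((t-m)/2) * Y"
  have Wd: "dim_row W = n" "dim_col W = n" using Yd A B dims by (auto simp: W_def)
  define P where "P = mpow A (s/2) * (mpow B (-s/2) * W)"
  define Q where "Q = mpow A (t/2) * (mpow B (-t/2) * W)"
  have Pd: "dim_row P = n" "dim_col P = n" "dim_row Q = n" "dim_col Q = n"
    using A B dims Wd by (auto simp: P_def Q_def)
  define G where "G = adj W * W"
  have Gd: "dim_row G = n" "dim_col G = n" using Wd by (auto simp: G_def)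
  have "adj P * Q = G * ?M"
  proof -
    have e1: "(t - m) / 2 - s / 2 = (t - m) + - m / 2"  "- t / 2 + (t - m) / 2 = - m / 2" "s / 2 + t / 2 = m"
      using m by (auto simp: field_simps)
    have "adj P * Q = adj Y * (mpow B ((t-m)/2 - s/2) * (mpow A (s/2 + t/2) * (mpow B (-t/2 + (t-m)/2) * Y)))"
      using A B dims Wd Yd by (simp add: P_def Q_def W_def adj_mult mat_assoc mm)
    also have "\<dots> = adj Y * (mpow B (t-m) * (C * Y))"
      unfolding e1 using A B dims Yd by (simp add: C_def mat_assoc mm)
    also have "\<dots> = adj W * W * ?M"
      unfolding CY using A B dims Yd by (simp add: W_def adj_mult mat_assoc mm)
    finally show ?thesis by (simp add: G_def)
  qed
  \<comment> \<open>Conjugating \<open>mpow B r - mpow A r\<close> by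
    \<open>mpow B (-r/2) * W\<close> expresses that \<open>mpow A (r/2) * mpow B (-r/2)\<close> is a
    contraction.\<close>
  moreover have GP: "psd (G - adj X * X)"
    if X: "X = mpow A (r/2) * (mpow B (-r/2) * W)" and r: "psd (mpow B r - mpow A r)" for X r
  proof -
    let ?R = "mpow B (-r/2) * W"
    have Rd: "dim_row ?R = n" "dim_col ?R = n" using A B dims Wd by auto
    have "psd (adj ?R * (mpow B r - mpow A r) * ?R)"
      using A B dims Rd by (intro psd_conj[OF r, of n _ n] carrier_matI) auto
    moreover have "adj ?R * (mpow B r - mpow A r) * ?R = adj ?R * (mpow B r * ?R) - adj ?R * (mpow A r * ?R)"
      using A B dims Rd by (simp add: mat_alg)
    moreover have "adj ?R * (mpow B r * ?R) = G"
      using A B dims Wd by (simp add: adj_mult mat_assoc mm G_def)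
    moreover have "adj ?R * (mpow A r * ?R) = adj X * X"
      using A B dims Wd by (simp add: X adj_mult mat_assoc mm)
    ultimately show ?thesis by simp
  qed
  have "\<mu> k \<le> 1" if k: "k < n" for k
  proof -
    have G_kk: "G $$ (k,k) = of_real (\<Sum>i<n. (cmod (W $$ (i,k)))\<^sup>2)"
      unfolding G_def using Wd k
      by (subst index_mult_sum) (auto simp: complex_norm_square mult.commute simp del: of_real_power)
    \<comment> \<open>Column \<open>k\<close> of \<open>W\<close> is not zero: \<open>B\<close> is
      invertible by the hypothesis on \<open>mpow B 0\<close>, so column \<open>k\<close> of the
      unitary \<open>Y\<close> is recovered from it.\<close>
    have "(\<Sum>i<n. (cmod (W $$ (i,k)))\<^sup>2) \<noteq> 0"
    proof
      assume "(\<Sum>i<n. (cmod (W $$ (i,k)))\<^sup>2) = 0"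
      then have W0: "W $$ (i,k) = 0" if "i < n" for i
        using that by (subst (asm) sum_nonneg_eq_0_iff) auto
      have "mpow B (-(t-m)/2) * W = Y"
        using A B dims Yd by (simp add: W_def mm flip: add_divide_distrib)
      then have "Y $$ (i,k) = (mpow B (-(t-m)/2) * W) $$ (i,k)" for i by simp
      then have Y0: "Y $$ (i,k) = 0" if "i < n" for i
        using A B dims Wd k that W0 by (simp add: index_mult_sum del: index_mult_mat(1))
      have "(adj Y * Y) $$ (k,k) = 0"
        using Yd k Y0 by (simp add: index_mult_sum del: index_mult_mat(1))
      then show False using unitaryD(2)[OF Y(2)] Yd k by simp
    qed
    moreover have "0 \<le> (\<Sum>i<n. (cmod (W $$ (i,k)))\<^sup>2)" by (intro sum_nonneg) auto
    ultimately have pos: "0 < Re (G $$ (k,k))" by (simp add: G_kk)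
    have PQ: "(adj P * Q) $$ (k,k) = of_real (\<mu> k) * G $$ (k,k)"
      using \<open>adj P * Q = G * ?M\<close> Gd k by (simp add: index_mult_diagm del: index_mult_mat(1))
    have "(adj Q * P) $$ (k,k) = cnj ((adj P * Q) $$ (k,k))"
      using Pd k by (simp add: index_mult_sum mult.commute del: index_mult_mat(1))
    then have QP: "Re ((adj Q * P) $$ (k,k)) = Re ((adj P * Q) $$ (k,k))" by simp
    \<comment> \<open>Cauchy-Schwarz in its arithmetic-mean form: columns \<open>k\<close> of
      \<open>P\<close> and \<open>Q\<close> are no longer than that of \<open>W\<close>, while their
      inner product is \<open>\<mu> k\<close> times the squared length of that column.\<close>
    have "adj (P - Q) * (P - Q) = (adj P * P - adj Q * P) - (adj P * Q - adj Q * Q)"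
      using Pd by (simp add: adj_minus mat_alg)
    then have "0 \<le> Re (((adj P * P - adj Q * P) - (adj P * Q - adj Q * Q)) $$ (k,k))"
      using psd_index_nonneg[OF psd_adj_mult[of "P - Q"], of k] Pd k by simp
    then have "0 \<le> Re ((adj P * P) $$ (k,k)) + Re ((adj Q * Q) $$ (k,k)) - 2 * Re ((adj P * Q) $$ (k,k))"
      using Pd k QP by (simp del: index_mult_mat(1))
    moreover have "Re ((adj P * P) $$ (k,k)) \<le> Re (G $$ (k,k))" "Re ((adj Q * Q) $$ (k,k)) \<le> Re (G $$ (k,k))"
      using psd_index_nonneg[OF GP[OF P_def s], of k] psd_index_nonneg[OF GP[OF Q_def t], of k] Pd Gd k
      by (simp_all del: index_mult_mat(1))
    ultimately have "\<mu> k * Re (G $$ (k,k)) \<le> 1 * Re (G $$ (k,k))"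
      by (simp add: PQ)
    then show ?thesis using pos by (simp only: mult_le_cancel_right_pos)
  qed
  then have *: "psd (Y * diagm n (\<lambda>i. complex_of_real (1 - \<mu> i)) * adj Y)"
    using Y(1) by (intro psd_diag_conj) auto
  have "Y * diagm n (\<lambda>i. complex_of_real (1 - \<mu> i)) * adj Y = 1\<^sub>m n - C"
  proof -
    have "diagm n (\<lambda>i. complex_of_real (1 - \<mu> i)) = 1\<^sub>m n - ?M"
      by (simp add: diagm_minus flip: diagm_one)
    then show ?thesis
      unfolding Y(3) using Yd unitaryD(1)[OF Y(2)] by (simp add: mat_alg)
  qed
  with * have **: "psd (adj (mpow B (m/2)) * (1\<^sub>m n - C) * mpow B (m/2))"
    using B C by (intro psd_conj[of _ n _ n]) auto
  have "adj (mpow B (m/2)) * (1\<^sub>m n - C) * mpow B (m/2) = mpow B m - mpow A m"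
    using A B dims C by (simp add: mat_alg C_def mm)
  with ** show ?thesis by simp
qed

text \<open>A zero eigenvalue contributes 0 at every exponent, so \<open>x = 0\<close> is no
  exception to continuity in the exponent.\<close>

lemma continuous_on_qform_mpow:
  assumes "psd A" "A \<in> carrier_mat n n" "v \<in> carrier_vec n"
  shows "continuous_on UNIV (\<lambda>x. Re (qform (mpow A x) v))"
proof -
  obtain U l where U: "U \<in> carrier_mat n n" "unitary U" "A = U * diagm n (\<lambda>i. complex_of_real (l i)) * adj U"
    "\<And>i. 0 \<le> l i" using psd_spectral[OF assms(1,2)] by blast
  have "continuous_on UNIV (\<lambda>x. pospow a x)" for a
    by (cases "a > 0") (auto simp: pospow_def intro!: continuous_intros)
  then show ?thesis
    unfolding mpow_eq[OF U(1-3)] qform_diag_conj[OF U(1) assms(3)] Re_complex_of_real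
    by (intro continuous_on_sum continuous_on_mult continuous_on_const)
qed

text \<open>The admissible exponents form a closed set, by continuity of the quadratic forms, which
  is stable under midpoints and contains 0 and 1.\<close>

lemma mpow_mono_aux:
  assumes A: "psd A" "A \<in> carrier_mat n n" and B: "psd B" "B \<in> carrier_mat n n" "mpow B 0 = 1\<^sub>m n"
    and AB: "psd (B - A)" and s: "s \<in> {0..1}"
  shows "psd (mpow B s - mpow A s)"
proof -
  define S where "S = {s. \<forall>v\<in>carrier_vec n. Re (qform (mpow A s) v) \<le> Re (qform (mpow B s) v)}"
  have S: "s \<in> S \<longleftrightarrow> psd (mpow B s - mpow A s)" for s
  proof
    assume "psd (mpow B s - mpow A s)"
    from psd_qform[OF this] show "s \<in> S"
      using A B by (auto simp: S_def qform_minus[of _ n])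
  next
    assume "s \<in> S"
    then show "psd (mpow B s - mpow A s)"
      using A B by (intro psdI[of _ n]) (auto simp: S_def qform_minus[of _ n] adj_minus)
  qed
  have "closed S"
  proof -
    have "S = (\<Inter>v\<in>carrier_vec n. {s. Re (qform (mpow A s) v) \<le> Re (qform (mpow B s) v)})"
      by (auto simp: S_def)
    also have "closed \<dots>"
      using A B by (intro closed_INT ballI closed_Collect_le continuous_on_qform_mpow) auto
    finally show ?thesis .
  qed
  \<comment> \<open>For invertible \<open>B\<close> this says only that the support projection of
    \<open>A\<close> is at most the identity.\<close>
  moreover have "0 \<in> S"
  proof -
    obtain U l where U: "U \<in> carrier_mat n n" "unitary U" "A = U * diagm n (\<lambda>i. complex_of_real (l i)) * adj U"
      "\<And>i. 0 \<le> l i" using psd_spectral[OF A] by blast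
    have *: "1\<^sub>m n - diagm n (\<lambda>i. complex_of_real (pospow (l i) 0)) = diagm n (\<lambda>i. complex_of_real (1 - pospow (l i) 0))"
      by (simp add: diagm_minus flip: diagm_one)
    have "mpow B 0 - mpow A 0 = U * (1\<^sub>m n - diagm n (\<lambda>i. complex_of_real (pospow (l i) 0))) * adj U"
      unfolding mpow_eq[OF U(1-3)] B(3) using U(1) unitaryD(1)[OF U(2)] by (simp add: mat_alg)
    then have "mpow B 0 - mpow A 0 = U * diagm n (\<lambda>i. complex_of_real (1 - pospow (l i) 0)) * adj U"
      unfolding * .
    moreover have "psd (U * diagm n (\<lambda>i. complex_of_real (1 - pospow (l i) 0)) * adj U)"
      using U(1) by (intro psd_diag_conj) (auto simp: pospow_def)
    ultimately show ?thesis using S by simp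
  qed
  moreover have "1 \<in> S" using S mpow_1[OF A] mpow_1[OF B(1,2)] AB by simp
  moreover have "(a + b) / 2 \<in> S" if "a \<in> S" "b \<in> S" for a b
    using that mpow_mono_midpoint[OF A B] unfolding S by blast
  ultimately show ?thesis using closed_midpoint_convex_superset[of S] s S by blast
qed

text \<open>Adding \<epsilon> to the eigenvalues of \<open>B\<close> makes it invertible and
  preserves \<open>A \<le> B\<close>. The limit \<epsilon> to 0 uses \<open>0 < s\<close>: at
  exponent 0 the power of a vanishing eigenvalue jumps from 1 to 0.\<close>

theorem Loewner_Heinz:
  assumes A: "psd A" "A \<in> carrier_mat n n" and B: "psd B" "B \<in> carrier_mat n n"
    and AB: "psd (B - A)" and s: "0 < s" "s \<le> 1"
  shows "psd (mpow B s - mpow A s)"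
proof (rule psdI[of _ n])
  fix v :: "complex vec" assume v: "v \<in> carrier_vec n"
  obtain V b where V: "V \<in> carrier_mat n n" "unitary V" "B = V * diagm n (\<lambda>i. complex_of_real (b i)) * adj V"
    "\<And>i. 0 \<le> b i" using psd_spectral[OF B] by blast
  define w where "w i = (cmod ((adj V *\<^sub>v v) $ i))\<^sup>2" for i
  let ?D = "\<lambda>\<epsilon>. diagm n (\<lambda>i. complex_of_real (b i + \<epsilon>))"
  define B' where "B' \<epsilon> = V * ?D \<epsilon> * adj V" for \<epsilon>
  have B': "B' \<epsilon> \<in> carrier_mat n n" for \<epsilon> unfolding B'_def using V(1) by (intro carrier_matI) simp_all
  have "Re (qform (mpow A s) v) \<le> (\<Sum>i<n. pospow (b i + \<epsilon>) s * w i)" if \<epsilon>: "\<epsilon> > 0" for \<epsilon>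
  proof -
    have "psd (B' \<epsilon>)"
      unfolding B'_def using V \<epsilon> by (intro psd_diag_conj) (auto intro: add_nonneg_nonneg)
    have p0: "pospow (b i + \<epsilon>) 0 = 1" for i using V(4)[of i] \<epsilon> by (simp add: pospow_def)
    have "mpow (B' \<epsilon>) 0 = 1\<^sub>m n"
      unfolding mpow_eq[OF V(1,2) B'_def] p0 using V(1) unitaryD(1)[OF V(2)] by (simp add: diagm_one)
    let ?E = "V * diagm n (\<lambda>i. complex_of_real \<epsilon>) * adj V"
    have E: "psd ?E" using \<epsilon> by (intro psd_diag_conj[OF _ V(1)]) simp
    have Ec: "?E \<in> carrier_mat n n" using V(1) by (intro carrier_matI) simp_all
    have "?D \<epsilon> = diagm n (\<lambda>i. complex_of_real (b i)) + diagm n (\<lambda>i. complex_of_real \<epsilon>)"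
      by (simp add: diagm_add)
    then have "B' \<epsilon> = B + ?E"
      unfolding B'_def V(3) using V(1) by (simp add: mat_alg)
    then have "B' \<epsilon> - A = (B - A) + ?E"
      using A B V(1) by (intro eq_matI) (auto simp del: index_mult_mat(1))
    then have "psd (B' \<epsilon> - A)"
      using psd_add[OF AB E minus_carrier_mat[OF A(2)] Ec] by simp
    from mpow_mono_aux[OF A \<open>psd (B' \<epsilon>)\<close> B' \<open>mpow (B' \<epsilon>) 0 = 1\<^sub>m n\<close> this, of s] s
    have "psd (mpow (B' \<epsilon>) s - mpow A s)" by simp
    from psd_qform[OF this, of v] have "Re (qform (mpow A s) v) \<le> Re (qform (mpow (B' \<epsilon>) s) v)"
      using A B'[of \<epsilon>] \<open>psd (B' \<epsilon>)\<close> v by (simp add: qform_minus[of _ n])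
    then show ?thesis
      unfolding mpow_eq[OF V(1,2) B'_def] qform_diag_conj[OF V(1) v] by (simp add: w_def)
  qed
  then have "\<forall>\<^sub>F \<epsilon> in at_right 0. Re (qform (mpow A s) v) \<le> (\<Sum>i<n. pospow (b i + \<epsilon>) s * w i)"
    by (auto simp: eventually_at_filter)
  moreover have "((\<lambda>\<epsilon>. \<Sum>i<n. pospow (b i + \<epsilon>) s * w i) \<longlongrightarrow> (\<Sum>i<n. pospow (b i) s * w i)) (at_right 0)"
  proof (intro tendsto_sum tendsto_mult tendsto_const)
    fix i
    have 1: "((\<lambda>\<epsilon>. (b i + \<epsilon>) powr s) \<longlongrightarrow> (b i + 0) powr s) (at_right 0)"
      using V(4)[of i] s by (intro tendsto_powr' tendsto_intros) (auto simp: eventually_at_filter)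
    have 2: "\<forall>\<^sub>F \<epsilon> in at_right 0. (b i + \<epsilon>) powr s = pospow (b i + \<epsilon>) s"
      using V(4)[of i] by (auto simp: eventually_at_filter pospow_def)
    have 3: "(b i + 0) powr s = pospow (b i) s"
      using V(4)[of i] by (auto simp: pospow_def)
    show "((\<lambda>\<epsilon>. pospow (b i + \<epsilon>) s) \<longlongrightarrow> pospow (b i) s) (at_right 0)"
      using Lim_transform_eventually[OF 1 2] unfolding 3 .
  qed
  ultimately have "Re (qform (mpow A s) v) \<le> (\<Sum>i<n. pospow (b i) s * w i)"
    by (intro tendsto_lowerbound) auto
  also have "\<dots> = Re (qform (mpow B s) v)"
    unfolding mpow_eq[OF V(1-3)] qform_diag_conj[OF V(1) v] by (simp add: w_def)
  finally show "0 \<le> Re (qform (mpow B s - mpow A s) v)"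
    using A B v by (simp add: qform_minus[of _ n])
qed (use A B in \<open>auto simp: adj_minus\<close>)

section \<open>Audenaert's inequality\<close>

lemma is_test_diag_conj:
  assumes U: "U \<in> carrier_mat n n" "unitary U" and f: "\<And>i. i < n \<Longrightarrow> 0 \<le> f i \<and> f i \<le> 1"
  shows "is_test (U * diagm n (\<lambda>i. complex_of_real (f i)) * adj U)"
proof -
  have "diagm n (\<lambda>i. complex_of_real (1 - f i)) = 1\<^sub>m n - diagm n (\<lambda>i. complex_of_real (f i))"
    by (simp add: diagm_minus flip: diagm_one)
  then have "1\<^sub>m n - U * diagm n (\<lambda>i. complex_of_real (f i)) * adj U = U * diagm n (\<lambda>i. complex_of_real (1 - f i)) * adj U"
    using U(1) unitaryD(1)[OF U(2)] by (simp add: mat_alg)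
  moreover have "psd (U * diagm n (\<lambda>i. complex_of_real (1 - f i)) * adj U)"
      "psd (U * diagm n (\<lambda>i. complex_of_real (f i)) * adj U)"
    using f by (auto intro!: psd_diag_conj[OF _ U(1)] simp del: of_real_diff)
  ultimately show ?thesis
    using U(1) by (simp add: is_test_def)
qed

text \<open>\<open>T\<close> projects onto the positive part of \<open>A - B\<close>, and its total
  error is \<open>Tr A + Tr B - Tr D\<close> for \<open>D = B + R\<close>, with \<open>R\<close>
  that positive part. Since \<open>D\<close> dominates both \<open>A\<close> and \<open>B\<close>,
  Loewner-Heinz makes the trace of \<open>(D^s - A^s) (D^(1-s) - B^(1-s))\<close> nonnegative; in
  its expansion the mixed terms with \<open>D\<close> are at least \<open>Tr A\<close> and
  \<open>Tr B\<close>, again by monotonicity.\<close>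

theorem Audenaert_inequality:
  assumes A: "psd A" "A \<in> carrier_mat n n" and B: "psd B" "B \<in> carrier_mat n n"
    and s: "0 < s" "s < 1"
  obtains T where "T \<in> carrier_mat n n" "is_test T"
    "Re (mtrace (A * (1\<^sub>m n - T))) + Re (mtrace (B * T)) \<le> Re (mtrace (mpow A s * mpow B (1 - s)))"
proof -
  have dims: "dim_row A = n" "dim_row B = n" "dim_col A = n" "dim_col B = n" using A B by auto
  have "adj (A - B) = A - B" using A B psdD(1) by (simp add: adj_minus)
  then obtain Z \<delta> where Z: "Z \<in> carrier_mat n n" "unitary Z"
    "A - B = Z * diagm n (\<lambda>i. complex_of_real (\<delta> i)) * adj Z"
    using spectral_theorem[OF minus_carrier_mat[OF B(2)]] by blast
  have Zd: "dim_row Z = n" "dim_col Z = n" using Z by auto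
  let ?D = "\<lambda>f. Z * diagm n (\<lambda>i. complex_of_real (f i)) * adj Z"
  define T where "T = ?D (\<lambda>i. if \<delta> i > 0 then 1 else 0)"
  have T: "T \<in> carrier_mat n n" unfolding T_def using Z(1) by (intro carrier_matI) simp_all
  have "is_test T" unfolding T_def by (intro is_test_diag_conj Z(1,2)) auto
  define R where "R = ?D (\<lambda>i. max 0 (\<delta> i))"
  have R: "R \<in> carrier_mat n n" unfolding R_def using Z(1) by (intro carrier_matI) simp_all
  have "psd R" unfolding R_def by (rule psd_diag_conj[OF _ Z(1)]) auto
  define D where "D = B + R"
  have D: "psd D" "D \<in> carrier_mat n n"
    unfolding D_def using psd_add[OF B(1) \<open>psd R\<close> B(2) R] B R by auto
  have "D - B = R" unfolding D_def using B R by (intro eq_matI) auto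
  then have DB: "psd (D - B)" using \<open>psd R\<close> by simp
  have "D - A = R - (A - B)" unfolding D_def using A B R by (intro eq_matI) auto
  also have "\<dots> = ?D (\<lambda>i. max 0 (\<delta> i) - \<delta> i)"
  proof -
    have "diagm n (\<lambda>i. complex_of_real (max 0 (\<delta> i) - \<delta> i))
        = diagm n (\<lambda>i. complex_of_real (max 0 (\<delta> i))) - diagm n (\<lambda>i. complex_of_real (\<delta> i))"
      by (simp add: diagm_minus)
    then show ?thesis unfolding Z(3) R_def using Zd by (simp add: mat_alg)
  qed
  finally have DA: "psd (D - A)" using psd_diag_conj[OF _ Z(1), of "\<lambda>i. max 0 (\<delta> i) - \<delta> i"] by simp
  have ABT: "(A - B) * T = R"
  proof -
    have "diagm n (\<lambda>i. complex_of_real (\<delta> i)) * diagm n (\<lambda>i. complex_of_real (if \<delta> i > 0 then 1 else 0))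
       = diagm n (\<lambda>i. complex_of_real (max 0 (\<delta> i)))"
      unfolding diagm_mult by (intro diagm_cong) (auto simp: max_def)
    moreover have "(A - B) * T = Z * (diagm n (\<lambda>i. complex_of_real (\<delta> i))
        * diagm n (\<lambda>i. complex_of_real (if \<delta> i > 0 then 1 else 0))) * adj Z"
      unfolding Z(3) T_def using Zd unitary_cancel(2)[OF Z(2)] by (simp add: mat_assoc)
    ultimately show ?thesis by (simp add: R_def)
  qed
  let ?t = "\<lambda>X. Re (mtrace X)"
  have dimD: "dim_row D = n" "dim_col D = n" using D by auto
  note mp = mpow_mult[OF A] mpow_mult[OF B] mpow_mult[OF D] mpow_1[OF A] mpow_1[OF B] mpow_1[OF D]
  have sA: "psd (mpow D s - mpow A s)" using Loewner_Heinz[OF A D DA] s by simp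
  have sB: "psd (mpow D (1 - s) - mpow B (1 - s))" using Loewner_Heinz[OF B D DB] s by simp
  have tA: "psd (mpow D (1 - s) - mpow A (1 - s))" using Loewner_Heinz[OF A D DA] s by simp
  have tB: "psd (mpow D s - mpow B s)" using Loewner_Heinz[OF B D DB] s by simp
  have "0 \<le> ?t ((mpow D (1 - s) - mpow A (1 - s)) * mpow A s)"
    using A D by (intro mtrace_psd_mult_nonneg[OF tA, of _ n]) (auto intro: mpow_psd)
  then have 1: "?t A \<le> ?t (mpow A s * mpow D (1 - s))"
    using A D dims dimD mtrace_mult_comm[of "mpow A s" "mpow D (1 - s)"] by (simp add: mat_alg mtrace_minus mp)
  have "0 \<le> ?t ((mpow D s - mpow A s) * (mpow D (1 - s) - mpow B (1 - s)))"
    using A B D by (intro mtrace_psd_mult_nonneg[OF sA sB, of n]) auto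
  then have 2: "?t (mpow A s * mpow D (1 - s)) + ?t (mpow D s * mpow B (1 - s))
      \<le> ?t D + ?t (mpow A s * mpow B (1 - s))"
    using A B D dims dimD by (simp add: mat_alg mtrace_minus mp)
  have "0 \<le> ?t ((mpow D s - mpow B s) * mpow B (1 - s))"
    using B D by (intro mtrace_psd_mult_nonneg[OF tB, of _ n]) (auto intro: mpow_psd)
  then have 3: "?t B \<le> ?t (mpow D s * mpow B (1 - s))"
    using B D dims dimD by (simp add: mat_alg mtrace_minus mp)
  have "?t D = ?t B + ?t R" using B R by (simp add: D_def mtrace_add)
  moreover have "?t R = ?t (A * T) - ?t (B * T)"
    using A B T by (simp flip: ABT add: mat_alg mtrace_minus)
  moreover have "?t (A * (1\<^sub>m n - T)) = ?t A - ?t (A * T)"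
    using A T by (simp add: mat_alg mtrace_minus)
  ultimately show ?thesis
    using that[OF T \<open>is_test T\<close>] 1 2 3 by linarith
qed

section \<open>Errors of tests and tensor powers\<close>

lemma is_testD:
  assumes "is_test T" "T \<in> carrier_mat n n"
  shows "psd T" "psd (1\<^sub>m n - T)"
  using assms by (auto simp: is_test_def)

lemma psd_minus_square:
  assumes T: "psd T" "T \<in> carrier_mat n n" and S: "psd (1\<^sub>m n - T)"
  shows "psd (T - T * T)"
proof -
  let ?C = "mpow T (1/2)"
  have d: "dim_row T = n" "dim_col T = n" using T by auto
  have CC: "?C * ?C = T" using mpow_mult[OF T] mpow_1[OF T] by simp
  have "adj ?C * (1\<^sub>m n - T) * ?C = ?C * ?C - ?C * T * ?C"
    using T d by (simp add: mat_alg)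
  also have "?C * T * ?C = ?C * (?C * ?C) * ?C" by (simp add: CC)
  also have "\<dots> = (?C * ?C) * (?C * ?C)" using T d by (simp add: mat_assoc)
  finally have "adj ?C * (1\<^sub>m n - T) * ?C = T - T * T" by (simp add: CC)
  moreover have "psd (adj ?C * (1\<^sub>m n - T) * ?C)"
    using T by (intro psd_conj[OF S, of n _ n]) auto
  ultimately show ?thesis by simp
qed

lemma mtrace_diagm_mult:
  "N \<in> carrier_mat n n \<Longrightarrow> mtrace (diagm n f * N) = (\<Sum>i<n. f i * N $$ (i,i))"
  by (simp add: mtrace_def index_diagm_mult del: index_mult_mat(1))

lemma mtrace_diag_conj_mult:
  assumes "U \<in> carrier_mat n n" "X \<in> carrier_mat n n"
  shows "mtrace (U * diagm n f * adj U * X) = (\<Sum>i<n. f i * (adj U * X * U) $$ (i,i))"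
proof -
  have "mtrace (U * diagm n f * adj U * X) = mtrace (U * (diagm n f * adj U * X))"
    using assms by (simp add: mat_assoc)
  also have "\<dots> = mtrace (diagm n f * (adj U * X * U))"
    using assms by (subst mtrace_mult_comm) (simp_all add: mat_assoc)
  also have "\<dots> = (\<Sum>i<n. f i * (adj U * X * U) $$ (i,i))"
    using assms by (intro mtrace_diagm_mult carrier_matI) simp_all
  finally show ?thesis .
qed

lemma index_mult_adj:
  assumes "M \<in> carrier_mat n n" "i < n"
  shows "(M * adj M) $$ (i,i) = complex_of_real (\<Sum>j<n. (cmod (M $$ (i,j)))\<^sup>2)"
    "(adj M * M) $$ (i,i) = complex_of_real (\<Sum>j<n. (cmod (M $$ (j,i)))\<^sup>2)"
  using assms by (simp_all add: index_mult_sum complex_norm_square mult.commute del: index_mult_mat(1) of_real_power)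

text \<open>With \<open>x = \<langle>u\<^sub>i, (1 - T) v\<^sub>j\<rangle>\<close> and \<open>y = \<langle>u\<^sub>i, T v\<^sub>j\<rangle>\<close> the two error terms dominate
  \<open>\<Sum> r\<^sub>i |x|\<^sup>2\<close> and \<open>\<Sum> s\<^sub>j |y|\<^sup>2\<close>, as \<open>T\<^sup>2 \<le> T\<close>; moreover \<open>|x|\<^sup>2 + |y|\<^sup>2 \<ge> |x + y|\<^sup>2 / 2\<close>.\<close>

lemma test_error_ge:
  assumes U: "U \<in> carrier_mat n n" "unitary U" "A = U * diagm n (\<lambda>i. complex_of_real (r i)) * adj U"
    and V: "V \<in> carrier_mat n n" "unitary V" "B = V * diagm n (\<lambda>i. complex_of_real (s i)) * adj V"
    and rs: "\<And>i. 0 \<le> r i" "\<And>i. 0 \<le> s i"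
    and T: "T \<in> carrier_mat n n" "is_test T"
  shows "(\<Sum>i<n. \<Sum>j<n. min (r i) (s j) * (cmod ((adj U * V) $$ (i,j)))\<^sup>2) / 2
     \<le> Re (mtrace (A * (1\<^sub>m n - T))) + Re (mtrace (B * T))"
proof -
  define S where "S = 1\<^sub>m n - T"
  note psdT = is_testD[OF T(2,1)]
  have Sc: "S \<in> carrier_mat n n" unfolding S_def by (rule minus_carrier_mat[OF T(1)])
  have psdS: "psd S" "psd (1\<^sub>m n - S)"
  proof -
    have "1\<^sub>m n - S = T" unfolding S_def using T by (intro eq_matI) auto
    then show "psd S" "psd (1\<^sub>m n - S)" using psdT by (auto simp: S_def)
  qed
  have Ac: "A \<in> carrier_mat n n" unfolding U(3) using U(1) by (intro carrier_matI) simp_all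
  have Bc: "B \<in> carrier_mat n n" unfolding V(3) using V(1) by (intro carrier_matI) simp_all
  have psdA: "psd A" unfolding U(3) using rs by (intro psd_diag_conj[OF _ U(1)])
  have psdB: "psd B" unfolding V(3) using rs by (intro psd_diag_conj[OF _ V(1)])
  have sq: "Re (mtrace (X * (Y * Y))) \<le> Re (mtrace (X * Y))"
    if "psd X" "X \<in> carrier_mat n n" "psd Y" "Y \<in> carrier_mat n n" "psd (1\<^sub>m n - Y)" for X Y
  proof -
    have "0 \<le> Re (mtrace (X * (Y - Y * Y)))"
      using that by (intro mtrace_psd_mult_nonneg[OF that(1) psd_minus_square[OF that(3-5)] that(2)]) auto
    then show ?thesis using that by (simp add: mat_alg mtrace_minus)
  qed
  define M where "M = adj U * S * V"
  define N where "N = adj U * T * V"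
  have Mc: "M \<in> carrier_mat n n" unfolding M_def using U(1) V(1) Sc by (intro carrier_matI) simp_all
  have Nc: "N \<in> carrier_mat n n" unfolding N_def using U(1) V(1) T by (intro carrier_matI) simp_all
  have adjST: "adj S = S" "adj T = T" using psdD(1)[OF psdS(1)] psdD(1)[OF psdT(1)] .
  have e1: "adj U * (S * S) * U = M * adj M"
    using U(1) V(1) Sc unitary_cancel(1)[OF V(2)] adjST by (simp add: M_def mat_assoc adj_mult)
  have e2: "adj V * (T * T) * V = adj N * N"
    using U(1) V(1) T unitary_cancel(1)[OF U(2)] adjST by (simp add: N_def mat_assoc adj_mult)
  have e3: "(adj U * V) $$ (i,j) = M $$ (i,j) + N $$ (i,j)" if "i < n" "j < n" for i j
  proof -
    have "1\<^sub>m n = S + T" unfolding S_def using T by (intro eq_matI) auto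
    have "adj U * V = adj U * 1\<^sub>m n * V" using U(1) by simp
    also have "\<dots> = M + N"
      unfolding \<open>1\<^sub>m n = S + T\<close> M_def N_def using U(1) V(1) Sc T by (simp add: mat_alg)
    finally show ?thesis using that Mc Nc by simp
  qed
  have "Re (mtrace (A * (S * S))) = (\<Sum>i<n. \<Sum>j<n. r i * (cmod (M $$ (i,j)))\<^sup>2)"
    unfolding U(3) using U(1) Sc Mc
    by (subst mtrace_diag_conj_mult) (auto simp: e1 index_mult_adj[of _ n] sum_distrib_left simp flip: of_real_mult of_real_sum simp del: of_real_power index_mult_mat(1))
  moreover have "Re (mtrace (B * (T * T))) = (\<Sum>i<n. \<Sum>j<n. s j * (cmod (N $$ (i,j)))\<^sup>2)"
    unfolding V(3) using V(1) T Nc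
    by (subst sum.swap, subst mtrace_diag_conj_mult) (auto simp: e2 index_mult_adj[of _ n] sum_distrib_left simp flip: of_real_mult of_real_sum simp del: of_real_power index_mult_mat(1))
  moreover have "(\<Sum>i<n. \<Sum>j<n. min (r i) (s j) * (cmod ((adj U * V) $$ (i,j)))\<^sup>2) / 2
      \<le> (\<Sum>i<n. \<Sum>j<n. r i * (cmod (M $$ (i,j)))\<^sup>2 + s j * (cmod (N $$ (i,j)))\<^sup>2)"
    unfolding sum_divide_distrib
  proof (intro sum_mono)
    fix i j assume "i \<in> {..<n}" "j \<in> {..<n}"
    then have ij: "i < n" "j < n" by auto
    let ?x = "M $$ (i,j)" and ?y = "N $$ (i,j)"
    have "(cmod (?x + ?y))\<^sup>2 \<le> (cmod ?x + cmod ?y)\<^sup>2"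
      by (intro power_mono norm_triangle_ineq) auto
    also have "\<dots> \<le> 2 * ((cmod ?x)\<^sup>2 + (cmod ?y)\<^sup>2)"
      using sum_squares_ge_zero[of "cmod ?x - cmod ?y" 0] by (simp add: power2_eq_square algebra_simps)
    finally have "min (r i) (s j) * (cmod (?x + ?y))\<^sup>2 \<le> min (r i) (s j) * (2 * ((cmod ?x)\<^sup>2 + (cmod ?y)\<^sup>2))"
      using rs by (intro mult_left_mono) auto
    also have "\<dots> = 2 * (min (r i) (s j) * (cmod ?x)\<^sup>2 + min (r i) (s j) * (cmod ?y)\<^sup>2)"
      by (simp add: algebra_simps)
    also have "\<dots> \<le> 2 * (r i * (cmod ?x)\<^sup>2 + s j * (cmod ?y)\<^sup>2)"
      by (intro mult_left_mono add_mono mult_right_mono) auto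
    finally show "min (r i) (s j) * (cmod ((adj U * V) $$ (i,j)))\<^sup>2 / 2 \<le> r i * (cmod ?x)\<^sup>2 + s j * (cmod ?y)\<^sup>2"
      using e3[OF ij] by simp
  qed
  moreover have "Re (mtrace (A * (S * S))) \<le> Re (mtrace (A * S))"
    by (rule sq[OF psdA Ac psdS(1) Sc psdS(2)])
  moreover have "Re (mtrace (B * (T * T))) \<le> Re (mtrace (B * T))"
    by (rule sq[OF psdB Bc psdT(1) T(1) psdT(2)])
  ultimately show ?thesis by (simp add: S_def sum.distrib)
qed

section \<open>Kronecker products and tensor powers\<close>

lemma sum_lessThan_mult_div_mod:
  fixes f :: "nat \<Rightarrow> nat \<Rightarrow> 'a::comm_monoid_add"
  shows "(\<Sum>k<m*n. f (k div n) (k mod n)) = (\<Sum>a<m. \<Sum>b<n. f a b)"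
proof -
  have "(\<Sum>k<m*n. f (k div n) (k mod n)) = (\<Sum>a<m. \<Sum>k=a*n..<a*n+n. f (k div n) (k mod n))"
    by (rule sum.nat_group[symmetric])
  also have "\<dots> = (\<Sum>a<m. \<Sum>b<n. f a b)"
  proof (rule sum.cong[OF refl])
    fix a
    have *: "(b + a * n) div n = a" "(b + a * n) mod n = b" if "b < n" for b
      using that by auto
    have "(\<Sum>k=a*n..<a*n+n. f (k div n) (k mod n)) = (\<Sum>b<n. f ((b + a * n) div n) ((b + a * n) mod n))"
      by (rule sum.reindex_bij_witness[of _ "\<lambda>b. b + a * n" "\<lambda>k. k - a * n"]) auto
    also have "\<dots> = (\<Sum>b<n. f a b)"
      by (intro sum.cong refl) (simp only: * lessThan_iff)
    finally show "(\<Sum>k=a*n..<a*n+n. f (k div n) (k mod n)) = (\<Sum>b<n. f a b)" .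
  qed
  finally show ?thesis .
qed

lemma div_mod_less: "i < m * n \<Longrightarrow> i div n < m" "i < m * n \<Longrightarrow> i mod n < n" for i m n :: nat
  by (auto simp: less_mult_imp_div_less) (metis mod_less_divisor mult_is_0 not_less_zero gr0I)

lemma dim_kron [simp]: "dim_row (kron A B) = dim_row A * dim_row B" "dim_col (kron A B) = dim_col A * dim_col B"
  by (simp_all add: kron_def)

lemma index_kron [simp]:
  "i < dim_row A * dim_row B \<Longrightarrow> j < dim_col A * dim_col B \<Longrightarrow>
    kron A B $$ (i,j) = A $$ (i div dim_row B, j div dim_col B) * B $$ (i mod dim_row B, j mod dim_col B)"
  by (simp add: kron_def)

lemma kron_mult:
  assumes "dim_col A = dim_row C" "dim_col B = dim_row D"
  shows "kron A B * kron C D = kron (A * C) (B * D)"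
proof (rule eq_matI)
  fix i j assume "i < dim_row (kron (A * C) (B * D))" "j < dim_col (kron (A * C) (B * D))"
  then have ij: "i < dim_row A * dim_row B" "j < dim_col C * dim_col D" by auto
  let ?i = "i div dim_row B" and ?i' = "i mod dim_row B" and ?j = "j div dim_col D" and ?j' = "j mod dim_col D"
  have "(kron A B * kron C D) $$ (i,j) = (\<Sum>k<dim_row C * dim_row D.
      (A $$ (?i, k div dim_row D) * B $$ (?i', k mod dim_row D)) * (C $$ (k div dim_row D, ?j) * D $$ (k mod dim_row D, ?j')))"
    using assms ij by (simp add: index_mult_sum del: index_mult_mat(1))
  also have "\<dots> = (\<Sum>a<dim_row C. \<Sum>b<dim_row D. (A $$ (?i,a) * B $$ (?i',b)) * (C $$ (a,?j) * D $$ (b,?j')))"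
    by (rule sum_lessThan_mult_div_mod)
  also have "\<dots> = (\<Sum>a<dim_row C. A $$ (?i,a) * C $$ (a,?j)) * (\<Sum>b<dim_row D. B $$ (?i',b) * D $$ (b,?j'))"
    by (simp add: sum_product mult_ac)
  also have "\<dots> = kron (A * C) (B * D) $$ (i,j)"
    using assms ij div_mod_less[OF ij(1)] div_mod_less[OF ij(2)]
    by (simp add: index_mult_sum del: index_mult_mat(1))
  finally show "(kron A B * kron C D) $$ (i,j) = kron (A * C) (B * D) $$ (i,j)" .
qed auto

lemma adj_kron: "adj (kron A B) = kron (adj A) (adj B)"
  by (rule eq_matI) (auto simp: div_mod_less)

lemma kron_diagm: "kron (diagm m f) (diagm n g) = diagm (m * n) (\<lambda>i. f (i div n) * g (i mod n))"
proof (rule eq_matI)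
  fix i j assume "i < dim_row (diagm (m * n) (\<lambda>i. f (i div n) * g (i mod n)))"
    "j < dim_col (diagm (m * n) (\<lambda>i. f (i div n) * g (i mod n)))"
  then have ij: "i < m * n" "j < m * n" by auto
  have "i = j \<longleftrightarrow> i div n = j div n \<and> i mod n = j mod n"
    by (metis div_mult_mod_eq)
  then show "kron (diagm m f) (diagm n g) $$ (i,j) = diagm (m * n) (\<lambda>i. f (i div n) * g (i mod n)) $$ (i,j)"
    using ij div_mod_less[OF ij(1)] div_mod_less[OF ij(2)] by auto
qed auto

lemma mtrace_kron:
  assumes "dim_col A = dim_row A" "dim_col B = dim_row B"
  shows "mtrace (kron A B) = mtrace A * mtrace B"
proof -
  have "mtrace (kron A B) = (\<Sum>i<dim_row A * dim_row B. A $$ (i div dim_row B, i div dim_row B) * B $$ (i mod dim_row B, i mod dim_row B))"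
    using assms by (simp add: mtrace_def)
  also have "\<dots> = (\<Sum>a<dim_row A. \<Sum>b<dim_row B. A $$ (a,a) * B $$ (b,b))"
    by (rule sum_lessThan_mult_div_mod)
  finally show ?thesis by (simp add: mtrace_def sum_product)
qed

lemma dim_tpow [simp]: "dim_row (tpow n A) = dim_row A ^ n" "dim_col (tpow n A) = dim_col A ^ n"
  by (induction n) (simp_all add: mult.commute)

lemma tpow_carrier: "A \<in> carrier_mat d d \<Longrightarrow> tpow n A \<in> carrier_mat (d ^ n) (d ^ n)"
  by (intro carrier_matI) simp_all

lemma tpow_mult: "dim_col A = dim_row B \<Longrightarrow> tpow n (A * B) = tpow n A * tpow n B"
  by (induction n) (simp_all add: kron_mult)

lemma adj_tpow: "adj (tpow n A) = tpow n (adj A)"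
  by (induction n) (simp_all add: adj_kron)

lemma mtrace_tpow: "dim_col A = dim_row A \<Longrightarrow> mtrace (tpow n A) = mtrace A ^ n"
  by (induction n) (simp add: mtrace_def, simp add: mtrace_kron)

text \<open>Eigenvalues of an \<open>n\<close>-fold tensor power: the last \<open>n\<close>
  base-\<open>d\<close> digits of \<open>i\<close> select the eigenvalue of each factor.\<close>

fun tev :: "nat \<Rightarrow> (nat \<Rightarrow> real) \<Rightarrow> nat \<Rightarrow> nat \<Rightarrow> real" where
  "tev d r 0 i = 1"
| "tev d r (Suc n) i = tev d r n (i div d) * r (i mod d)"

lemma tev_nonneg: "(\<And>i. 0 \<le> r i) \<Longrightarrow> 0 \<le> tev d r n i"
  by (induction n arbitrary: i) auto

lemma pospow_tev: "(\<And>i. 0 \<le> r i) \<Longrightarrow> pospow (tev d r n i) x = tev d (\<lambda>i. pospow (r i) x) n i"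
proof (induction n arbitrary: i)
  case 0
  show ?case by (simp add: pospow_def)
next
  case (Suc n)
  then show ?case by (simp add: pospow_mult tev_nonneg)
qed

lemma tpow_diagm:
  "tpow n (diagm d (\<lambda>i. complex_of_real (r i))) = diagm (d ^ n) (\<lambda>i. complex_of_real (tev d r n i))"
  by (induction n) (simp_all add: kron_diagm diagm_one mult.commute)

lemma tpow_one: "tpow n (1\<^sub>m d) = 1\<^sub>m (d ^ n)"
proof -
  have "tev d (\<lambda>i. 1) n i = 1" for i by (induction n arbitrary: i) auto
  then show ?thesis using tpow_diagm[of n d "\<lambda>i. 1"] by (simp add: diagm_one)
qed

lemma unitary_tpow:
  assumes "unitary U" "U \<in> carrier_mat d d"
  shows "unitary (tpow n U)"
  using assms unitaryD(1)[OF assms(1)]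
  by (intro unitaryI[OF tpow_carrier[OF assms(2)]])
    (simp add: adj_tpow tpow_one flip: tpow_mult)

lemma tpow_diag_conj:
  assumes "U \<in> carrier_mat d d"
  shows "tpow n (U * diagm d (\<lambda>i. complex_of_real (r i)) * adj U)
    = tpow n U * diagm (d ^ n) (\<lambda>i. complex_of_real (tev d r n i)) * adj (tpow n U)"
  using assms by (simp add: tpow_mult tpow_diagm adj_tpow)

lemma psd_tpow:
  assumes "psd A" "A \<in> carrier_mat d d"
  shows "psd (tpow n A)"
proof -
  obtain U l where U: "U \<in> carrier_mat d d" "unitary U" "A = U * diagm d (\<lambda>i. complex_of_real (l i)) * adj U"
    "\<And>i. 0 \<le> l i" using psd_spectral[OF assms] by blast
  show ?thesis
    unfolding U(3) tpow_diag_conj[OF U(1)]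
    by (intro psd_diag_conj[OF _ tpow_carrier[OF U(1)]] tev_nonneg U(4))
qed

lemma mpow_tpow:
  assumes "psd A" "A \<in> carrier_mat d d"
  shows "mpow (tpow n A) x = tpow n (mpow A x)"
proof -
  obtain U l where U: "U \<in> carrier_mat d d" "unitary U" "A = U * diagm d (\<lambda>i. complex_of_real (l i)) * adj U"
    "\<And>i. 0 \<le> l i" using psd_spectral[OF assms] by blast
  have "tpow n A = tpow n U * diagm (d ^ n) (\<lambda>i. complex_of_real (tev d l n i)) * adj (tpow n U)"
    unfolding U(3) by (rule tpow_diag_conj[OF U(1)])
  from mpow_eq[OF tpow_carrier[OF U(1)] unitary_tpow[OF U(2,1)] this, of x]
  show ?thesis
    unfolding mpow_eq[OF U(1-3)] tpow_diag_conj[OF U(1)] by (simp only: pospow_tev[OF U(4)])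
qed

text \<open>The \<open>n\<close>-fold product of the "joint spectral measure" \<open>w\<close> of two diagonalised matrices, with
  \<open>w\<^sub>i\<^sub>j = |\<langle>u\<^sub>i, v\<^sub>j\<rangle>|\<^sup>2\<close>, as a functional on functions of the two eigenvalues.\<close>

definition overlap_sum :: "nat \<Rightarrow> complex mat \<Rightarrow> (nat \<Rightarrow> real) \<Rightarrow> (nat \<Rightarrow> real) \<Rightarrow> nat \<Rightarrow> (real \<Rightarrow> real \<Rightarrow> real) \<Rightarrow> real" where
  "overlap_sum d W r s n F = (\<Sum>i<d^n. \<Sum>j<d^n. F (tev d r n i) (tev d s n j) * (cmod (tpow n W $$ (i,j)))\<^sup>2)"

lemma overlap_sum_0: "overlap_sum d W r s 0 F = F 1 1"
  by (simp add: overlap_sum_def)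

text \<open>Integrates out the last tensor factor. Inductions on \<open>n\<close> therefore have to
  treat a class of functions \<open>F\<close> that is closed under rescaling the arguments.\<close>

lemma overlap_sum_Suc:
  assumes "W \<in> carrier_mat d d"
  shows "overlap_sum d W r s (Suc n) F
    = (\<Sum>k<d. \<Sum>l<d. (cmod (W $$ (k,l)))\<^sup>2 * overlap_sum d W r s n (\<lambda>x y. F (x * r k) (y * s l)))"
proof -
  define G where "G i k j l = F (tev d r n i * r k) (tev d s n j * s l)
      * ((cmod (tpow n W $$ (i,j)))\<^sup>2 * (cmod (W $$ (k,l)))\<^sup>2)" for i k j l
  have "overlap_sum d W r s (Suc n) F = (\<Sum>i<d^n*d. \<Sum>j<d^n*d. G (i div d) (i mod d) (j div d) (j mod d))"
    using assms unfolding overlap_sum_def G_def power_Suc2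
    by (intro sum.cong refl) (simp add: norm_mult power_mult_distrib)
  also have "\<dots> = (\<Sum>i<d^n*d. \<Sum>j<d^n. \<Sum>l<d. G (i div d) (i mod d) j l)"
    by (intro sum.cong refl sum_lessThan_mult_div_mod)
  also have "\<dots> = (\<Sum>i<d^n. \<Sum>k<d. \<Sum>j<d^n. \<Sum>l<d. G i k j l)"
    by (rule sum_lessThan_mult_div_mod)
  also have "\<dots> = (\<Sum>k<d. \<Sum>i<d^n. \<Sum>j<d^n. \<Sum>l<d. G i k j l)"
    by (rule sum.swap)
  also have "\<dots> = (\<Sum>k<d. \<Sum>i<d^n. \<Sum>l<d. \<Sum>j<d^n. G i k j l)"
    by (intro sum.cong refl sum.swap)
  also have "\<dots> = (\<Sum>k<d. \<Sum>l<d. \<Sum>i<d^n. \<Sum>j<d^n. G i k j l)"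
    by (intro sum.cong refl sum.swap)
  also have "\<dots> = (\<Sum>k<d. \<Sum>l<d. (cmod (W $$ (k,l)))\<^sup>2 * overlap_sum d W r s n (\<lambda>x y. F (x * r k) (y * s l)))"
    by (simp add: overlap_sum_def G_def sum_distrib_left mult_ac)
  finally show ?thesis .
qed

lemma overlap_sum_mono:
  assumes "\<And>i j. F (tev d r n i) (tev d s n j) \<le> G (tev d r n i) (tev d s n j)"
  shows "overlap_sum d W r s n F \<le> overlap_sum d W r s n G"
  unfolding overlap_sum_def using assms by (intro sum_mono mult_right_mono) auto

section \<open>Cramer's lower bound and log-convexity\<close>

definition overlap_pow :: "nat \<Rightarrow> complex mat \<Rightarrow> (nat \<Rightarrow> real) \<Rightarrow> (nat \<Rightarrow> real) \<Rightarrow> real \<Rightarrow> real" where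
  "overlap_pow d W r s t = (\<Sum>i<d. \<Sum>j<d. pospow (r i) t * pospow (s j) (1 - t) * (cmod (W $$ (i,j)))\<^sup>2)"

definition overlap_support :: "nat \<Rightarrow> complex mat \<Rightarrow> (nat \<Rightarrow> real) \<Rightarrow> (nat \<Rightarrow> real) \<Rightarrow> (nat \<times> nat) set" where
  "overlap_support d W r s = {(i,j). i < d \<and> j < d \<and> 0 < r i \<and> 0 < s j \<and> W $$ (i,j) \<noteq> 0}"

lemma finite_overlap_support [simp]: "finite (overlap_support d W r s)"
  by (rule finite_subset[of _ "{..<d} \<times> {..<d}"]) (auto simp: overlap_support_def)

lemma overlap_pow_eq_sum:
  "overlap_pow d W r s t = (\<Sum>(i,j)\<in>overlap_support d W r s. r i powr t * s j powr (1 - t) * (cmod (W $$ (i,j)))\<^sup>2)"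
  unfolding overlap_pow_def sum.cartesian_product
  by (rule sum.mono_neutral_cong_right) (auto simp: overlap_support_def pospow_def split: if_splits)

lemma overlap_pow_pos:
  assumes "overlap_support d W r s \<noteq> {}"
  shows "0 < overlap_pow d W r s t"
  unfolding overlap_pow_eq_sum using assms
  by (intro sum_pos finite_overlap_support) (auto simp: overlap_support_def)

lemma overlap_sum_cong:
  assumes "\<And>i. 0 \<le> r i" "\<And>i. 0 \<le> s i" "\<And>x y. 0 \<le> x \<Longrightarrow> 0 \<le> y \<Longrightarrow> F x y = G x y"
  shows "overlap_sum d W r s n F = overlap_sum d W r s n G"
  unfolding overlap_sum_def using assms by (simp add: tev_nonneg)

lemma overlap_sum_scale: "overlap_sum d W r s n (\<lambda>x y. c * F x y) = c * overlap_sum d W r s n F"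
  by (simp add: overlap_sum_def sum_distrib_left mult.assoc)

text \<open>Exponential change of measure: under \<open>overlap_sum\<close> this integrates
  \<open>G\<close> of the log-likelihood ratio against the unnormalised tilted distribution with
  parameter \<open>t\<close>.\<close>

definition tilt :: "real \<Rightarrow> (real \<Rightarrow> real) \<Rightarrow> real \<Rightarrow> real \<Rightarrow> real" where
  "tilt t G x y = pospow x t * pospow y (1 - t) * G (ln x - ln y)"

lemma tilt_mult:
  assumes "0 \<le> x" "0 \<le> y" "0 \<le> a" "0 \<le> b"
  shows "tilt t G (x * a) (y * b) = pospow a t * pospow b (1 - t) * tilt t (\<lambda>z. G (z + (ln a - ln b))) x y"
proof (cases "0 < x \<and> 0 < y \<and> 0 < a \<and> 0 < b")
  case True
  then have "ln (x * a) - ln (y * b) = ln x - ln y + (ln a - ln b)" by (simp add: ln_mult)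
  then show ?thesis using assms by (simp add: tilt_def pospow_mult)
next
  \<comment> \<open>A vanishing factor annihilates both sides, so the conventional value of
    \<open>ln 0\<close> never enters.\<close>
  case False
  then have "pospow x t * pospow y (1 - t) * pospow a t * pospow b (1 - t) = 0"
    using assms by (auto simp: pospow_def)
  then show ?thesis using assms by (auto simp: tilt_def pospow_mult)
qed

text \<open>Mean \<open>n * \<mu>\<close> and variance \<open>n * \<nu>\<close> of a sum of
  \<open>n\<close> independent copies, times the total mass \<open>Z ^ n\<close>. Quadratic
  polynomials are the natural class for the induction, because each factor only shifts their
  argument by \<open>L k l\<close>.\<close>

lemma overlap_sum_quadratic:
  fixes r s :: "nat \<Rightarrow> real"
  assumes W: "W \<in> carrier_mat d d" and rs: "\<And>i. 0 \<le> r i" "\<And>i. 0 \<le> s i"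
    and v_def: "\<And>i j. v i j = pospow (r i) t * pospow (s j) (1 - t) * (cmod (W $$ (i,j)))\<^sup>2"
    and L_def: "\<And>i j. L i j = ln (r i) - ln (s j)"
    and Z: "(\<Sum>i<d. \<Sum>j<d. v i j) = Z"
    and M: "(\<Sum>i<d. \<Sum>j<d. v i j * L i j) = Z * \<mu>"
    and M2: "(\<Sum>i<d. \<Sum>j<d. v i j * (L i j)\<^sup>2) = Z * (\<nu> + \<mu>\<^sup>2)"
  shows "overlap_sum d W r s n (tilt t (\<lambda>x. a + b * x + c * x\<^sup>2))
    = Z ^ n * (a + b * (n * \<mu>) + c * (n * \<nu> + (n * \<mu>)\<^sup>2))"
proof (induction n arbitrary: a b c)
  case 0
  show ?case by (simp add: overlap_sum_0 tilt_def pospow_def)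
next
  case (Suc n)
  let ?G = "\<lambda>a b c x::real. a + b * x + c * x\<^sup>2"
  have step: "(cmod (W $$ (k,l)))\<^sup>2 * overlap_sum d W r s n (\<lambda>x y. tilt t (?G a b c) (x * r k) (y * s l))
     = Z ^ n * ((a + b * (n * \<mu>) + c * (n * \<nu> + (n * \<mu>)\<^sup>2)) * v k l
        + (b + 2 * c * (n * \<mu>)) * (v k l * L k l) + c * (v k l * (L k l)\<^sup>2))" for k l
  proof -
    have shift: "(\<lambda>z. ?G a b c (z + L k l)) = ?G (a + b * L k l + c * (L k l)\<^sup>2) (b + 2 * c * L k l) c"
      by (intro ext) (simp add: algebra_simps power2_eq_square)
    have "overlap_sum d W r s n (\<lambda>x y. tilt t (?G a b c) (x * r k) (y * s l))
        = overlap_sum d W r s n (\<lambda>x y. (pospow (r k) t * pospow (s l) (1 - t)) * tilt t (\<lambda>z. ?G a b c (z + L k l)) x y)"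
      using rs by (intro overlap_sum_cong) (auto simp: tilt_mult L_def)
    also have "\<dots> = (pospow (r k) t * pospow (s l) (1 - t)) * (Z ^ n * ((a + b * L k l + c * (L k l)\<^sup>2)
        + (b + 2 * c * L k l) * (n * \<mu>) + c * (n * \<nu> + (n * \<mu>)\<^sup>2)))"
      unfolding overlap_sum_scale shift Suc.IH ..
    finally show ?thesis by (simp add: v_def algebra_simps)
  qed
  have "overlap_sum d W r s (Suc n) (tilt t (?G a b c))
     = Z ^ n * ((a + b * (n * \<mu>) + c * (n * \<nu> + (n * \<mu>)\<^sup>2)) * Z
        + (b + 2 * c * (n * \<mu>)) * (Z * \<mu>) + c * (Z * (\<nu> + \<mu>\<^sup>2)))"
    unfolding overlap_sum_Suc[OF W] step
    by (simp only: sum.distrib sum_distrib_left[symmetric] Z M M2)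
  then show ?case by (simp add: algebra_simps power2_eq_square)
qed

text \<open>Under the conditions on \<open>t\<close> and \<open>\<mu>\<close> the minimum is at
  least the tilted weight times \<open>exp (-z)\<close>, with \<open>z\<close> the distance of
  \<open>l\<close> from \<open>\<mu>\<close>. The exponential is then bounded below by a quadratic,
  through \<open>1 + u \<le> exp u\<close> and \<open>z \<le> z^2/(2 m) + m/2\<close>, so that two
  moments suffice for Cramer's bound.\<close>

lemma min_ge_tilted:
  fixes x y t m \<mu> :: real
  assumes xy: "0 \<le> x" "0 \<le> y" and m: "0 < m"
    and t: "0 \<le> t" "t \<le> 1" "\<mu> = 0 \<or> t = 1 \<and> \<mu> \<le> 0 \<or> t = 0 \<and> 0 \<le> \<mu>"
  shows "tilt t (\<lambda>l. exp (-m) * (1 + m / 2 - (l - \<mu>)\<^sup>2 / (2 * m))) x y \<le> min x y"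
proof (cases "0 < x \<and> 0 < y")
  case False
  then show ?thesis using xy by (auto simp: tilt_def pospow_def)
next
  case True
  define l where "l = ln x - ln y"
  define z where "z = \<bar>l - \<mu>\<bar>"
  have "z \<le> z\<^sup>2 / (2 * m) + m / 2"
    using sum_squares_ge_zero[of "z - m" 0] m by (simp add: field_simps power2_eq_square)
  then have "exp (-m) * (1 + m / 2 - z\<^sup>2 / (2 * m)) \<le> exp (-m) * (1 + (m - z))"
    by (intro mult_left_mono) auto
  also have "\<dots> \<le> exp (-m) * exp (m - z)"
    by (intro mult_left_mono exp_ge_add_one_self) auto
  also have "\<dots> = exp (-z)" by (simp flip: exp_add)
  finally have 1: "exp (-m) * (1 + m / 2 - (l - \<mu>)\<^sup>2 / (2 * m)) \<le> exp (-z)" by (simp add: z_def)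
  have 2: "pospow x t * pospow y (1 - t) = exp (t * ln x + (1 - t) * ln y)"
    using True by (simp add: pospow_def powr_def exp_add)
  have "(1 - t) * \<bar>l\<bar> \<le> 1 * \<bar>l\<bar>" "t * \<bar>l\<bar> \<le> 1 * \<bar>l\<bar>" using t by (intro mult_right_mono; simp)+
  moreover have "\<bar>(1 - t) * l\<bar> = (1 - t) * \<bar>l\<bar>" "\<bar>t * l\<bar> = t * \<bar>l\<bar>" using t by (simp_all add: abs_mult)
  ultimately have "-z \<le> (1 - t) * l" "-z \<le> - (t * l)"
    using t(3) by (auto simp: z_def)
  then have "t * ln x + (1 - t) * ln y - z \<le> ln x" "t * ln x + (1 - t) * ln y - z \<le> ln y"
    by (auto simp: l_def algebra_simps)
  then have "exp (t * ln x + (1 - t) * ln y - z) \<le> min x y"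
    using True by (simp add: ln_ge_iff)
  moreover have "tilt t (\<lambda>l. exp (-m) * (1 + m / 2 - (l - \<mu>)\<^sup>2 / (2 * m))) x y \<le>
     exp (t * ln x + (1 - t) * ln y) * exp (-z)"
    unfolding tilt_def 2 l_def[symmetric] using 1 by (intro mult_left_mono) auto
  moreover have "exp (t * ln x + (1 - t) * ln y) * exp (-z) = exp (t * ln x + (1 - t) * ln y - z)"
    by (simp flip: exp_add)
  ultimately show ?thesis by linarith
qed

text \<open>Cramer's lower bound: at the parameter \<open>t\<close> chosen here the tilted distribution
  \<open>r\<^sub>i\<^sup>t s\<^sub>j\<^sup>1\<^sup>-\<^sup>t w\<^sub>i\<^sub>j\<close> makes the log-likelihood ratio centred (or of the harmless sign at the endpoints
  of \<open>[0,1]\<close>), so that its \<open>n\<close>-fold sum is \<open>o(n)\<close> by the second-moment bound.\<close>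

lemma overlap_sum_min_ge:
  fixes r s :: "nat \<Rightarrow> real"
  assumes W: "W \<in> carrier_mat d d" and rs: "\<And>i. 0 \<le> r i" "\<And>i. 0 \<le> s i"
    and ne: "overlap_support d W r s \<noteq> {}"
  obtains t where "0 \<le> t" "t \<le> 1"
    "\<And>\<eta>. 0 < \<eta> \<Longrightarrow> \<forall>\<^sub>F n in sequentially. (overlap_pow d W r s t * exp (-\<eta>)) ^ n \<le> overlap_sum d W r s n min"
proof -
  define v where "v t i j = pospow (r i) t * pospow (s j) (1 - t) * (cmod (W $$ (i,j)))\<^sup>2" for t i j
  define L where "L i j = ln (r i) - ln (s j)" for i j
  \<comment> \<open>The derivative of \<open>overlap_pow\<close> in \<open>t\<close>. The choice of
    \<open>t\<close> below thus minimises this convex function over \<open>[0,1]\<close>, with the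
    one-sided conditions at the endpoints.\<close>
  define h where "h t = (\<Sum>i<d. \<Sum>j<d. v t i j * L i j)" for t
  have cont: "continuous_on UNIV (\<lambda>x. pospow a x)" for a
    by (cases "a > 0") (auto simp: pospow_def intro!: continuous_intros)
  have "continuous_on {0..1} h"
    unfolding h_def v_def
    by (intro continuous_intros continuous_on_subset[OF cont] continuous_on_compose2[OF cont]) auto
  then have IVT: "\<exists>t. 0 \<le> t \<and> t \<le> 1 \<and> h t = 0" if "h 0 \<le> 0" "0 \<le> h 1"
    using IVT'[of h 0 0 1] that by auto
  have "\<exists>t. 0 \<le> t \<and> t \<le> 1 \<and> (h t = 0 \<or> t = 1 \<and> h t \<le> 0 \<or> t = 0 \<and> 0 \<le> h t)"
  proof (cases "h 1 \<le> 0")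
    case True
    then show ?thesis by (intro exI[of _ 1]) simp
  next
    case False
    show ?thesis
    proof (cases "0 \<le> h 0")
      case True
      then show ?thesis by (intro exI[of _ 0]) simp
    next
      case False
      then show ?thesis using IVT \<open>\<not> h 1 \<le> 0\<close> by fastforce
    qed
  qed
  then obtain t where t: "0 \<le> t" "t \<le> 1" "h t = 0 \<or> t = 1 \<and> h t \<le> 0 \<or> t = 0 \<and> 0 \<le> h t" by blast
  define Z where "Z = overlap_pow d W r s t"
  have Z: "0 < Z" using overlap_pow_pos[OF ne] by (simp add: Z_def)
  define \<mu> where "\<mu> = h t / Z"
  define \<nu> where "\<nu> = (\<Sum>i<d. \<Sum>j<d. v t i j * (L i j)\<^sup>2) / Z - \<mu>\<^sup>2"
  have quad: "overlap_sum d W r s n (tilt t (\<lambda>x. a + b * x + c * x\<^sup>2))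
    = Z ^ n * (a + b * (n * \<mu>) + c * (n * \<nu> + (n * \<mu>)\<^sup>2))" for n a b c
    by (rule overlap_sum_quadratic[OF W rs v_def L_def])
      (use Z in \<open>auto simp: Z_def \<mu>_def \<nu>_def h_def v_def overlap_pow_def field_simps\<close>)
  have "\<forall>\<^sub>F n in sequentially. (Z * exp (-\<eta>)) ^ n \<le> overlap_sum d W r s n min" if \<eta>: "0 < \<eta>" for \<eta>
  proof -
    \<comment> \<open>Beyond \<open>N\<close> the variance \<open>n * \<nu>\<close> is at most the
      square of the slack \<open>m = n * \<eta>\<close>. The quadratic term then costs at most
      \<open>m / 2\<close>, which the constant term compensates.\<close>
    obtain N :: nat where N: "\<nu> / \<eta>\<^sup>2 < N" using reals_Archimedean2 by blast
    show ?thesis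
    proof (rule eventually_sequentiallyI)
      fix n assume n: "Suc N \<le> n"
      define m where "m = n * \<eta>"
      have m: "0 < m" using n \<eta> by (simp add: m_def)
      have \<mu>: "n * \<mu> = 0 \<or> t = 1 \<and> n * \<mu> \<le> 0 \<or> t = 0 \<and> 0 \<le> n * \<mu>"
        using t(3) Z by (auto simp: \<mu>_def divide_nonpos_pos mult_nonneg_nonpos)
      have "\<nu> < N * \<eta>\<^sup>2" using N \<eta> by (simp add: pos_divide_less_eq)
      also have "N * \<eta>\<^sup>2 \<le> n * \<eta>\<^sup>2" using n by (intro mult_right_mono) auto
      finally have "n * \<nu> \<le> m\<^sup>2"
        using mult_left_mono[of \<nu> "n * \<eta>\<^sup>2" n] by (simp add: m_def power_mult_distrib power2_eq_square mult_ac)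
      then have "n * \<nu> / (2 * m) \<le> m / 2" using m by (simp add: field_simps power2_eq_square)
      then have "exp (-m) * Z ^ n * 1 \<le> exp (-m) * Z ^ n * (1 + m / 2 - n * \<nu> / (2 * m))"
        using Z by (intro mult_left_mono) auto
      also have "\<dots> = overlap_sum d W r s n (tilt t (\<lambda>l. exp (-m) * (1 + m / 2 - (l - n * \<mu>)\<^sup>2 / (2 * m))))"
      proof -
        have eq: "(\<lambda>l. exp (-m) * (1 + m / 2 - (l - n * \<mu>)\<^sup>2 / (2 * m))) = (\<lambda>l. exp (-m) * (1 + m / 2 - (n * \<mu>)\<^sup>2 / (2 * m))
            + (exp (-m) * (n * \<mu>) / m) * l + (- exp (-m) / (2 * m)) * l\<^sup>2)"
          using m by (intro ext) (simp add: field_simps power2_eq_square)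
        show ?thesis unfolding eq quad using m by (simp add: field_simps power2_eq_square)
      qed
      also have "\<dots> \<le> overlap_sum d W r s n min"
        using rs by (intro overlap_sum_mono min_ge_tilted tev_nonneg m t \<mu>)
      finally show "(Z * exp (-\<eta>)) ^ n \<le> overlap_sum d W r s n min"
        by (simp add: m_def power_mult_distrib mult.commute flip: exp_of_nat_mult)
    qed
  qed
  with t that show ?thesis unfolding Z_def by blast
qed

section \<open>Hoelder's inequality with equality case, and log-convexity\<close>

text \<open>Apply \<open>ln u \<le> u - 1\<close> to \<open>a / m\<close> and \<open>b / m\<close>,
  where \<open>m\<close> is the weighted mean; equality holds only at \<open>u = 1\<close>, which
  forces both numbers to be \<open>m\<close>.\<close>

lemma weighted_am_gm:
  fixes a b \<theta> :: real
  assumes "0 < a" "0 < b" "0 < \<theta>" "\<theta> < 1"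
  shows "a powr \<theta> * b powr (1 - \<theta>) \<le> \<theta> * a + (1 - \<theta>) * b"
    "a powr \<theta> * b powr (1 - \<theta>) = \<theta> * a + (1 - \<theta>) * b \<Longrightarrow> a = b"
proof -
  define m where "m = \<theta> * a + (1 - \<theta>) * b"
  have m: "0 < m" using assms by (simp add: m_def add_pos_pos)
  have sum: "\<theta> * (a / m - 1) + (1 - \<theta>) * (b / m - 1) = 0"
    using m by (simp add: field_simps) (simp add: m_def algebra_simps)
  have la: "ln (a / m) \<le> a / m - 1" and lb: "ln (b / m) \<le> b / m - 1"
    using assms m by (auto intro!: ln_le_minus_one)
  have e: "ln (a powr \<theta> * b powr (1 - \<theta>)) = \<theta> * ln (a / m) + (1 - \<theta>) * ln (b / m) + ln m"
    using assms m by (simp add: ln_mult ln_div algebra_simps)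
  have ta: "\<theta> * ln (a / m) \<le> \<theta> * (a / m - 1)" and tb: "(1 - \<theta>) * ln (b / m) \<le> (1 - \<theta>) * (b / m - 1)"
    using la lb assms by (auto intro!: mult_left_mono)
  have "ln (a powr \<theta> * b powr (1 - \<theta>)) \<le> ln m" using e sum ta tb by linarith
  then show "a powr \<theta> * b powr (1 - \<theta>) \<le> \<theta> * a + (1 - \<theta>) * b"
    using assms m by (simp add: m_def)
  assume "a powr \<theta> * b powr (1 - \<theta>) = \<theta> * a + (1 - \<theta>) * b"
  then have "\<theta> * ln (a / m) + (1 - \<theta>) * ln (b / m) = 0" using e by (simp add: m_def)
  then have "\<theta> * ln (a / m) = \<theta> * (a / m - 1)" "(1 - \<theta>) * ln (b / m) = (1 - \<theta>) * (b / m - 1)"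
    using sum ta tb by linarith+
  then have "ln (a / m) = a / m - 1" "ln (b / m) = b / m - 1" using assms by auto
  then have "a / m = 1" "b / m = 1" using assms m ln_eq_minus_one by (meson divide_pos_pos)+
  then show "a = b" using m by simp
qed

text \<open>After normalising both families to sum 1, the weighted mean inequality holds term by
  term, so equality of the sums forces equality in each term.\<close>

lemma Holder_sum:
  fixes u v :: "'a \<Rightarrow> real"
  assumes fin: "finite I" and ne: "I \<noteq> {}" and pos: "\<And>i. i \<in> I \<Longrightarrow> 0 < u i" "\<And>i. i \<in> I \<Longrightarrow> 0 < v i"
    and \<theta>: "0 < \<theta>" "\<theta> < 1"
  shows "(\<Sum>i\<in>I. u i powr \<theta> * v i powr (1 - \<theta>)) \<le> sum u I powr \<theta> * sum v I powr (1 - \<theta>)"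
    "(\<Sum>i\<in>I. u i powr \<theta> * v i powr (1 - \<theta>)) = sum u I powr \<theta> * sum v I powr (1 - \<theta>)
      \<Longrightarrow> i \<in> I \<Longrightarrow> u i / sum u I = v i / sum v I"
proof -
  define A where "A = sum u I"
  define B where "B = sum v I"
  have AB: "0 < A" "0 < B" unfolding A_def B_def using fin ne pos by (auto intro!: sum_pos)
  let ?f = "\<lambda>i. (u i / A) powr \<theta> * (v i / B) powr (1 - \<theta>)"
  let ?g = "\<lambda>i. \<theta> * (u i / A) + (1 - \<theta>) * (v i / B)"
  have f: "(\<Sum>i\<in>I. u i powr \<theta> * v i powr (1 - \<theta>)) = (A powr \<theta> * B powr (1 - \<theta>)) * sum ?f I"
    unfolding sum_distrib_left using AB pos by (intro sum.cong refl) (auto simp: powr_divide less_imp_le)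
  have g: "sum ?g I = 1"
    using AB by (simp add: sum.distrib A_def B_def flip: sum_distrib_left sum_divide_distrib)
  have le: "?f i \<le> ?g i" if "i \<in> I" for i
    using that pos AB \<theta> by (intro weighted_am_gm) auto
  have "sum ?f I \<le> sum ?g I" by (intro sum_mono le)
  then have f1: "sum ?f I \<le> 1" using g by linarith
  then show "(\<Sum>i\<in>I. u i powr \<theta> * v i powr (1 - \<theta>)) \<le> sum u I powr \<theta> * sum v I powr (1 - \<theta>)"
    unfolding f A_def[symmetric] B_def[symmetric] by (intro mult_left_le f1) auto
  assume eq: "(\<Sum>i\<in>I. u i powr \<theta> * v i powr (1 - \<theta>)) = sum u I powr \<theta> * sum v I powr (1 - \<theta>)"
    and i: "i \<in> I"
  have "A powr \<theta> * B powr (1 - \<theta>) * sum ?f I = A powr \<theta> * B powr (1 - \<theta>) * 1"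
    using eq unfolding f A_def[symmetric] B_def[symmetric] by simp
  then have "sum ?f I = 1" using AB by simp
  then have "sum ?f I = sum ?g I" using g by linarith
  then have "?f i = ?g i"
    by (rule sum_mono_inv[OF _ le i fin])
  from weighted_am_gm(2)[OF _ _ \<theta> this] show "u i / sum u I = v i / sum v I"
    unfolding A_def[symmetric] B_def[symmetric] using i pos AB by simp
qed

text \<open>The summands interpolate geometrically in the exponent, so Hoelder's inequality applies.
  In the equality case the normalised tilted distributions at \<open>x\<close> and \<open>y\<close>
  coincide, and the overlap weight cancels from that identity.\<close>

lemma overlap_pow_log_convex:
  fixes r s :: "nat \<Rightarrow> real"
  assumes ne: "overlap_support d W r s \<noteq> {}" and \<theta>: "0 < \<theta>" "\<theta> < 1"
  defines "Q \<equiv> overlap_pow d W r s"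
  shows "ln (Q (\<theta> * x + (1 - \<theta>) * y)) \<le> \<theta> * ln (Q x) + (1 - \<theta>) * ln (Q y)"
    "ln (Q (\<theta> * x + (1 - \<theta>) * y)) = \<theta> * ln (Q x) + (1 - \<theta>) * ln (Q y) \<Longrightarrow>
      (i,j) \<in> overlap_support d W r s \<Longrightarrow>
      r i powr x * s j powr (1 - x) / Q x = r i powr y * s j powr (1 - y) / Q y"
proof -
  let ?I = "overlap_support d W r s"
  define u where "u x = (\<lambda>(i,j). r i powr x * s j powr (1 - x) * (cmod (W $$ (i,j)))\<^sup>2)" for x
  have Q: "Q t = sum (u t) ?I" for t by (simp add: Q_def u_def overlap_pow_eq_sum)
  have upos: "0 < u t i" if "i \<in> ?I" for t i
    using that by (auto simp: u_def overlap_support_def)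
  have Qpos: "0 < Q t" for t unfolding Q_def by (rule overlap_pow_pos[OF ne])
  have conv: "Q (\<theta> * x + (1 - \<theta>) * y) = (\<Sum>i\<in>?I. u x i powr \<theta> * u y i powr (1 - \<theta>))"
    unfolding Q
  proof (intro sum.cong refl)
    fix p assume p: "p \<in> ?I"
    obtain i j where ij: "p = (i,j)" by (cases p)
    define c where "c = (cmod (W $$ (i,j)))\<^sup>2"
    have w: "0 < c" and pos: "0 < r i" "0 < s j"
      using p ij by (auto simp: overlap_support_def c_def)
    have u: "u t p = r i powr t * s j powr (1 - t) * c" for t
      by (simp add: u_def ij c_def)
    have "ln (u (\<theta> * x + (1 - \<theta>) * y) p) = ln (u x p powr \<theta> * u y p powr (1 - \<theta>))"
      unfolding u using w pos by (simp add: ln_mult ln_powr) (simp add: algebra_simps)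
    then show "u (\<theta> * x + (1 - \<theta>) * y) p = u x p powr \<theta> * u y p powr (1 - \<theta>)"
      using upos[OF p, of x] upos[OF p, of y] upos[OF p, of "\<theta> * x + (1 - \<theta>) * y"]
      by (subst (asm) ln_inj_iff) auto
  qed
  have lnR: "ln (Q x powr \<theta> * Q y powr (1 - \<theta>)) = \<theta> * ln (Q x) + (1 - \<theta>) * ln (Q y)"
    using Qpos by (simp add: ln_mult ln_powr less_imp_neq[symmetric])
  have R: "0 < Q x powr \<theta> * Q y powr (1 - \<theta>)"
    using Qpos[of x] Qpos[of y] by auto
  have H: "Q (\<theta> * x + (1 - \<theta>) * y) \<le> Q x powr \<theta> * Q y powr (1 - \<theta>)"
    unfolding conv unfolding Q by (rule Holder_sum) (use ne upos \<theta> in auto)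
  show "ln (Q (\<theta> * x + (1 - \<theta>) * y)) \<le> \<theta> * ln (Q x) + (1 - \<theta>) * ln (Q y)"
    unfolding lnR[symmetric] using H Qpos R by (intro ln_mono) auto
  assume eq: "ln (Q (\<theta> * x + (1 - \<theta>) * y)) = \<theta> * ln (Q x) + (1 - \<theta>) * ln (Q y)"
    and ij: "(i,j) \<in> ?I"
  have "Q (\<theta> * x + (1 - \<theta>) * y) = Q x powr \<theta> * Q y powr (1 - \<theta>)"
    using eq lnR Qpos[of "\<theta> * x + (1 - \<theta>) * y"] R by (simp flip: ln_inj_iff)
  then have "u x (i,j) / Q x = u y (i,j) / Q y"
    unfolding conv unfolding Q using Holder_sum(2)[of ?I "u x" "u y" \<theta> "(i,j)"] ne upos \<theta> ij by auto
  moreover have "0 < (cmod (W $$ (i,j)))\<^sup>2" using ij by (auto simp: overlap_support_def)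
  ultimately show "r i powr x * s j powr (1 - x) / Q x = r i powr y * s j powr (1 - y) / Q y"
    using Qpos[of x] Qpos[of y] by (simp add: u_def field_simps)
qed

section \<open>Test-measured divergences\<close>

lemma mult_smult_mat_distrib: "dim_col A = dim_row B \<Longrightarrow> A * (c \<cdot>\<^sub>m B) = c \<cdot>\<^sub>m (A * B)" for A :: "complex mat"
  by (rule mult_smult_distrib[of A "dim_row A" "dim_col A" B "dim_col B"]) auto

lemma smult_mult_mat_distrib: "dim_col A = dim_row B \<Longrightarrow> (c \<cdot>\<^sub>m A) * B = c \<cdot>\<^sub>m (A * B)" for A :: "complex mat"
  by (rule mult_smult_assoc_mat[of A "dim_row A" "dim_col A" B "dim_col B"]) auto

lemma smult_diag_conj:
  assumes "U \<in> carrier_mat n n"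
  shows "complex_of_real c \<cdot>\<^sub>m (U * diagm n (\<lambda>i. complex_of_real (f i)) * adj U)
    = U * diagm n (\<lambda>i. complex_of_real (c * f i)) * adj U"
proof -
  have "diagm n (\<lambda>i. complex_of_real (c * f i)) = complex_of_real c \<cdot>\<^sub>m diagm n (\<lambda>i. complex_of_real (f i))"
    by (rule eq_matI) auto
  then show ?thesis
    using assms by (simp add: mult_smult_mat_distrib smult_mult_mat_distrib)
qed

lemma psd_smult:
  assumes "psd A" "A \<in> carrier_mat n n" "0 \<le> c"
  shows "psd (complex_of_real c \<cdot>\<^sub>m A)"
proof -
  obtain U l where U: "U \<in> carrier_mat n n" "unitary U" "A = U * diagm n (\<lambda>i. complex_of_real (l i)) * adj U"
    "\<And>i. 0 \<le> l i" using psd_spectral[OF assms(1,2)] by blast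
  show ?thesis
    unfolding U(3) smult_diag_conj[OF U(1)] by (rule psd_diag_conj[OF _ U(1)]) (use U assms in auto)
qed

lemma mpow_smult:
  assumes "psd A" "A \<in> carrier_mat n n" "0 < c"
  shows "mpow (complex_of_real c \<cdot>\<^sub>m A) x = complex_of_real (c powr x) \<cdot>\<^sub>m mpow A x"
proof -
  obtain U l where U: "U \<in> carrier_mat n n" "unitary U" "A = U * diagm n (\<lambda>i. complex_of_real (l i)) * adj U"
    "\<And>i. 0 \<le> l i" using psd_spectral[OF assms(1,2)] by blast
  have e: "complex_of_real c \<cdot>\<^sub>m A = U * diagm n (\<lambda>i. complex_of_real (c * l i)) * adj U"
    unfolding U(3) by (rule smult_diag_conj[OF U(1)])
  have p: "pospow (c * l i) x = c powr x * pospow (l i) x" for i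
    using U(4)[of i] assms(3) by (simp add: pospow_mult) (simp add: pospow_def)
  show ?thesis
    unfolding mpow_eq[OF U(1,2) e] mpow_eq[OF U(1-3)] smult_diag_conj[OF U(1)] p ..
qed

text \<open>The argument of the logarithm in \<open>Dcl\<close>. Estimates are made at this level,
  where no infinite value occurs; as \<open>\<alpha> - 1\<close> is negative, \<open>Dcl_ge\<close>
  and \<open>Dcl_le\<close> reverse them.\<close>

definition Renyi_sum :: "real \<Rightarrow> real \<times> real \<Rightarrow> real \<times> real \<Rightarrow> real" where
  "Renyi_sum \<alpha> p q = fst p powr \<alpha> * fst q powr (1 - \<alpha>) + snd p powr \<alpha> * snd q powr (1 - \<alpha>)"

lemma Dcl_eq: "Dcl \<alpha> p q = (if Renyi_sum \<alpha> p q = 0 then \<infinity> else ereal (ln (Renyi_sum \<alpha> p q) / (\<alpha> - 1)))"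
  by (simp add: Dcl_def Renyi_sum_def Let_def)

lemma Renyi_sum_swap: "Renyi_sum \<alpha> (prod.swap p) (prod.swap q) = Renyi_sum \<alpha> p q"
  by (simp add: Renyi_sum_def)

lemma Renyi_sum_flip: "Renyi_sum (1 - \<alpha>) q p = Renyi_sum \<alpha> p q"
  by (simp add: Renyi_sum_def mult.commute)

lemma Renyi_sum_nonneg: "0 \<le> Renyi_sum \<alpha> p q"
  by (simp add: Renyi_sum_def)

lemma Dcl_ge:
  assumes "Renyi_sum \<alpha> p q \<le> S" "\<alpha> < 1" "0 < S"
  shows "ereal (ln S / (\<alpha> - 1)) \<le> Dcl \<alpha> p q"
proof (cases "Renyi_sum \<alpha> p q = 0")
  case False
  then have "0 < Renyi_sum \<alpha> p q" using Renyi_sum_nonneg[of \<alpha> p q] by linarith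
  then have "ln (Renyi_sum \<alpha> p q) \<le> ln S" using assms by simp
  then show ?thesis using False assms by (simp add: Dcl_eq divide_right_mono_neg)
qed (simp add: Dcl_eq)

lemma Dcl_le:
  assumes "S \<le> Renyi_sum \<alpha> p q" "\<alpha> < 1" "0 < S"
  shows "Dcl \<alpha> p q \<le> ereal (ln S / (\<alpha> - 1))"
proof -
  have "ln S \<le> ln (Renyi_sum \<alpha> p q)" "Renyi_sum \<alpha> p q \<noteq> 0" using assms by auto
  then show ?thesis using assms by (simp add: Dcl_eq divide_right_mono_neg)
qed

text \<open>Each summand is small although one of its factors is at least 1/2, so the other factor
  is small. For the first summand that factor is controlled by \<open>half\<close>; the second needs
  the bound on \<open>fst q\<close> obtained from the first.\<close>

lemma Renyi_sum_small:
  assumes \<alpha>: "0 < \<alpha>" "\<alpha> < 1"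
    and p: "0 \<le> fst p" "0 \<le> snd p" "fst p + snd p = 1" and q: "0 \<le> fst q" "0 \<le> snd q" "fst q + snd q = 1"
    and half: "1/2 \<le> fst p" and E: "E \<le> 1/8" "Renyi_sum \<alpha> p q \<le> E"
  shows "snd p \<le> (2 * E) powr (1 / \<alpha>)" "fst q \<le> (2 * E) powr (1 / (1 - \<alpha>))"
proof -
  have large: "1/2 \<le> x powr y" if "1/2 \<le> x" "x \<le> 1" "0 \<le> y" "y \<le> 1" for x y :: real
    using powr_mono'[of y 1 x] that by simp
  have root: "x \<le> (2 * E) powr (1 / y)" if "x powr y \<le> 2 * E" "0 \<le> x" "0 < y" for x y :: real
  proof -
    have "x = (x powr y) powr (1 / y)" using that by (simp add: powr_powr)
    also have "\<dots> \<le> (2 * E) powr (1 / y)" using that by (intro powr_mono2) auto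
    finally show ?thesis .
  qed
  have s1: "fst p powr \<alpha> * fst q powr (1 - \<alpha>) \<le> E" and s2: "snd p powr \<alpha> * snd q powr (1 - \<alpha>) \<le> E"
    using E(2) by (simp_all add: Renyi_sum_def) (smt (verit) mult_nonneg_nonneg powr_ge_zero)+
  have "1/2 * fst q powr (1 - \<alpha>) \<le> fst p powr \<alpha> * fst q powr (1 - \<alpha>)"
    using p half \<alpha> by (intro mult_right_mono large) auto
  with s1 have q1: "fst q powr (1 - \<alpha>) \<le> 2 * E" by simp
  then show "fst q \<le> (2 * E) powr (1 / (1 - \<alpha>))" using \<alpha> q by (intro root) auto
  \<comment> \<open>Lowering the exponent increases a power of a number in \<open>[0,1]\<close>.
    With \<open>E \<le> 1/8\<close> this gives \<open>fst q \<le> 1/4\<close>, which keeps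
    \<open>snd q\<close> above 1/2.\<close>
  have "fst q powr 1 \<le> fst q powr (1 - \<alpha>)" using \<alpha> q by (intro powr_mono') auto
  then have "fst q \<le> 1/4" using q1 E(1) q(1) by simp
  then have "snd p powr \<alpha> * (1/2) \<le> snd p powr \<alpha> * snd q powr (1 - \<alpha>)"
    using q \<alpha> by (intro mult_left_mono large) auto
  with s2 have "snd p powr \<alpha> \<le> 2 * E" by simp
  then show "snd p \<le> (2 * E) powr (1 / \<alpha>)" using \<alpha> p by (intro root) auto
qed

lemma meas_probability:
  assumes "psd A" "A \<in> carrier_mat n n" "mtrace A = 1" "T \<in> carrier_mat n n" "is_test T"
  shows "0 \<le> fst (meas T A)" "0 \<le> snd (meas T A)" "fst (meas T A) + snd (meas T A) = 1"
proof -
  note T = is_testD[OF assms(5,4)]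
  have n: "dim_row T = n" using assms by simp
  show "0 \<le> fst (meas T A)" "0 \<le> snd (meas T A)"
    unfolding meas_def n fst_conv snd_conv
    using mtrace_psd_mult_nonneg[OF assms(1) T(1) assms(2,4)]
      mtrace_psd_mult_nonneg[OF assms(1) T(2) assms(2) minus_carrier_mat[OF assms(4)]] by auto
  have "mtrace (A * (1\<^sub>m n - T)) = 1 - mtrace (A * T)"
    using assms by (simp add: mat_alg mtrace_minus)
  then show "fst (meas T A) + snd (meas T A) = 1" by (simp add: meas_def n)
qed

lemma one_minus_one_minus_mat: "T \<in> carrier_mat n n \<Longrightarrow> 1\<^sub>m n - (1\<^sub>m n - T) = T" for T :: "complex mat"
  by (intro eq_matI) auto

lemma meas_compl: "T \<in> carrier_mat n n \<Longrightarrow> meas (1\<^sub>m n - T) A = prod.swap (meas T A)"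
  by (simp add: meas_def one_minus_one_minus_mat)

lemma is_test_compl: "is_test T \<Longrightarrow> T \<in> carrier_mat n n \<Longrightarrow> is_test (1\<^sub>m n - T)"
  by (simp add: is_test_def one_minus_one_minus_mat)

lemma tev_scale: "tev d (\<lambda>i. c * s i) n j = c ^ n * tev d s n j"
  by (induction n arbitrary: j) auto

lemma is_test_mpow_0:
  assumes "psd A" "A \<in> carrier_mat n n"
  shows "is_test (mpow A 0)"
proof -
  obtain U l where U: "U \<in> carrier_mat n n" "unitary U" "A = U * diagm n (\<lambda>i. complex_of_real (l i)) * adj U"
    "\<And>i. 0 \<le> l i" using psd_spectral[OF assms] by blast
  show ?thesis
    unfolding mpow_eq[OF U(1-3)] by (rule is_test_diag_conj[OF U(1,2)]) (simp add: pospow_def)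
qed

section \<open>The overlap function of a pair of states\<close>

text \<open>With the eigenbases fixed in the context, \<open>swap\<close> gives every lemma a mirror
  image with the states exchanged and \<open>t\<close> replaced by \<open>1 - t\<close>.\<close>

locale state_pair =
  fixes d :: nat and \<rho> \<sigma> U V :: "complex mat" and r s :: "nat \<Rightarrow> real"
  assumes U: "U \<in> carrier_mat d d" "unitary U" "\<rho> = U * diagm d (\<lambda>i. complex_of_real (r i)) * adj U"
    and V: "V \<in> carrier_mat d d" "unitary V" "\<sigma> = V * diagm d (\<lambda>i. complex_of_real (s i)) * adj V"
    and r_nonneg: "\<And>i. 0 \<le> r i" and s_nonneg: "\<And>i. 0 \<le> s i"
    and trace_\<rho>: "mtrace \<rho> = 1" and trace_\<sigma>: "mtrace \<sigma> = 1"
begin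

lemma swap: "state_pair d \<sigma> \<rho> V U s r"
  by unfold_locales (fact U V r_nonneg s_nonneg trace_\<rho> trace_\<sigma>)+

definition W where "W = adj U * V"

definition Q where "Q = overlap_pow d W r s"

definition pairs where "pairs = overlap_support d W r s"

lemma W_carrier: "W \<in> carrier_mat d d"
  unfolding W_def using U V by (intro carrier_matI) simp_all

lemma \<rho>: "\<rho> \<in> carrier_mat d d" "psd \<rho>"
proof -
  show "\<rho> \<in> carrier_mat d d" unfolding U(3) using U(1) by (intro carrier_matI) simp_all
  show "psd \<rho>" unfolding U(3) by (rule psd_diag_conj[OF _ U(1)]) (rule r_nonneg)
qed

lemma \<sigma>: "\<sigma> \<in> carrier_mat d d" "psd \<sigma>"
proof -
  show "\<sigma> \<in> carrier_mat d d" unfolding V(3) using V(1) by (intro carrier_matI) simp_all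
  show "psd \<sigma>" unfolding V(3) by (rule psd_diag_conj[OF _ V(1)]) (rule s_nonneg)
qed

lemma trace_mpow: "mtrace (mpow \<rho> t * mpow \<sigma> (1 - t)) = complex_of_real (Q t)"
proof -
  have dims: "dim_row U = d" "dim_col U = d" "dim_row V = d" "dim_col V = d" using U V by auto
  let ?D = "diagm d (\<lambda>i. complex_of_real (pospow (s i) (1 - t)))"
  have "adj U * mpow \<sigma> (1 - t) * U = W * ?D * adj W"
    unfolding mpow_eq[OF V] W_def using dims by (simp add: mat_assoc adj_mult)
  moreover have "(W * ?D * adj W) $$ (i,i) = complex_of_real (\<Sum>j<d. pospow (s j) (1 - t) * (cmod (W $$ (i,j)))\<^sup>2)" if "i < d" for i
    using W_carrier that
    by (subst index_mult_sum) (auto simp: index_mult_diagm complex_norm_square mult_ac simp del: index_mult_mat(1) of_real_power intro!: sum.cong)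
  moreover have "mtrace (mpow \<rho> t * mpow \<sigma> (1 - t)) = (\<Sum>i<d. complex_of_real (pospow (r i) t) * (adj U * mpow \<sigma> (1 - t) * U) $$ (i,i))"
    unfolding mpow_eq[OF U] by (rule mtrace_diag_conj_mult[OF U(1) mpow_carrier[OF \<sigma>(2,1)]])
  ultimately have "mtrace (mpow \<rho> t * mpow \<sigma> (1 - t))
     = (\<Sum>i<d. complex_of_real (pospow (r i) t * (\<Sum>j<d. pospow (s j) (1 - t) * (cmod (W $$ (i,j)))\<^sup>2)))"
    by simp
  then show ?thesis
    by (simp add: Q_def overlap_pow_def sum_distrib_left mult.assoc)
qed

lemma Dpetz_eq: "Dpetz \<alpha> \<rho> \<sigma> = (if Q \<alpha> = 0 then \<infinity> else ereal (ln (Q \<alpha>) / (\<alpha> - 1)))"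
  by (simp add: Dpetz_def trace_mpow)

lemma Q_swap: "state_pair.Q d V U s r t = Q (1 - t)"
proof -
  interpret sw: state_pair d \<sigma> \<rho> V U s r by (rule swap)
  have "complex_of_real (sw.Q t) = mtrace (mpow \<rho> (1 - t) * mpow \<sigma> t)"
    unfolding sw.trace_mpow[symmetric]
    using \<rho> \<sigma> by (intro mtrace_mult_comm) auto
  then show ?thesis using trace_mpow[of "1 - t"] by simp
qed

text \<open>\<open>Q 1\<close> is the probability that \<open>\<rho>\<close> passes the projection
  onto the support of \<open>\<sigma>\<close>.\<close>

lemma Q_1_le: "Q 1 \<le> 1"
proof -
  note T = is_test_mpow_0[OF \<sigma>(2,1)] mpow_carrier[OF \<sigma>(2,1), of 0]
  have "Re (mtrace (\<rho> * mpow \<sigma> 0)) \<le> 1"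
    using meas_probability[OF \<rho>(2,1) trace_\<rho> T(2,1)] by (simp add: meas_def)
  then show ?thesis using trace_mpow[of 1] mpow_1[OF \<rho>(2,1)] by simp
qed

lemma Q_0_le: "Q 0 \<le> 1"
  using state_pair.Q_1_le[OF swap] Q_swap[of 1] by simp

lemma Q_empty: "pairs = {} \<Longrightarrow> Q t = 0"
  by (simp add: pairs_def Q_def overlap_pow_eq_sum)

lemma Q_pos: "pairs \<noteq> {} \<Longrightarrow> 0 < Q t"
  unfolding pairs_def Q_def by (rule overlap_pow_pos)

lemma Q_nonneg: "0 \<le> Q t"
  using Q_empty Q_pos by (cases "pairs = {}") (auto simp: less_imp_le)

text \<open>Convexity between \<open>0\<close> and \<open>t\<close>: because
  \<open>ln (Q 0) \<le> 0\<close>, the point at \<open>\<alpha>\<close> lies below the chord from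
  the origin to the point at \<open>t\<close>.\<close>

lemma ln_Q_ge:
  assumes ne: "pairs \<noteq> {}" and t: "0 < \<alpha>" "\<alpha> \<le> t" "t \<le> 1"
  shows "t * ln (Q \<alpha>) / \<alpha> \<le> ln (Q t)"
proof (cases "\<alpha> = t")
  case False
  define \<theta> where "\<theta> = \<alpha> / t"
  have \<theta>: "0 < \<theta>" "\<theta> < 1" using t False by (auto simp: \<theta>_def)
  have "\<theta> * t + (1 - \<theta>) * 0 = \<alpha>" using t by (simp add: \<theta>_def)
  then have "ln (Q \<alpha>) \<le> \<theta> * ln (Q t) + (1 - \<theta>) * ln (Q 0)"
    using overlap_pow_log_convex(1)[OF ne[unfolded pairs_def] \<theta>, of t 0] by (simp only: Q_def)
  also have "\<dots> \<le> \<theta> * ln (Q t)"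
    using \<theta> Q_0_le Q_pos[OF ne, of 0] by (simp add: mult_nonneg_nonpos)
  finally show ?thesis using t by (simp add: \<theta>_def field_simps)
qed (use t in simp)

lemma ln_Q_le_0:
  assumes ne: "pairs \<noteq> {}" and "0 < \<alpha>" "\<alpha> < 1"
  shows "ln (Q \<alpha>) \<le> 0"
proof -
  have "ln (Q \<alpha>) / \<alpha> \<le> ln (Q 1)" using ln_Q_ge[OF ne, of \<alpha> 1] assms by simp
  also have "\<dots> \<le> 0" using Q_1_le Q_pos[OF ne, of 1] by simp
  finally show ?thesis using assms by (simp add: divide_le_0_iff)
qed

lemma pairs_swap: "state_pair.pairs d V U s r = {} \<longleftrightarrow> pairs = {}"
proof -
  interpret sw: state_pair d \<sigma> \<rho> V U s r by (rule swap)
  have "sw.Q 0 = Q 1" using Q_swap[of 0] by simp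
  then show ?thesis
    using Q_pos[of 1] sw.Q_pos[of 0] Q_empty[of 1] sw.Q_empty[of 0] by (metis less_irrefl)
qed

lemma ln_Q_ge':
  assumes ne: "pairs \<noteq> {}" and t: "\<alpha> < 1" "t \<le> \<alpha>" "0 \<le> t"
  shows "(1 - t) * ln (Q \<alpha>) / (1 - \<alpha>) \<le> ln (Q t)"
  using state_pair.ln_Q_ge[OF swap, of "1 - \<alpha>" "1 - t"] ne t by (simp add: pairs_swap Q_swap)

text \<open>A failure between \<open>\<beta>\<close> and \<open>\<gamma>\<close> reverses the
  convexity inequality for \<open>\<gamma>\<close> between \<open>\<beta>\<close> and
  \<open>1\<close>, with 0 in place of \<open>ln (Q 1)\<close>. As \<open>ln (Q 1) \<le> 0\<close>,
  equality holds: \<open>Q 1 = 1\<close>, and \<open>r i / s j\<close> is a constant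
  \<open>c\<close> on \<open>pairs\<close>. Hence \<open>Q\<close> is geometric in \<open>t\<close>,
  and \<open>Q 1 = 1\<close> determines \<open>c\<close> from \<open>Q 0\<close>.\<close>

lemma Dpetz_not_strict_mono:
  assumes "\<not> strict_mono_on {0<..<1} (\<lambda>\<beta>. Dpetz \<beta> \<rho> \<sigma>)"
  shows "Q t = Q 0 powr (1 - t)"
proof (cases "pairs = {}")
  case True
  \<comment> \<open>\<open>Q\<close> vanishes identically here, and \<open>0 powr (1 - t)\<close> is
    0 even at \<open>t = 1\<close>.\<close>
  then show ?thesis by (simp add: Q_empty)
next
  case ne: False
  note Qp = Q_pos[OF ne]
  obtain \<beta> \<gamma> where \<beta>\<gamma>: "0 < \<beta>" "\<beta> < \<gamma>" "\<gamma> < 1" "\<not> Dpetz \<beta> \<rho> \<sigma> < Dpetz \<gamma> \<rho> \<sigma>"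
    using assms by (auto simp: strict_mono_on_def)
  have le: "ln (Q \<gamma>) / (\<gamma> - 1) \<le> ln (Q \<beta>) / (\<beta> - 1)"
    using \<beta>\<gamma>(4) Qp[of \<beta>] Qp[of \<gamma>] by (simp add: Dpetz_eq)
  define \<theta> where "\<theta> = (1 - \<gamma>) / (1 - \<beta>)"
  have \<theta>: "0 < \<theta>" "\<theta> < 1" using \<beta>\<gamma> by (auto simp: \<theta>_def)
  have "\<theta> * (1 - \<beta>) = 1 - \<gamma>" using \<beta>\<gamma> by (simp add: \<theta>_def)
  then have \<gamma>: "\<theta> * \<beta> + (1 - \<theta>) * 1 = \<gamma>" by (simp add: algebra_simps)
  note conv = overlap_pow_log_convex[OF ne[unfolded pairs_def] \<theta>, of \<beta> 1, unfolded \<gamma>, folded Q_def pairs_def]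
  have ge: "\<theta> * ln (Q \<beta>) \<le> ln (Q \<gamma>)"
  proof -
    have "- (ln (Q \<gamma>) / (1 - \<gamma>)) \<le> - (ln (Q \<beta>) / (1 - \<beta>))"
      using le by (simp only: minus_divide_right minus_diff_eq)
    then show ?thesis using \<beta>\<gamma> by (simp add: \<theta>_def field_simps)
  qed
  have "ln (Q 1) \<le> 0" using Q_1_le Qp[of 1] by simp
  moreover have "0 \<le> (1 - \<theta>) * ln (Q 1)" using conv(1) ge by linarith
  ultimately have Q1: "ln (Q 1) = 0" using \<theta> by (simp add: zero_le_mult_iff)
  then have "Q 1 = 1" using Qp[of 1] by simp
  \<comment> \<open>Solves the equality case at \<open>\<beta>\<close> and \<open>1\<close>, which
    reads \<open>r i powr \<beta> * s j powr (1 - \<beta>) / Q \<beta> = r i\<close>, for the ratio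
    \<open>r i / s j\<close>.\<close>
  define c where "c = (1 / Q \<beta>) powr (1 / (1 - \<beta>))"
  have c: "0 < c" using Qp[of \<beta>] by (simp add: c_def)
  have s: "r i = c * s j" if ij: "(i,j) \<in> pairs" for i j
  proof -
    have pos: "0 < r i" "0 < s j" using ij by (auto simp: pairs_def overlap_support_def)
    have "r i powr \<beta> * s j powr (1 - \<beta>) / Q \<beta> = r i"
      using conv(2)[OF _ ij] conv(1) ge Q1 pos \<open>Q 1 = 1\<close> by simp
    then have "ln (r i powr \<beta> * s j powr (1 - \<beta>) / Q \<beta>) = ln (r i)" by simp
    then have "(1 - \<beta>) * ln (r i) = (1 - \<beta>) * ln (s j) - ln (Q \<beta>)"
      using pos Qp[of \<beta>] by (simp add: ln_mult ln_div ln_powr algebra_simps)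
    then have "ln (r i) = ln (s j) - ln (Q \<beta>) / (1 - \<beta>)"
      using \<beta>\<gamma> by (simp add: field_simps)
    also have "\<dots> = ln (c * s j)"
      using pos Qp[of \<beta>] by (simp add: c_def ln_mult ln_powr ln_div)
    finally show ?thesis using pos c by simp
  qed
  have Qt: "Q t = c powr t * Q 0" for t
    unfolding Q_def overlap_pow_eq_sum sum_distrib_left pairs_def[symmetric]
  proof (intro sum.cong refl, clarify)
    fix i j assume ij: "(i,j) \<in> pairs"
    have pos: "0 < s j" using ij by (auto simp: pairs_def overlap_support_def)
    have "(c * s j) powr t * s j powr (1 - t) = c powr t * s j"
      using pos c by (simp add: powr_mult powr_diff)
    then show "r i powr t * s j powr (1 - t) * (cmod (W $$ (i,j)))\<^sup>2
        = c powr t * (r i powr 0 * s j powr (1 - 0) * (cmod (W $$ (i,j)))\<^sup>2)"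
      using s[OF ij] pos c by simp
  qed
  have "c * Q 0 = 1" using Qt[of 1] \<open>Q 1 = 1\<close> c by simp
  then have "c = 1 / Q 0" using Qp[of 0] by (simp add: field_simps)
  then show ?thesis using Qt[of t] Qp[of 0] by (simp add: powr_divide powr_diff)
qed

lemma psd_tpows: "psd (tpow n \<rho>)" "psd (tpow n \<sigma>)"
  by (rule psd_tpow[OF \<rho>(2,1)], rule psd_tpow[OF \<sigma>(2,1)])

lemma tpow_carriers: "tpow n \<rho> \<in> carrier_mat (d^n) (d^n)" "tpow n \<sigma> \<in> carrier_mat (d^n) (d^n)"
  by (rule tpow_carrier[OF \<rho>(1)], rule tpow_carrier[OF \<sigma>(1)])

lemma trace_tpows: "mtrace (tpow n \<rho>) = 1" "mtrace (tpow n \<sigma>) = 1"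
  using \<rho> \<sigma> by (simp_all add: mtrace_tpow trace_\<rho> trace_\<sigma>)

text \<open>The support projection of \<open>tpow n \<rho>\<close> has outcome probabilities 1 and 0
  under that state, and is passed by \<open>tpow n \<sigma>\<close> with probability
  \<open>Q 0 ^ n\<close>. Only the power \<open>1 - \<alpha>\<close> of the latter survives, for all
  \<open>\<alpha>\<close> with the same test.\<close>

lemma support_test:
  assumes Qt: "\<And>t. Q t = Q 0 powr (1 - t)"
  shows "\<exists>T. T \<in> carrier_mat (d^n) (d^n) \<and> is_test T \<and>
    (\<forall>\<alpha>\<in>{0<..<1}. Renyi_sum \<alpha> (meas T (tpow n \<rho>)) (meas T (tpow n \<sigma>)) = Q \<alpha> ^ n)"
proof (intro exI conjI ballI)
  define T where "T = mpow (tpow n \<rho>) 0"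
  show T: "T \<in> carrier_mat (d^n) (d^n)" "is_test T"
    unfolding T_def using mpow_carrier[OF psd_tpows(1) tpow_carriers(1)] is_test_mpow_0[OF psd_tpows(1) tpow_carriers(1)] by auto
  fix \<alpha> :: real assume \<alpha>: "\<alpha> \<in> {0<..<1}"
  have "tpow n \<rho> * T = tpow n \<rho>"
    using mpow_mult[OF psd_tpows(1) tpow_carriers(1), of n 1 0] mpow_1[OF psd_tpows(1) tpow_carriers(1)] by (simp add: T_def)
  then have "fst (meas T (tpow n \<rho>)) = 1" by (simp add: meas_def trace_tpows)
  moreover have "snd (meas T (tpow n \<rho>)) = 0"
    using meas_probability(3)[OF psd_tpows(1) tpow_carriers(1) trace_tpows(1) T] calculation by simp
  moreover have "fst (meas T (tpow n \<sigma>)) = Q 0 ^ n"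
  proof -
    have "mtrace (tpow n \<sigma> * T) = mtrace (tpow n (\<sigma> * mpow \<rho> 0))"
      using \<rho> \<sigma> by (simp add: T_def mpow_tpow[OF \<rho>(2,1)] tpow_mult)
    also have "\<dots> = mtrace (\<sigma> * mpow \<rho> 0) ^ n"
      using \<rho> \<sigma> by (intro mtrace_tpow) auto
    also have "mtrace (\<sigma> * mpow \<rho> 0) = mtrace (mpow \<rho> 0 * mpow \<sigma> (1 - 0))"
      using \<rho> \<sigma> mpow_1[OF \<sigma>(2,1)] by (simp add: mtrace_mult_comm[of \<sigma>])
    also have "\<dots> = complex_of_real (Q 0)" by (rule trace_mpow)
    finally show ?thesis by (simp add: meas_def flip: of_real_power)
  qed
  ultimately show "Renyi_sum \<alpha> (meas T (tpow n \<rho>)) (meas T (tpow n \<sigma>)) = Q \<alpha> ^ n"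
    using \<alpha> Q_nonneg[of 0] Q_nonneg[of \<alpha>]
    by (cases "Q 0 = 0"; cases "n = 0") (auto simp: Renyi_sum_def Qt[of \<alpha>] powr_powr powr_realpow[symmetric] mult.commute zero_power)
qed

text \<open>Its contrapositive leads from strictness at a single \<open>n\<close> to strict
  monotonicity of both divergences. The second disjunct is the first one for exchanged states, read
  at \<open>1 - \<alpha>\<close>.\<close>

lemma Dpetz_le_Dtest:
  assumes deg: "\<not> strict_mono_on {0<..<1} (\<lambda>\<beta>. Dpetz \<beta> \<rho> \<sigma>) \<or> \<not> strict_mono_on {0<..<1} (\<lambda>\<beta>. Dpetz \<beta> \<sigma> \<rho>)"
    and \<alpha>: "\<alpha> \<in> {0<..<1}" and n: "1 \<le> n"
  shows "Dpetz \<alpha> \<rho> \<sigma> \<le> ereal (1 / real n) * Dtest \<alpha> (tpow n \<rho>) (tpow n \<sigma>)"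
proof -
  interpret sw: state_pair d \<sigma> \<rho> V U s r by (rule swap)
  have "\<exists>T. T \<in> carrier_mat (d^n) (d^n) \<and> is_test T \<and>
    Renyi_sum \<alpha> (meas T (tpow n \<rho>)) (meas T (tpow n \<sigma>)) = Q \<alpha> ^ n"
    using deg
  proof
    assume "\<not> strict_mono_on {0<..<1} (\<lambda>\<beta>. Dpetz \<beta> \<rho> \<sigma>)"
    from support_test[OF Dpetz_not_strict_mono[OF this]] show ?thesis using \<alpha> by blast
  next
    assume "\<not> strict_mono_on {0<..<1} (\<lambda>\<beta>. Dpetz \<beta> \<sigma> \<rho>)"
    from sw.support_test[OF sw.Dpetz_not_strict_mono[OF this], of n]
    obtain T where T: "T \<in> carrier_mat (d^n) (d^n)" "is_test T"
      "\<And>\<alpha>. \<alpha> \<in> {0<..<1} \<Longrightarrow> Renyi_sum \<alpha> (meas T (tpow n \<sigma>)) (meas T (tpow n \<rho>)) = sw.Q \<alpha> ^ n" by blast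
    have "Renyi_sum \<alpha> (meas T (tpow n \<rho>)) (meas T (tpow n \<sigma>)) = Q \<alpha> ^ n"
      using T(3)[of "1 - \<alpha>"] \<alpha> by (simp add: Renyi_sum_flip Q_swap)
    with T show ?thesis by blast
  qed
  then obtain T where T: "T \<in> carrier_mat (d^n) (d^n)" "is_test T"
    "Renyi_sum \<alpha> (meas T (tpow n \<rho>)) (meas T (tpow n \<sigma>)) = Q \<alpha> ^ n" by blast
  have le: "Dcl \<alpha> (meas T (tpow n \<rho>)) (meas T (tpow n \<sigma>)) \<le> Dtest \<alpha> (tpow n \<rho>) (tpow n \<sigma>)"
    unfolding Dtest_def using T \<rho> by (intro SUP_upper) auto
  have "Dpetz \<alpha> \<rho> \<sigma> = ereal (1 / real n) * Dcl \<alpha> (meas T (tpow n \<rho>)) (meas T (tpow n \<sigma>))"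
    using n Q_nonneg[of \<alpha>] by (simp add: Dpetz_eq Dcl_eq T(3) ln_realpow)
  also have "\<dots> \<le> ereal (1 / real n) * Dtest \<alpha> (tpow n \<rho>) (tpow n \<sigma>)"
    by (intro ereal_mult_left_mono le) simp
  finally show ?thesis .
qed

section \<open>The upper bound\<close>

text \<open>The weight of the second error, one factor \<open>exp c\<close> per copy, is absorbed
  into the eigenvalues of \<open>\<sigma>\<close>, so the bound is again a plain minimum over a
  product and Cramer's estimate applies to it.\<close>

lemma error_ge:
  assumes T: "T \<in> carrier_mat (d^n) (d^n)" "is_test T"
  shows "overlap_sum d W r (\<lambda>j. exp c * s j) n min / 2
    \<le> snd (meas T (tpow n \<rho>)) + exp c ^ n * fst (meas T (tpow n \<sigma>))"
proof -
  have W: "adj (tpow n U) * tpow n V = tpow n W"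
    using U V by (simp add: W_def adj_tpow tpow_mult)
  have A: "tpow n \<rho> = tpow n U * diagm (d^n) (\<lambda>i. complex_of_real (tev d r n i)) * adj (tpow n U)"
    unfolding U(3) by (rule tpow_diag_conj[OF U(1)])
  have B: "complex_of_real (exp c ^ n) \<cdot>\<^sub>m tpow n \<sigma>
      = tpow n V * diagm (d^n) (\<lambda>i. complex_of_real (tev d (\<lambda>j. exp c * s j) n i)) * adj (tpow n V)"
    unfolding V(3) tpow_diag_conj[OF V(1)] tev_scale by (rule smult_diag_conj[OF tpow_carrier[OF V(1)]])
  have "overlap_sum d W r (\<lambda>j. exp c * s j) n min / 2
      \<le> Re (mtrace (tpow n \<rho> * (1\<^sub>m (d^n) - T))) + Re (mtrace ((complex_of_real (exp c ^ n) \<cdot>\<^sub>m tpow n \<sigma>) * T))"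
    unfolding overlap_sum_def W[symmetric]
    by (rule test_error_ge[OF tpow_carrier[OF U(1)] unitary_tpow[OF U(2,1)] A
        tpow_carrier[OF V(1)] unitary_tpow[OF V(2,1)] B tev_nonneg[OF r_nonneg] tev_nonneg T])
      (simp add: s_nonneg)
  also have "mtrace ((complex_of_real (exp c ^ n) \<cdot>\<^sub>m tpow n \<sigma>) * T) = complex_of_real (exp c ^ n) * mtrace (tpow n \<sigma> * T)"
    using T \<sigma> by (subst smult_mult_mat_distrib) (simp_all add: mtrace_smult)
  finally show ?thesis using T by (simp add: meas_def del: of_real_power)
qed

text \<open>The left-hand side of \<open>gap\<close> is linear in \<open>t\<close> and joins the two
  error exponents that a Renyi sum \<open>exp (n * K)\<close> would force. Lying strictly below
  \<open>ln Q\<close>, it leaves room even for a slightly larger \<open>K'\<close>, which gives the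
  strict conclusion after the limit superior.\<close>

lemma Dtest_bar_less:
  assumes ne: "pairs \<noteq> {}" and \<alpha>: "0 < \<alpha>" "\<alpha> < 1" and K: "K < 0"
    and gap: "\<And>t. 0 \<le> t \<Longrightarrow> t \<le> 1 \<Longrightarrow> t * K / \<alpha> + (1 - t) * K / (1 - \<alpha>) < ln (Q t)"
  shows "Dtest_bar \<alpha> \<rho> \<sigma> < ereal (K / (\<alpha> - 1))"
proof -
  \<comment> \<open>Brings the error exponents \<open>K / \<alpha>\<close> and
    \<open>K / (1 - \<alpha>)\<close> to the common value \<open>K / \<alpha>\<close>.\<close>
  define c where "c = K / \<alpha> - K / (1 - \<alpha>)"
  define s' where "s' j = exp c * s j" for j
  have s': "0 \<le> s' j" for j using s_nonneg by (simp add: s'_def)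
  have "overlap_support d W r s' = pairs"
    by (auto simp: pairs_def overlap_support_def s'_def zero_less_mult_iff)
  with ne have ne': "overlap_support d W r s' \<noteq> {}" by simp
  obtain t where t: "0 \<le> t" "t \<le> 1"
    "\<And>\<eta>. 0 < \<eta> \<Longrightarrow> \<forall>\<^sub>F n in sequentially. (overlap_pow d W r s' t * exp (-\<eta>)) ^ n \<le> overlap_sum d W r s' n min"
    by (rule overlap_sum_min_ge[OF W_carrier r_nonneg s' ne']) (rule that)
  \<comment> \<open>The margin that \<open>gap\<close> leaves at Cramer's parameter
    \<open>t\<close>. Half of it pays for the loss in Cramer's bound, a quarter for passing from
    \<open>K\<close> to \<open>K'\<close>, and the last quarter for the constant
    \<open>2 * C\<close>.\<close>
  define g where "g = ln (Q t) + (1 - t) * c - K / \<alpha>"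
  have g: "0 < g"
  proof -
    define a b where "a = K / \<alpha>" and "b = K / (1 - \<alpha>)"
    have "t * a + (1 - t) * b < ln (Q t)" using gap[OF t(1,2)] by (simp add: a_def b_def)
    then have "0 < ln (Q t) + (1 - t) * (a - b) - a" by (simp add: algebra_simps)
    then show ?thesis by (simp add: g_def c_def a_def b_def)
  qed
  have Qs': "overlap_pow d W r s' t = exp (K / \<alpha> + g)"
  proof -
    have "pospow (s' j) (1 - t) = exp ((1 - t) * c) * pospow (s j) (1 - t)" for j
      unfolding s'_def using s_nonneg[of j] by (simp add: pospow_mult) (simp add: pospow_def powr_def)
    then have "overlap_pow d W r s' t = exp ((1 - t) * c) * Q t"
      by (simp add: overlap_pow_def Q_def sum_distrib_left mult_ac)
    also have "\<dots> = exp ((1 - t) * c + ln (Q t))" using Q_pos[OF ne] by (simp add: exp_add)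
    finally show ?thesis by (simp add: g_def algebra_simps)
  qed
  have ev1: "\<forall>\<^sub>F n in sequentially. exp (n * (K / \<alpha> + g / 2)) \<le> overlap_sum d W r s' n min"
  proof -
    have "(overlap_pow d W r s' t * exp (-(g / 2))) ^ n = exp (n * (K / \<alpha> + g / 2))" for n
    proof -
      have "overlap_pow d W r s' t * exp (-(g / 2)) = exp (K / \<alpha> + g / 2)"
        unfolding Qs' exp_add[symmetric] by simp
      then show ?thesis by (simp only: exp_of_nat_mult)
    qed
    then show ?thesis using t(3)[of "g / 2"] g by simp
  qed
  \<comment> \<open>The first entry keeps \<open>K + \<delta>\<close> negative, so that the Renyi
    sum falls below 1/8; the others keep both error exponents within \<open>g / 4\<close>.\<close>
  define \<delta> where "\<delta> = min (- K / 2) (min (\<alpha> * g / 4) ((1 - \<alpha>) * g / 4))"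
  have \<delta>: "0 < \<delta>" "\<delta> \<le> - K / 2" "\<delta> \<le> \<alpha> * g / 4" "\<delta> \<le> (1 - \<alpha>) * g / 4"
    using K \<alpha> g by (auto simp: \<delta>_def)
  define K' where "K' = K + \<delta>"
  have K': "K' < 0" using \<delta> K by (simp add: K'_def)
  have K'1: "K' / \<alpha> \<le> K / \<alpha> + g / 4" and K'2: "c + K' / (1 - \<alpha>) \<le> K / \<alpha> + g / 4"
  proof -
    have "\<delta> / \<alpha> \<le> g / 4" "\<delta> / (1 - \<alpha>) \<le> g / 4"
      using \<delta>(3,4) \<alpha> by (simp_all add: pos_divide_le_eq mult.commute)
    then show "K' / \<alpha> \<le> K / \<alpha> + g / 4" "c + K' / (1 - \<alpha>) \<le> K / \<alpha> + g / 4"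
      by (simp_all add: K'_def c_def add_divide_distrib)
  qed
  define C :: real where "C = 2 powr (1 / \<alpha>) + 2 powr (1 / (1 - \<alpha>))"
  have ev2: "\<forall>\<^sub>F n in sequentially. exp (n * K') < 1 / 8"
  proof -
    have "filterlim (\<lambda>n. real n * K') at_bot sequentially"
      using K' filterlim_real_sequentially by (simp add: filterlim_tendsto_neg_mult_at_bot[OF tendsto_const] mult.commute)
    then have "((\<lambda>n. exp (real n * K')) \<longlongrightarrow> 0) sequentially"
      by (rule filterlim_compose[OF exp_at_bot])
    then show ?thesis by (rule order_tendstoD(2)) simp
  qed
  have ev3: "\<forall>\<^sub>F n in sequentially. 2 * C < exp (n * (g / 4))"
  proof -
    have "filterlim (\<lambda>n. real n * (g / 4)) at_top sequentially"
      using g filterlim_real_sequentially by (intro filterlim_at_top_mult_tendsto_pos[OF tendsto_const]) auto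
    then have "filterlim (\<lambda>n. exp (real n * (g / 4))) at_top sequentially"
      by (rule filterlim_compose[OF exp_at_top])
    then show ?thesis by (simp add: filterlim_at_top_dense)
  qed
  have "\<forall>\<^sub>F n in sequentially. 1 \<le> n \<longrightarrow> ereal (1 / real n) * Dtest \<alpha> (tpow n \<rho>) (tpow n \<sigma>) \<le> ereal (K' / (\<alpha> - 1))"
    using ev1 ev2 ev3
  proof eventually_elim
    case (elim n)
    let ?E = "exp (n * K')"
    have half: "?E \<le> Renyi_sum \<alpha> (meas T (tpow n \<rho>)) (meas T (tpow n \<sigma>))"
      if T: "T \<in> carrier_mat (d^n) (d^n)" "is_test T" and h: "1/2 \<le> fst (meas T (tpow n \<rho>))" for T
    proof (rule ccontr)
      assume "\<not> ?thesis"
      then have small: "Renyi_sum \<alpha> (meas T (tpow n \<rho>)) (meas T (tpow n \<sigma>)) \<le> ?E" by simp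
      note S = Renyi_sum_small[OF \<alpha> meas_probability[OF psd_tpows(1) tpow_carriers(1) trace_tpows(1) T]
        meas_probability[OF psd_tpows(2) tpow_carriers(2) trace_tpows(2) T] h less_imp_le[OF elim(2)] small]
      have E: "(2 * ?E) powr y = 2 powr y * exp (n * (K' * y))" for y
        by (simp add: powr_mult exp_powr_real mult.assoc)
      let ?X = "exp (n * (K / \<alpha> + g / 4))"
      have "exp (n * (K / \<alpha> + g / 2)) / 2 \<le> snd (meas T (tpow n \<rho>)) + exp c ^ n * fst (meas T (tpow n \<sigma>))"
        using error_ge[OF T, of c] elim(1) by (simp add: s'_def[abs_def])
      also have "\<dots> \<le> (2 * ?E) powr (1 / \<alpha>) + exp c ^ n * (2 * ?E) powr (1 / (1 - \<alpha>))"
        using S by (intro add_mono mult_left_mono) auto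
      also have "exp c ^ n * (2 * ?E) powr (1 / (1 - \<alpha>)) = 2 powr (1 / (1 - \<alpha>)) * exp (n * (c + K' / (1 - \<alpha>)))"
        unfolding E by (simp add: ring_distribs exp_add flip: exp_of_nat_mult)
      also have "(2 * ?E) powr (1 / \<alpha>) = 2 powr (1 / \<alpha>) * exp (n * (K' / \<alpha>))"
        unfolding E by simp
      also have "2 powr (1 / \<alpha>) * exp (n * (K' / \<alpha>)) + 2 powr (1 / (1 - \<alpha>)) * exp (n * (c + K' / (1 - \<alpha>)))
          \<le> 2 powr (1 / \<alpha>) * ?X + 2 powr (1 / (1 - \<alpha>)) * ?X"
        by (intro add_mono mult_left_mono iffD2[OF exp_le_cancel_iff] K'1 K'2) simp_all
      also have "\<dots> = C * ?X" by (simp add: C_def algebra_simps)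
      finally have "exp (n * (K / \<alpha> + g / 2)) \<le> 2 * C * ?X" by simp
      moreover have "exp (n * (K / \<alpha> + g / 2)) = exp (n * (g / 4)) * ?X"
        by (simp add: algebra_simps flip: exp_add)
      ultimately have "exp (n * (g / 4)) \<le> 2 * C" by simp
      with elim(3) show False by simp
    qed
    \<comment> \<open>Exchanging the outcomes preserves the Renyi sum, and one of \<open>T\<close>
      and its complement has first probability at least 1/2.\<close>
    have all: "?E \<le> Renyi_sum \<alpha> (meas T (tpow n \<rho>)) (meas T (tpow n \<sigma>))"
      if T: "T \<in> carrier_mat (d^n) (d^n)" "is_test T" for T
    proof (cases "1/2 \<le> fst (meas T (tpow n \<rho>))")
      case False
      let ?T = "1\<^sub>m (d^n) - T"
      have "1/2 \<le> fst (meas ?T (tpow n \<rho>))"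
        using False meas_probability(3)[OF psd_tpows(1) tpow_carriers(1) trace_tpows(1) T] by (simp add: meas_compl[OF T(1)])
      from half[OF minus_carrier_mat[OF T(1)] is_test_compl[OF T(2,1)] this] show ?thesis
        by (simp add: meas_compl[OF T(1)] Renyi_sum_swap)
    qed (rule half[OF T])
    have "Dtest \<alpha> (tpow n \<rho>) (tpow n \<sigma>) \<le> ereal (ln ?E / (\<alpha> - 1))"
      unfolding Dtest_def using all \<rho> \<alpha> by (intro SUP_least Dcl_le) auto
    then have "ereal (1 / real n) * Dtest \<alpha> (tpow n \<rho>) (tpow n \<sigma>) \<le> ereal (1 / real n) * ereal (ln ?E / (\<alpha> - 1))"
      by (rule ereal_mult_left_mono) simp
    then show ?case by auto
  qed
  then have "\<forall>\<^sub>F n in sequentially. ereal (1 / real (Suc n)) * Dtest \<alpha> (tpow (Suc n) \<rho>) (tpow (Suc n) \<sigma>) \<le> ereal (K' / (\<alpha> - 1))"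
    unfolding eventually_sequentially by (metis One_nat_def Suc_le_mono le_Suc_eq le0)
  then have "Dtest_bar \<alpha> \<rho> \<sigma> \<le> ereal (K' / (\<alpha> - 1))"
    unfolding Dtest_bar_def by (rule Limsup_bounded)
  also have "\<dots> < ereal (K / (\<alpha> - 1))"
    using \<delta> \<alpha> by (simp add: K'_def divide_strict_right_mono_neg)
  finally show ?thesis .
qed

lemma Dtest_bar_le_Dpetz:
  assumes \<alpha>: "0 < \<alpha>" "\<alpha> < 1"
  shows "Dtest_bar \<alpha> \<rho> \<sigma> \<le> Dpetz \<alpha> \<rho> \<sigma>"
proof (cases "pairs = {}")
  case True
  then show ?thesis by (simp add: Dpetz_eq Q_empty)
next
  case ne: False
  let ?p = "ln (Q \<alpha>)"
  have p0: "?p \<le> 0" by (rule ln_Q_le_0[OF ne \<alpha>])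
  have less: "Dtest_bar \<alpha> \<rho> \<sigma> < ereal (K / (\<alpha> - 1))" if K: "K < ?p" for K
  proof (rule Dtest_bar_less[OF ne \<alpha>])
    show "K < 0" using K p0 by simp
    fix t :: real assume t: "0 \<le> t" "t \<le> 1"
    have *: "t * K / \<alpha> + (1 - t) * K / (1 - \<alpha>) = t / \<alpha> * K + (1 - t) / (1 - \<alpha>) * K" by simp
    show "t * K / \<alpha> + (1 - t) * K / (1 - \<alpha>) < ln (Q t)"
    proof (cases "\<alpha> \<le> t")
      case True
      have "t / \<alpha> * K < t / \<alpha> * ?p" using True \<alpha> K by (intro mult_strict_left_mono) auto
      moreover have "(1 - t) / (1 - \<alpha>) * K \<le> 0" using t \<alpha> \<open>K < 0\<close> by (intro mult_nonneg_nonpos) auto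
      moreover have "t / \<alpha> * ?p \<le> ln (Q t)" using ln_Q_ge[OF ne \<alpha>(1) True t(2)] by simp
      ultimately show ?thesis unfolding * by linarith
    next
      case False
      have "(1 - t) / (1 - \<alpha>) * K < (1 - t) / (1 - \<alpha>) * ?p" using False \<alpha> K by (intro mult_strict_left_mono) auto
      moreover have "t / \<alpha> * K \<le> 0" using t \<alpha> \<open>K < 0\<close> by (intro mult_nonneg_nonpos) auto
      moreover have "(1 - t) / (1 - \<alpha>) * ?p \<le> ln (Q t)" using ln_Q_ge'[OF ne \<alpha>(2) _ t(1)] False by simp
      ultimately show ?thesis unfolding * by linarith
    qed
  qed
  have "Dtest_bar \<alpha> \<rho> \<sigma> \<le> ereal (?p / (\<alpha> - 1))"
  proof (rule ereal_le_epsilon2)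
    fix e :: real assume e: "0 < e"
    have "Dtest_bar \<alpha> \<rho> \<sigma> < ereal ((?p + e * (\<alpha> - 1)) / (\<alpha> - 1))"
      using e \<alpha> by (intro less) (simp add: mult_pos_neg)
    also have "(?p + e * (\<alpha> - 1)) / (\<alpha> - 1) = ?p / (\<alpha> - 1) + e" using \<alpha> by (simp add: field_simps)
    finally show "Dtest_bar \<alpha> \<rho> \<sigma> \<le> ereal (?p / (\<alpha> - 1)) + ereal e" by simp
  qed
  then show ?thesis using Q_pos[OF ne, of \<alpha>] by (simp add: Dpetz_eq)
qed

lemma strict_mono_imp_ln_Q_gt:
  assumes ne: "pairs \<noteq> {}" and mono: "strict_mono_on {0<..<1} (\<lambda>\<beta>. Dpetz \<beta> \<rho> \<sigma>)"
    and \<alpha>: "0 < \<alpha>" "\<alpha> < 1" and t: "0 \<le> t" "t < \<alpha>"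
  shows "(1 - t) * ln (Q \<alpha>) / (1 - \<alpha>) < ln (Q t)"
proof -
  have pos: "(1 - t) * ln (Q \<alpha>) / (1 - \<alpha>) < ln (Q t)" if t: "0 < t" "t < \<alpha>" for t
  proof -
    have "Dpetz t \<rho> \<sigma> < Dpetz \<alpha> \<rho> \<sigma>" using mono t \<alpha> by (auto simp: strict_mono_on_def)
    then have "ln (Q t) / (t - 1) < ln (Q \<alpha>) / (\<alpha> - 1)"
      using Q_pos[OF ne, of \<alpha>] Q_pos[OF ne, of t] by (simp add: Dpetz_eq)
    then have "- (ln (Q t) / (1 - t)) < - (ln (Q \<alpha>) / (1 - \<alpha>))"
      by (simp only: minus_divide_right minus_diff_eq)
    then show ?thesis using t \<alpha> by (simp add: field_simps)
  qed
  show ?thesis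
  proof (cases "t = 0")
    case True
    \<comment> \<open>Monotonicity is assumed on the open interval only. The strict step is taken at
      \<open>\<alpha> / 2\<close> and carried on to 0 by convexity.\<close>
    have "ln (Q \<alpha>) / (1 - \<alpha>) < ln (Q (\<alpha> / 2)) / (1 - \<alpha> / 2)"
      using pos[of "\<alpha> / 2"] \<alpha> by (simp add: field_simps)
    also have "\<dots> \<le> ln (Q 0)" using ln_Q_ge'[OF ne, of "\<alpha> / 2" 0] \<alpha> by simp
    finally show ?thesis by (simp add: True)
  qed (use pos t in simp)
qed

text \<open>The gap condition now holds for \<open>K = ln (Q \<alpha>)\<close> itself, since the
  summand that is kept lies strictly below \<open>ln Q\<close> away from
  \<open>\<alpha>\<close>.\<close>

lemma Dtest_bar_less_Dpetz:
  assumes mono: "strict_mono_on {0<..<1} (\<lambda>\<beta>. Dpetz \<beta> \<rho> \<sigma>)" "strict_mono_on {0<..<1} (\<lambda>\<beta>. Dpetz \<beta> \<sigma> \<rho>)"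
    and \<alpha>: "0 < \<alpha>" "\<alpha> < 1"
  shows "Dtest_bar \<alpha> \<rho> \<sigma> < Dpetz \<alpha> \<rho> \<sigma>"
proof -
  interpret sw: state_pair d \<sigma> \<rho> V U s r by (rule swap)
  have ne: "pairs \<noteq> {}"
  proof
    assume "pairs = {}"
    then have "Dpetz \<beta> \<rho> \<sigma> = \<infinity>" for \<beta> by (simp add: Dpetz_eq Q_empty)
    moreover have "Dpetz (1/3) \<rho> \<sigma> < Dpetz (1/2) \<rho> \<sigma>" using mono(1) by (auto simp: strict_mono_on_def)
    ultimately show False by simp
  qed
  let ?p = "ln (Q \<alpha>)"
  have left: "(1 - t) * ?p / (1 - \<alpha>) < ln (Q t)" if "0 \<le> t" "t < \<alpha>" for t
    by (rule strict_mono_imp_ln_Q_gt[OF ne mono(1) \<alpha> that])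
  have right: "t * ?p / \<alpha> < ln (Q t)" if "\<alpha> < t" "t \<le> 1" for t
    using sw.strict_mono_imp_ln_Q_gt[OF _ mono(2), of "1 - \<alpha>" "1 - t"] ne that \<alpha> by (simp add: pairs_swap Q_swap)
  have p: "?p < 0"
  proof -
    have "(1 - \<alpha> / 2) * ?p / (1 - \<alpha>) < ln (Q (\<alpha> / 2))" using left[of "\<alpha> / 2"] \<alpha> by simp
    also have "\<dots> \<le> 0" using ln_Q_le_0[OF ne, of "\<alpha> / 2"] \<alpha> by simp
    finally show ?thesis using \<alpha> by (simp add: divide_less_0_iff mult_less_0_iff)
  qed
  have "Dtest_bar \<alpha> \<rho> \<sigma> < ereal (?p / (\<alpha> - 1))"
  proof (rule Dtest_bar_less[OF ne \<alpha> p])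
    fix t :: real assume t: "0 \<le> t" "t \<le> 1"
    have 1: "t * ?p / \<alpha> \<le> 0" "(1 - t) * ?p / (1 - \<alpha>) \<le> 0"
      using t \<alpha> p by (auto intro!: divide_nonpos_pos mult_nonneg_nonpos)
    consider "t < \<alpha>" | "t = \<alpha>" | "\<alpha> < t" by linarith
    then show "t * ?p / \<alpha> + (1 - t) * ?p / (1 - \<alpha>) < ln (Q t)"
    proof cases
      case 2
      \<comment> \<open>At \<open>\<alpha>\<close> both summands equal \<open>?p\<close>, and twice
        a negative number is smaller than the number.\<close>
      then show ?thesis using \<alpha> p by simp
    qed (use left[of t] right[of t] t 1 in linarith)+
  qed
  then show ?thesis using Q_pos[OF ne, of \<alpha>] by (simp add: Dpetz_eq)
qed

section \<open>The lower bound\<close>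

text \<open>With weight \<open>q powr (x * n)\<close>, Audenaert's inequality bounds the two terms
  of the Renyi sum by powers of \<open>q ^ n\<close> with exponents
  \<open>\<alpha> * (x * (1 - \<alpha>) + 1)\<close> and
  \<open>(1 - \<alpha>) * (1 - x * \<alpha>)\<close>. These add up to 1 for every \<open>x\<close>,
  so the best common exponent is 1/2; this is where the factor comes from.\<close>

lemma half_Dpetz_le_Dtest_bar:
  assumes \<alpha>: "0 < \<alpha>" "\<alpha> < 1"
  shows "ereal (1/2) * Dpetz \<alpha> \<rho> \<sigma> \<le> Dtest_bar \<alpha> \<rho> \<sigma>"
proof (cases "pairs = {}")
  case True
  \<comment> \<open>Orthogonal supports fall under the degenerate case: a divergence that is
    constantly infinite is not strictly increasing.\<close>
  then have D: "Dpetz \<beta> \<rho> \<sigma> = \<infinity>" for \<beta> by (simp add: Dpetz_eq Q_empty)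
  then have "\<not> strict_mono_on {0<..<1} (\<lambda>\<beta>. Dpetz \<beta> \<rho> \<sigma>)"
    using strict_mono_onD[of "{0<..<1}" "\<lambda>\<beta>. Dpetz \<beta> \<rho> \<sigma>" "1/3" "1/2"] by (auto simp: D)
  then have "\<infinity> \<le> ereal (1 / real (Suc n)) * Dtest \<alpha> (tpow (Suc n) \<rho>) (tpow (Suc n) \<sigma>)" for n
    using Dpetz_le_Dtest[of \<alpha> "Suc n"] \<alpha> unfolding D by simp
  then have "Dtest_bar \<alpha> \<rho> \<sigma> = \<infinity>"
    unfolding Dtest_bar_def by (simp add: Limsup_const)
  then show ?thesis by simp
next
  case ne: False
  define q where "q = Q \<alpha>"
  have q: "0 < q" unfolding q_def by (rule Q_pos[OF ne])
  \<comment> \<open>The weight of the second error that makes both terms of the test's Renyi sum of order \<open>q\<^sup>n\<^sup>/\<^sup>2\<close>.\<close>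
  define x where "x = (1 / (2 * \<alpha>) - 1) / (1 - \<alpha>)"
  have x1: "\<alpha> * (x * (1 - \<alpha>) + 1) = 1 / 2" using \<alpha> by (simp add: x_def field_simps)
  have x2: "(1 - \<alpha>) * (1 - x * \<alpha>) = 1 / 2"
    using \<alpha> x1 by (simp add: algebra_simps)
  have bound: "ereal ((ln 2 / real n + ln q / 2) / (\<alpha> - 1)) \<le> ereal (1 / real n) * Dtest \<alpha> (tpow n \<rho>) (tpow n \<sigma>)" if n: "1 \<le> n" for n
  proof -
    define l where "l = q powr (x * n)"
    have l: "0 < l" using q by (simp add: l_def)
    let ?B = "complex_of_real l \<cdot>\<^sub>m tpow n \<sigma>"
    have B: "psd ?B" "?B \<in> carrier_mat (d^n) (d^n)"
      using psd_smult[OF psd_tpows(2) tpow_carriers(2)] tpow_carriers(2) l by auto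
    obtain T where T: "T \<in> carrier_mat (d^n) (d^n)" "is_test T"
      "Re (mtrace (tpow n \<rho> * (1\<^sub>m (d^n) - T))) + Re (mtrace (?B * T)) \<le> Re (mtrace (mpow (tpow n \<rho>) \<alpha> * mpow ?B (1 - \<alpha>)))"
      using Audenaert_inequality[OF psd_tpows(1) tpow_carriers(1) B \<alpha>] by blast
    let ?p = "meas T (tpow n \<rho>)" and ?q = "meas T (tpow n \<sigma>)"
    have "mtrace (?B * T) = complex_of_real l * mtrace (tpow n \<sigma> * T)"
      using T \<sigma> by (subst smult_mult_mat_distrib) (simp_all add: mtrace_smult)
    then have lhs: "snd ?p + l * fst ?q \<le> Re (mtrace (mpow (tpow n \<rho>) \<alpha> * mpow ?B (1 - \<alpha>)))"
      using T by (simp add: meas_def)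
    have "mtrace (mpow (tpow n \<rho>) \<alpha> * mpow ?B (1 - \<alpha>))
        = complex_of_real (l powr (1 - \<alpha>)) * mtrace (tpow n (mpow \<rho> \<alpha> * mpow \<sigma> (1 - \<alpha>)))"
      unfolding mpow_smult[OF psd_tpows(2) tpow_carriers(2) l] mpow_tpow[OF \<rho>(2,1)] mpow_tpow[OF \<sigma>(2,1)]
      using \<rho> \<sigma> by (simp add: mult_smult_mat_distrib mtrace_smult tpow_mult)
    also have "mtrace (tpow n (mpow \<rho> \<alpha> * mpow \<sigma> (1 - \<alpha>))) = complex_of_real (q ^ n)"
      using \<rho> \<sigma> by (simp add: mtrace_tpow trace_mpow q_def)
    finally have err: "snd ?p + l * fst ?q \<le> l powr (1 - \<alpha>) * q ^ n" using lhs by (simp del: of_real_power)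
    note mp = meas_probability[OF psd_tpows(1) tpow_carriers(1) trace_tpows(1) T(1,2)]
    note mq = meas_probability[OF psd_tpows(2) tpow_carriers(2) trace_tpows(2) T(1,2)]
    have rhs: "l powr (1 - \<alpha>) * q ^ n = q powr (n * (x * (1 - \<alpha>) + 1))"
    proof -
      have "l powr (1 - \<alpha>) * q ^ n = q powr (x * n * (1 - \<alpha>)) * q powr n"
        using q by (simp add: l_def powr_powr powr_realpow)
      also have "\<dots> = q powr (x * n * (1 - \<alpha>) + n)" by (rule powr_add[symmetric])
      also have "x * n * (1 - \<alpha>) + n = n * (x * (1 - \<alpha>) + 1)" by (simp add: algebra_simps)
      finally show ?thesis .
    qed
    have "snd ?p \<le> q powr (n * (x * (1 - \<alpha>) + 1))"
      using err mq(1) l unfolding rhs by (smt (verit) mult_nonneg_nonneg)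
    then have "snd ?p powr \<alpha> \<le> (q powr (n * (x * (1 - \<alpha>) + 1))) powr \<alpha>"
      using mp \<alpha> by (intro powr_mono2) auto
    also have "\<dots> = q powr (n * (\<alpha> * (x * (1 - \<alpha>) + 1)))" by (simp add: powr_powr mult_ac)
    finally have P: "snd ?p powr \<alpha> \<le> q powr (n / 2)" unfolding x1 by simp
    have "l * fst ?q \<le> q powr (n * (x * (1 - \<alpha>) + 1))" using err mp(2) unfolding rhs by linarith
    also have "\<dots> = l * q powr (n * (1 - x * \<alpha>))"
      by (simp add: l_def algebra_simps flip: powr_add)
    finally have "fst ?q \<le> q powr (n * (1 - x * \<alpha>))" using l by simp
    then have "fst ?q powr (1 - \<alpha>) \<le> (q powr (n * (1 - x * \<alpha>))) powr (1 - \<alpha>)"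
      using mq \<alpha> by (intro powr_mono2) auto
    also have "\<dots> = q powr (n * ((1 - \<alpha>) * (1 - x * \<alpha>)))" by (simp add: powr_powr mult_ac)
    finally have R: "fst ?q powr (1 - \<alpha>) \<le> q powr (n / 2)" unfolding x2 by simp
    have "fst ?p powr \<alpha> \<le> 1" "snd ?q powr (1 - \<alpha>) \<le> 1"
      using mp mq \<alpha> by (auto intro!: powr_le1)
    then have "Renyi_sum \<alpha> ?p ?q \<le> 1 * q powr (n / 2) + q powr (n / 2) * 1"
      unfolding Renyi_sum_def using P R by (intro add_mono mult_mono) auto
    then have "ereal (ln (2 * q powr (n / 2)) / (\<alpha> - 1)) \<le> Dcl \<alpha> ?p ?q"
      using \<alpha> q by (intro Dcl_ge) auto
    also have "\<dots> \<le> Dtest \<alpha> (tpow n \<rho>) (tpow n \<sigma>)"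
      unfolding Dtest_def using T \<rho> by (intro SUP_upper) auto
    finally have "ereal (1 / real n) * ereal (ln (2 * q powr (n / 2)) / (\<alpha> - 1))
        \<le> ereal (1 / real n) * Dtest \<alpha> (tpow n \<rho>) (tpow n \<sigma>)"
      by (rule ereal_mult_left_mono) simp
    moreover have "1 / real n * (ln (2 * q powr (n / 2)) / (\<alpha> - 1)) = (ln 2 / real n + ln q / 2) / (\<alpha> - 1)"
      using n q by (simp add: ln_mult ln_powr add_divide_distrib)
    ultimately show ?thesis by simp
  qed
  have "(\<lambda>n. ln 2 / real (Suc n)) \<longlonglongrightarrow> 0"
    by (rule LIMSEQ_Suc[OF lim_const_over_n])
  then have "(\<lambda>n. (ln 2 / real (Suc n) + ln q / 2) / (\<alpha> - 1)) \<longlonglongrightarrow> (0 + ln q / 2) / (\<alpha> - 1)"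
    using \<alpha> by (intro tendsto_intros) auto
  then have "limsup (\<lambda>n. ereal ((ln 2 / real (Suc n) + ln q / 2) / (\<alpha> - 1))) = ereal ((0 + ln q / 2) / (\<alpha> - 1))"
    by (intro lim_imp_Limsup tendsto_ereal) auto
  also have "\<dots> = ereal (1/2) * Dpetz \<alpha> \<rho> \<sigma>"
    using q by (simp add: Dpetz_eq q_def[symmetric])
  finally have "ereal (1/2) * Dpetz \<alpha> \<rho> \<sigma> = limsup (\<lambda>n. ereal ((ln 2 / real (Suc n) + ln q / 2) / (\<alpha> - 1)))" ..
  also have "\<dots> \<le> Dtest_bar \<alpha> \<rho> \<sigma>"
    unfolding Dtest_bar_def by (intro Limsup_mono always_eventually allI bound) simp
  finally show ?thesis .
qed

end

lemma density_imp_state_pair: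
  assumes "density d \<rho>" "density d \<sigma>"
  obtains U V r s where "state_pair d \<rho> \<sigma> U V r s"
proof -
  have a: "psd \<rho>" "\<rho> \<in> carrier_mat d d" "psd \<sigma>" "\<sigma> \<in> carrier_mat d d" "mtrace \<rho> = 1" "mtrace \<sigma> = 1"
    using assms by (auto simp: density_def)
  obtain U r where U: "U \<in> carrier_mat d d" "unitary U" "\<rho> = U * diagm d (\<lambda>i. complex_of_real (r i)) * adj U" "\<And>i. 0 \<le> r i"
    using psd_spectral[OF a(1,2)] by blast
  obtain V s where V: "V \<in> carrier_mat d d" "unitary V" "\<sigma> = V * diagm d (\<lambda>i. complex_of_real (s i)) * adj V" "\<And>i. 0 \<le> s i"
    using psd_spectral[OF a(3,4)] by blast
  show ?thesis by (rule that[of U V r s], unfold_locales) (fact U V a)+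
qed

theorem mainTheorem2:
  fixes d :: nat and \<rho> \<sigma> :: "complex mat"
  assumes "density d \<rho>" and "density d \<sigma>"
  shows "(\<forall>\<alpha>\<in>{0<..<1::real}. ereal (1/2) * Dpetz \<alpha> \<rho> \<sigma> \<le> Dtest_bar \<alpha> \<rho> \<sigma>
                          \<and> Dtest_bar \<alpha> \<rho> \<sigma> \<le> Dpetz \<alpha> \<rho> \<sigma>)
       \<and> ((\<forall>\<alpha>\<in>{0<..<1::real}. Dtest_bar \<alpha> \<rho> \<sigma> < Dpetz \<alpha> \<rho> \<sigma>)
            \<longleftrightarrow> (\<exists>\<alpha>\<in>{0<..<1::real}. Dtest_bar \<alpha> \<rho> \<sigma> < Dpetz \<alpha> \<rho> \<sigma>))
       \<and> ((\<exists>\<alpha>\<in>{0<..<1::real}. Dtest_bar \<alpha> \<rho> \<sigma> < Dpetz \<alpha> \<rho> \<sigma>)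
            \<longleftrightarrow> (\<exists>\<alpha>\<in>{0<..<1::real}. \<exists>n::nat. n \<ge> 1 \<and>
                   ereal (1 / real n) * Dtest \<alpha> (tpow n \<rho>) (tpow n \<sigma>) < Dpetz \<alpha> \<rho> \<sigma>))
       \<and> ((\<exists>\<alpha>\<in>{0<..<1::real}. Dtest_bar \<alpha> \<rho> \<sigma> < Dpetz \<alpha> \<rho> \<sigma>)
            \<longleftrightarrow> (strict_mono_on {0<..<1::real} (\<lambda>\<beta>. Dpetz \<beta> \<rho> \<sigma>)
                 \<and> strict_mono_on {0<..<1::real} (\<lambda>\<beta>. Dpetz \<beta> \<sigma> \<rho>)))"
proof -
  obtain U V r s where "state_pair d \<rho> \<sigma> U V r s"
    using density_imp_state_pair[OF assms] by blast
  then interpret state_pair d \<rho> \<sigma> U V r s .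
  let ?mono = "strict_mono_on {0<..<1::real} (\<lambda>\<beta>. Dpetz \<beta> \<rho> \<sigma>) \<and> strict_mono_on {0<..<1::real} (\<lambda>\<beta>. Dpetz \<beta> \<sigma> \<rho>)"
  let ?all = "\<forall>\<alpha>\<in>{0<..<1::real}. Dtest_bar \<alpha> \<rho> \<sigma> < Dpetz \<alpha> \<rho> \<sigma>"
  let ?some = "\<exists>\<alpha>\<in>{0<..<1::real}. Dtest_bar \<alpha> \<rho> \<sigma> < Dpetz \<alpha> \<rho> \<sigma>"
  let ?finite = "\<exists>\<alpha>\<in>{0<..<1::real}. \<exists>n::nat. n \<ge> 1 \<and>
                   ereal (1 / real n) * Dtest \<alpha> (tpow n \<rho>) (tpow n \<sigma>) < Dpetz \<alpha> \<rho> \<sigma>"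
  \<comment> \<open>The four conditions are linked in a cycle, in which only the first and the last
    implication use the analysis of \<open>Q\<close>.\<close>
  have "?mono \<Longrightarrow> ?all" using Dtest_bar_less_Dpetz by auto
  moreover have "?all \<Longrightarrow> ?some" by (rule bexI[of _ "1/2"]) auto
  moreover have "?some \<Longrightarrow> ?finite"
  proof -
    assume ?some
    then obtain \<alpha> where \<alpha>: "\<alpha> \<in> {0<..<1}" "Dtest_bar \<alpha> \<rho> \<sigma> < Dpetz \<alpha> \<rho> \<sigma>" by blast
    from \<alpha>(2) have "\<forall>\<^sub>F n in sequentially. ereal (1 / real (Suc n)) * Dtest \<alpha> (tpow (Suc n) \<rho>) (tpow (Suc n) \<sigma>) < Dpetz \<alpha> \<rho> \<sigma>"
      unfolding Dtest_bar_def by (rule Limsup_lessD)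
    then obtain n where "ereal (1 / real (Suc n)) * Dtest \<alpha> (tpow (Suc n) \<rho>) (tpow (Suc n) \<sigma>) < Dpetz \<alpha> \<rho> \<sigma>"
      unfolding eventually_sequentially by blast
    then show ?finite using \<alpha>(1) by (intro bexI[of _ \<alpha>] exI[of _ "Suc n"]) auto
  qed
  moreover have "?finite \<Longrightarrow> ?mono" using Dpetz_le_Dtest by (metis not_less)
  ultimately show ?thesis
    using half_Dpetz_le_Dtest_bar Dtest_bar_le_Dpetz by (auto simp del: tpow.simps)
qed

end
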